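(* Let $\boldsymbol\kappa=(r,r',\varrho,\theta)$ be positive constants with $0<\theta<\pi/2$, $0<\varrho<1$, $0<r<\varrho r'$, and let $\widetilde{\boldsymbol\kappa}=(\tilde r,\tilde r',\tilde\varrho,\tilde\theta)$ be positive constants with $\tilde\theta<\pi/2$, $\tilde\varrho<1$, $\tilde r<\tilde\varrho\tilde r'$ and $$\tilde r<r,\qquad \tilde r'<\frac{r'}2,\qquad \tilde\theta<\frac\theta4,\qquad \tilde\varrho<\frac\varrho2\sin\frac\theta4 .$$ Then the bilinear morphism $$\mu:E^{\mathbb R}_X(\boldsymbol\kappa)\otimes_{\mathbb C}C^{\mathbb R}_{Y|X}(\boldsymbol\kappa)\to C^{\mathbb R}_{Y|X}(\widetilde{\boldsymbol\kappa})$$ defined, for $K(z,w)\,dw=[\psi(z,w,\eta)\,dw]$ and $f(z)=[u(z,\eta)]$, by $$K\,dw\otimes f=[\psi(z,w,\eta)\,dw]\otimes[u(z,\eta)]\ \longmapsto\ \mu(K\,dw\otimes f):=\Bigl[\int_{\gamma(z,\eta;\varrho,\theta)}\psi(z,w,\eta)\,u(w,\eta)\,dw\Bigr]$$ is well defined. In particular, there exists the linear morphism $$\mu_K:C^{\mathbb R}_{Y|X}(\boldsymbol\kappa)\ni f\mapsto\mu(K\,dw\otimes f)\in C^{\mathbb R}_{Y|X}(\widetilde{\boldsymbol\kappa}).$$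
   Context: $X=\mathbb C^n$, $1\le d\le n$, $Y=\{z_1=\dots=z_d=0\}$, $\widehat X=X\times\mathbb C\ni(z,\eta)$, $\widehat X^2=X\times X\times\mathbb C\ni(z,w,\eta)$, $\|z\|=\max_i|z_i|$. $\mathscr O$ is the sheaf of holomorphic functions; $\mathscr O^{(0,n,0)}_{\widehat X^2}$ the sheaf of holomorphic $n$-forms with respect to $dw_1,\dots,dw_n$. For a tuple $\boldsymbol\kappa=(r,r',\varrho,\theta)$ as in the claim set $S_{\boldsymbol\kappa}=\{\eta\in\mathbb C;\ 0<|\eta|<r,\ |\arg\eta|<\theta/4\}$. Sets for $Y$: $\widehat U_{\boldsymbol\kappa}=\{(z,\eta)\in X\times S_{\boldsymbol\kappa};\ |z_1|<\varrho|\eta|,\ |z_i|<r'\ (2\le i\le n)\}$, $\widehat V^{(1)}_{\boldsymbol\kappa}=\{(z,\eta)\in\widehat U_{\boldsymbol\kappa};\ \frac\pi2-\theta<\arg z_1<\frac{3\pi}2+\theta\}$, $\widehat V^{(i)}_{\boldsymbol\kappa}=\{(z,\eta)\in\widehat U_{\boldsymbol\kappa};\ \varrho|z_i|>|\eta|\}$ ($2\le i\le d$). Sets for the diagonal: $\widehat U_{\Delta,\boldsymbol\kappa}=\{(z,w,\eta);\ \|z\|<r',\ \eta\in S_{\boldsymbol\kappa},\ |z_1-w_1|<\varrho|\eta|,\ |z_i-w_i|<r'\ (2\le i\le n)\}$, $\widehat V^{(1)}_{\Delta,\boldsymbol\kappa}=\{(z,w,\eta)\in\widehat U_{\Delta,\boldsymbol\kappa};\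 \frac\pi2-\theta<\arg(z_1-w_1)<\frac{3\pi}2+\theta\}$, $\widehat V^{(i)}_{\Delta,\boldsymbol\kappa}=\{(z,w,\eta)\in\widehat U_{\Delta,\boldsymbol\kappa};\ \varrho|z_i-w_i|>|\eta|\}$ ($2\le i\le n$). For a set $\alpha$ of indices, $V^{(\alpha)}$ denotes the intersection of the $V^{(i)}$, $i\in\alpha$ (equal to the ambient $\widehat U$ if $\alpha=\emptyset$); $*$ denotes the full index set ($\{1,\dots,d\}$, resp. $\{1,\dots,n\}$), and $\mathcal P_m^\vee$ the set of subsets of $\{1,\dots,m\}$ with $m-1$ elements. Define $$C^{\mathbb R}_{Y|X}(\boldsymbol\kappa)=\Bigl\{u\in\Gamma(\widehat V^{( * )}_{\boldsymbol\kappa};\mathscr O_{\widehat X})\Big/\sum_{\alpha\in\mathcal P_d^\vee}\Gamma(\widehat V^{(\alpha)}_{\boldsymbol\kappa};\mathscr O_{\widehat X});\ \partial_\eta u=0\Bigr\},$$ $$E^{\mathbb R}_{X}(\boldsymbol\kappa)=\Bigl\{K\in\Gamma(\widehat V^{( * )}_{\Delta,\boldsymbol\kappa};\mathscr O^{(0,n,0)}_{\widehat X^2})\Big/\sum_{\alpha\in\mathcal P_n^\vee}\Gamma(\widehat V^{(\alpha)}_{\Delta,\boldsymbol\kappa};\mathscr O^{(0,n,0)}_{\widehat X^2});\ \partial_\eta K=0\Bigr\}.$$ Path of integration: let $\beta_0=\frac\varrho2e^{-\sqrt{-1}(\pi+\theta)/2}$, $\beta_1=\frac\varrho2e^{\sqrt{-1}(\pi+\theta)/2}$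 and let $\varepsilon>0$ be sufficiently small. $\gamma_1(z,\eta;\varrho,\theta)\subset\mathbb C_{w_1}$ is the path joining $z_1+\beta_0\eta$ to $z_1+\beta_1\eta$ made of the segment $w_1=z_1+t\beta_0\eta$ ($t$ from $1$ to $\varepsilon$), the arc $w_1=z_1+\frac{\varepsilon\varrho\eta}2e^{\sqrt{-1}(\pi+\theta)t/2}$ ($-1\le t\le1$), and the segment $w_1=z_1+t\beta_1\eta$ ($t$ from $\varepsilon$ to $1$). For $2\le i\le n$, $\gamma_i(z,\eta;\varrho)$ is the circle $w_i=z_i+(\frac{|\eta|}\varrho+\varepsilon)e^{2\pi\sqrt{-1}t}$, $0\le t\le1$. Then $\gamma(z,\eta;\varrho,\theta)=\gamma_1(z,\eta;\varrho,\theta)\times\gamma_2(z,\eta;\varrho)\times\dots\times\gamma_n(z,\eta;\varrho)$. *)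

theory Defs
  imports "HOL-Complex_Analysis.Contour_Integration"
begin

section \<open>Holomorphic functions of several variables\<close>

class cscale =
  fixes scaleC :: "complex \<Rightarrow> 'a \<Rightarrow> 'a" (infixr "*\<^sub>C" 75)

instantiation complex :: cscale
begin
definition scaleC_complex :: "complex \<Rightarrow> complex \<Rightarrow> complex" where
  "scaleC_complex c x = c * x"
instance ..
end

instantiation vec :: (cscale, finite) cscale
begin
definition scaleC_vec :: "complex \<Rightarrow> 'a ^ 'b \<Rightarrow> 'a ^ 'b" where
  "scaleC_vec c x = (\<chi> i. c *\<^sub>C (x $ i))"
instance ..
end

instantiation prod :: (cscale, cscale) cscale
begin
definition scaleC_prod :: "complex \<Rightarrow> 'a \<times> 'b \<Rightarrow> 'a \<times> 'b" where
  "scaleC_prod c p = (c *\<^sub>C fst p, c *\<^sub>C snd p)"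
instance ..
end

text \<open>Sections of the sheaf of holomorphic functions over an open set \<open>V\<close>, represented by total
  functions whose values outside \<open>V\<close> are irrelevant: complex differentiability means that the
  Frechet derivative exists and is complex linear.\<close>

definition hol_sections :: "'a::{real_normed_vector,cscale} set \<Rightarrow> ('a \<Rightarrow> complex) set" where
  "hol_sections V = {f. \<forall>p\<in>V. \<exists>D. (f has_derivative D) (at p) \<and> (\<forall>c v. D (c *\<^sub>C v) = c * D v)}"

section \<open>The quotient spaces\<close>

definition cover_inter :: "'a set \<Rightarrow> (nat \<Rightarrow> 'a set) \<Rightarrow> nat set \<Rightarrow> 'a set" where
  "cover_inter U V \<alpha> = U \<inter> (\<Inter>i\<in>\<alpha>. V i)"

definition P_vee :: "nat \<Rightarrow> nat set set" where
  "P_vee m = {\<alpha>. \<alpha> \<subseteq> {1..m} \<and> card \<alpha> = m - 1}"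

text \<open>Congruence modulo the sum of the spaces of sections over the \<open>V\<^sup>(\<^sup>\<alpha>\<^sup>)\<close>. Functions that agree on
  \<open>V\<^sup>(\<^sup>*\<^sup>)\<close> are congruent, so the choice of values outside \<open>V\<^sup>(\<^sup>*\<^sup>)\<close> does not affect the quotient.\<close>

definition quot_rel ::
  "'a::{real_normed_vector,cscale} set \<Rightarrow> (nat \<Rightarrow> 'a set) \<Rightarrow> nat \<Rightarrow> (('a \<Rightarrow> complex) \<times> ('a \<Rightarrow> complex)) set"
  where
  "quot_rel U V m =
    {(u, v). u \<in> hol_sections (cover_inter U V {1..m}) \<and> v \<in> hol_sections (cover_inter U V {1..m}) \<and>
       (\<exists>h. (\<forall>\<alpha>\<in>P_vee m. h \<alpha> \<in> hol_sections (cover_inter U V \<alpha>)) \<and>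
            (\<forall>p\<in>cover_inter U V {1..m}. u p - v p = (\<Sum>\<alpha>\<in>P_vee m. h \<alpha> p)))}"

definition class_add ::
  "(('a \<Rightarrow> complex) \<times> ('a \<Rightarrow> complex)) set \<Rightarrow> ('a \<Rightarrow> complex) set \<Rightarrow> ('a \<Rightarrow> complex) set \<Rightarrow> ('a \<Rightarrow> complex) set"
  where
  "class_add R A B = (\<Union>u\<in>A. \<Union>v\<in>B. R `` {\<lambda>p. u p + v p})"

definition class_scale ::
  "(('a \<Rightarrow> complex) \<times> ('a \<Rightarrow> complex)) set \<Rightarrow> complex \<Rightarrow> ('a \<Rightarrow> complex) set \<Rightarrow> ('a \<Rightarrow> complex) set"
  where
  "class_scale R c A = (\<Union>u\<in>A. R `` {\<lambda>p. c * u p})"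

definition d_eta :: "('b \<times> complex \<Rightarrow> complex) \<Rightarrow> 'b \<times> complex \<Rightarrow> complex" where
  "d_eta u = (\<lambda>(x, \<eta>). deriv (\<lambda>s. u (x, s)) \<eta>)"

definition class_d_eta ::
  "(('b \<times> complex \<Rightarrow> complex) \<times> ('b \<times> complex \<Rightarrow> complex)) set \<Rightarrow>
    ('b \<times> complex \<Rightarrow> complex) set \<Rightarrow> ('b \<times> complex \<Rightarrow> complex) set" where
  "class_d_eta R A = (\<Union>u\<in>A. R `` {d_eta u})"

definition eta_constant_classes ::
  "('b::{real_normed_vector,cscale} \<times> complex) set \<Rightarrow> (nat \<Rightarrow> ('b \<times> complex) set) \<Rightarrow> nat \<Rightarrow>
    ('b \<times> complex \<Rightarrow> complex) set set" where
  "eta_constant_classes U V m =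
    {A \<in> hol_sections (cover_inter U V {1..m}) // quot_rel U V m.
       class_d_eta (quot_rel U V m) A = quot_rel U V m `` {\<lambda>p. 0}}"

definition linear_classes ::
  "(('a \<Rightarrow> complex) \<times> ('a \<Rightarrow> complex)) set \<Rightarrow> ('a \<Rightarrow> complex) set set \<Rightarrow>
   (('b \<Rightarrow> complex) \<times> ('b \<Rightarrow> complex)) set \<Rightarrow> ('b \<Rightarrow> complex) set set \<Rightarrow>
   (('a \<Rightarrow> complex) set \<Rightarrow> ('b \<Rightarrow> complex) set) \<Rightarrow> bool" where
  "linear_classes R C R' C' \<phi> \<longleftrightarrow>
     (\<forall>f\<in>C. \<phi> f \<in> C') \<and>
     (\<forall>f\<in>C. \<forall>g\<in>C. \<phi> (class_add R f g) = class_add R' (\<phi> f) (\<phi> g)) \<and>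
     (\<forall>c. \<forall>f\<in>C. \<phi> (class_scale R c f) = class_scale R' c (\<phi> f))"

section \<open>The sets attached to \<open>Y\<close> and to the diagonal\<close>

text \<open>Throughout, \<open>e\<close> enumerates the coordinates of \<open>complex ^ 'n\<close>, so the \<open>i\<close>-th coordinate
  (\<open>1 \<le> i \<le> n = CARD('n)\<close>) of \<open>z\<close> is \<open>z $ e i\<close>. A parameter tuple is \<open>(r, r', \<rho>, \<theta>)\<close>.
  Points of \<open>X \<times> X \<times> \<complex>\<close> are written \<open>((z, w), \<eta>)\<close>.\<close>

type_synonym kappa = "real \<times> real \<times> real \<times> real"

fun S_kappa :: "kappa \<Rightarrow> complex set" where
  "S_kappa (r, r', \<rho>, \<theta>) = {\<eta>. 0 < cmod \<eta> \<and> cmod \<eta> < r \<and> \<bar>Arg \<eta>\<bar> < \<theta> / 4}"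

text \<open>The condition \<open>a < arg x < b\<close> (which forces \<open>x \<noteq> 0\<close>) for some determination of the argument;
  the principal value \<open>Arg\<close> would be wrong for intervals reaching beyond \<open>\<pi>\<close>.\<close>

definition arg_between :: "real \<Rightarrow> real \<Rightarrow> complex set" where
  "arg_between a b = {x. \<exists>\<rho> \<phi>. 0 < \<rho> \<and> a < \<phi> \<and> \<phi> < b \<and> x = rcis \<rho> \<phi>}"

fun U_Y :: "(nat \<Rightarrow> 'n::finite) \<Rightarrow> kappa \<Rightarrow> ((complex ^ 'n) \<times> complex) set" where
  "U_Y e (r, r', \<rho>, \<theta>) =
    {(z, \<eta>). \<eta> \<in> S_kappa (r, r', \<rho>, \<theta>) \<and> cmod (z $ e 1) < \<rho> * cmod \<eta> \<and>
       (\<forall>i\<in>{2..CARD('n)}. cmod (z $ e i) < r')}"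

fun V_Y :: "(nat \<Rightarrow> 'n::finite) \<Rightarrow> kappa \<Rightarrow> nat \<Rightarrow> ((complex ^ 'n) \<times> complex) set" where
  "V_Y e (r, r', \<rho>, \<theta>) i =
    {(z, \<eta>) \<in> U_Y e (r, r', \<rho>, \<theta>).
       if i = 1 then z $ e 1 \<in> arg_between (pi / 2 - \<theta>) (3 * pi / 2 + \<theta>)
       else cmod \<eta> < \<rho> * cmod (z $ e i)}"

fun U_diag :: "(nat \<Rightarrow> 'n::finite) \<Rightarrow> kappa \<Rightarrow> (((complex ^ 'n) \<times> (complex ^ 'n)) \<times> complex) set" where
  "U_diag e (r, r', \<rho>, \<theta>) =
    {((z, w), \<eta>). (\<forall>i\<in>{1..CARD('n)}. cmod (z $ e i) < r') \<and> \<eta> \<in> S_kappa (r, r', \<rho>, \<theta>) \<and>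
       cmod (z $ e 1 - w $ e 1) < \<rho> * cmod \<eta> \<and>
       (\<forall>i\<in>{2..CARD('n)}. cmod (z $ e i - w $ e i) < r')}"

fun V_diag ::
  "(nat \<Rightarrow> 'n::finite) \<Rightarrow> kappa \<Rightarrow> nat \<Rightarrow> (((complex ^ 'n) \<times> (complex ^ 'n)) \<times> complex) set" where
  "V_diag e (r, r', \<rho>, \<theta>) i =
    {((z, w), \<eta>) \<in> U_diag e (r, r', \<rho>, \<theta>).
       if i = 1 then z $ e 1 - w $ e 1 \<in> arg_between (pi / 2 - \<theta>) (3 * pi / 2 + \<theta>)
       else cmod \<eta> < \<rho> * cmod (z $ e i - w $ e i)}"

definition V_Y_star :: "(nat \<Rightarrow> 'n::finite) \<Rightarrow> nat \<Rightarrow> kappa \<Rightarrow> ((complex ^ 'n) \<times> complex) set" where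
  "V_Y_star e d \<kappa> = cover_inter (U_Y e \<kappa>) (V_Y e \<kappa>) {1..d}"

definition V_diag_star ::
  "(nat \<Rightarrow> 'n::finite) \<Rightarrow> kappa \<Rightarrow> (((complex ^ 'n) \<times> (complex ^ 'n)) \<times> complex) set" where
  "V_diag_star e \<kappa> = cover_inter (U_diag e \<kappa>) (V_diag e \<kappa>) {1..CARD('n)}"

definition CR_rel :: "(nat \<Rightarrow> 'n::finite) \<Rightarrow> nat \<Rightarrow> kappa \<Rightarrow>
    (((complex ^ 'n) \<times> complex \<Rightarrow> complex) \<times> ((complex ^ 'n) \<times> complex \<Rightarrow> complex)) set" where
  "CR_rel e d \<kappa> = quot_rel (U_Y e \<kappa>) (V_Y e \<kappa>) d"

definition CR :: "(nat \<Rightarrow> 'n::finite) \<Rightarrow> nat \<Rightarrow> kappa \<Rightarrow> ((complex ^ 'n) \<times> complex \<Rightarrow> complex) set set" where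
  "CR e d \<kappa> = eta_constant_classes (U_Y e \<kappa>) (V_Y e \<kappa>) d"

text \<open>A form \<open>\<psi> dw\<^sub>1 \<and> \<dots> \<and> dw\<^sub>n\<close> is represented by its coefficient \<open>\<psi>\<close>.\<close>

definition ER_rel :: "(nat \<Rightarrow> 'n::finite) \<Rightarrow> kappa \<Rightarrow>
    ((((complex ^ 'n) \<times> (complex ^ 'n)) \<times> complex \<Rightarrow> complex) \<times>
     (((complex ^ 'n) \<times> (complex ^ 'n)) \<times> complex \<Rightarrow> complex)) set" where
  "ER_rel e \<kappa> = quot_rel (U_diag e \<kappa>) (V_diag e \<kappa>) CARD('n)"

definition ER :: "(nat \<Rightarrow> 'n::finite) \<Rightarrow> kappa \<Rightarrow>
    (((complex ^ 'n) \<times> (complex ^ 'n)) \<times> complex \<Rightarrow> complex) set set" where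
  "ER e \<kappa> = eta_constant_classes (U_diag e \<kappa>) (V_diag e \<kappa>) CARD('n)"

section \<open>The integral over \<open>\<gamma>\<close>\<close>

text \<open>The arc is reparametrised from \<open>[-1, 1]\<close> to \<open>[0, 1]\<close>, as \<open>(+++)\<close> requires.\<close>

definition gamma_first :: "real \<Rightarrow> complex \<Rightarrow> complex \<Rightarrow> real \<Rightarrow> real \<Rightarrow> real \<Rightarrow> complex" where
  "gamma_first \<epsilon> z1 \<eta> \<rho> \<theta> =
    (let \<beta>0 = of_real (\<rho> / 2) * cis (- (pi + \<theta>) / 2);
         \<beta>1 = of_real (\<rho> / 2) * cis ((pi + \<theta>) / 2)
     in linepath (z1 + \<beta>0 * \<eta>) (z1 + of_real \<epsilon> * \<beta>0 * \<eta>) +++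
        ((\<lambda>t. z1 + of_real (\<epsilon> * \<rho> / 2) * \<eta> * cis ((pi + \<theta>) * (2 * t - 1) / 2)) +++
         linepath (z1 + of_real \<epsilon> * \<beta>1 * \<eta>) (z1 + \<beta>1 * \<eta>)))"

fun gamma_path :: "(nat \<Rightarrow> 'n::finite) \<Rightarrow> kappa \<Rightarrow> real \<Rightarrow> (complex ^ 'n) \<Rightarrow> complex \<Rightarrow> nat \<Rightarrow> real \<Rightarrow> complex"
  where
  "gamma_path e (r, r', \<rho>, \<theta>) \<epsilon> z \<eta> i =
    (if i = 1 then gamma_first \<epsilon> (z $ e 1) \<eta> \<rho> \<theta>
     else circlepath (z $ e i) (cmod \<eta> / \<rho> + \<epsilon>))"

definition gamma_image :: "(nat \<Rightarrow> 'n::finite) \<Rightarrow> kappa \<Rightarrow> real \<Rightarrow> (complex ^ 'n) \<Rightarrow> complex \<Rightarrow> (complex ^ 'n) set"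
  where
  "gamma_image e \<kappa> \<epsilon> z \<eta> =
    {w. \<forall>i\<in>{1..CARD('n)}. w $ e i \<in> path_image (gamma_path e \<kappa> \<epsilon> z \<eta> i)}"

text \<open>\<open>prod_path_integral e g k F w\<close> is the integral of \<open>F dw\<^sub>1 \<and> \<dots> \<and> dw\<^sub>k\<close> over
  \<open>g 1 \<times> \<dots> \<times> g k\<close> as an iterated contour integral, the remaining coordinates being frozen
  at those of \<open>w\<close>. For \<open>k = n\<close> there are no remaining coordinates and \<open>w\<close> plays no role.\<close>

primrec prod_path_integral ::
  "(nat \<Rightarrow> 'n::finite) \<Rightarrow> (nat \<Rightarrow> real \<Rightarrow> complex) \<Rightarrow> nat \<Rightarrow> ((complex ^ 'n) \<Rightarrow> complex) \<Rightarrow> (complex ^ 'n) \<Rightarrow> complex"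
  where
  "prod_path_integral e g 0 F w = F w"
| "prod_path_integral e g (Suc k) F w =
     contour_integral (g (Suc k))
       (\<lambda>x. prod_path_integral e g k F (\<chi> j. if j = e (Suc k) then x else w $ j))"

definition gamma_integral ::
  "(nat \<Rightarrow> 'n::finite) \<Rightarrow> kappa \<Rightarrow> real \<Rightarrow> (((complex ^ 'n) \<times> (complex ^ 'n)) \<times> complex \<Rightarrow> complex) \<Rightarrow>
    ((complex ^ 'n) \<times> complex \<Rightarrow> complex) \<Rightarrow> (complex ^ 'n) \<Rightarrow> complex \<Rightarrow> complex" where
  "gamma_integral e \<kappa> \<epsilon> \<psi> u z \<eta> =
     prod_path_integral e (gamma_path e \<kappa> \<epsilon> z \<eta>) CARD('n) (\<lambda>w. \<psi> ((z, w), \<eta>) * u (w, \<eta>)) 0"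

text \<open>How small \<open>\<epsilon>\<close> has to be depends on the point \<open>(z, \<eta>)\<close>; the value taken is the one shared by all
  sufficiently small \<open>\<epsilon>\<close>.\<close>

definition mu_rep ::
  "(nat \<Rightarrow> 'n::finite) \<Rightarrow> kappa \<Rightarrow> (((complex ^ 'n) \<times> (complex ^ 'n)) \<times> complex \<Rightarrow> complex) \<Rightarrow>
    ((complex ^ 'n) \<times> complex \<Rightarrow> complex) \<Rightarrow> (complex ^ 'n) \<times> complex \<Rightarrow> complex" where
  "mu_rep e \<kappa> \<psi> u = (\<lambda>(z, \<eta>). THE c. \<forall>\<^sub>F \<epsilon> in at_right 0. gamma_integral e \<kappa> \<epsilon> \<psi> u z \<eta> = c)"

definition mu ::
  "(nat \<Rightarrow> 'n::finite) \<Rightarrow> nat \<Rightarrow> kappa \<Rightarrow> kappa \<Rightarrow>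
    (((complex ^ 'n) \<times> (complex ^ 'n)) \<times> complex \<Rightarrow> complex) set \<Rightarrow>
    ((complex ^ 'n) \<times> complex \<Rightarrow> complex) set \<Rightarrow> ((complex ^ 'n) \<times> complex \<Rightarrow> complex) set" where
  "mu e d \<kappa> \<kappa>' K f = (\<Union>\<psi>\<in>K. \<Union>u\<in>f. CR_rel e d \<kappa>' `` {mu_rep e \<kappa> \<psi> u})"

end

theory Submission
  imports Defs "HOL-Complex_Analysis.Cauchy_Integral_Formula"
begin

text \<open>
  The substitution \<open>w\<^sub>1 = z\<^sub>1 + \<eta> x\<^sub>1\<close>, \<open>w\<^sub>i = z\<^sub>i + x\<^sub>i\<close> (\<open>i \<ge> 2\<close>) turns the integral over \<open>\<gamma> (z, \<eta>)\<close> into \<open>\<eta>\<close> times an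
  integral over a product of a path that does not depend on \<open>(z, \<eta>)\<close> and of circles of radius
  \<open>|\<eta>| / \<rho> + \<epsilon>\<close>. For fixed \<open>(z, \<eta>)\<close> the domain of the integrand contains a product of open sets, one for each
  coordinate (\<open>fibre_admissible\<close>), so the paths can be deformed one coordinate at a time
  (\<open>prod_path_integral_deform\<close>). Hence the value does not depend on small \<open>\<epsilon>\<close>, and near a given point the
  circles can be replaced by circles of fixed radius (\<open>locally_deformable_local\<close>). Holomorphy in \<open>(z, \<eta>)\<close> then
  follows from holomorphic dependence of contour integrals on parameters (\<open>contour_integral_param\<close>,
  \<open>prod_path_integral_hol\<close>), which is derived from the Cauchy estimates on complex lines.

  The position of the cycle is controlled by describing the sector, which is larger than a half plane, as the
  union of two half planes. Its complement is a convex cone, and this is why the segments of the first path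
  stay in the sector when \<open>z\<^sub>1\<close> lies in the sector for \<open>\<kappa>'\<close>.

  Independence of the representatives has two parts. If \<open>u\<close> extends to \<open>V\<^sup>(\<^sup>\<alpha>\<^sup>)\<close>, so does the integral, over the
  same cycle (\<open>mu_rep_hol\<close>). If \<open>\<psi>\<close> is free of the condition on \<open>z\<^sub>j - w\<^sub>j\<close> for some \<open>j \<ge> 2\<close>, the \<open>j\<close>-th circle
  contracts and the integral vanishes (\<open>mu_rep_null\<close>); if it is free of the condition on \<open>arg (z\<^sub>1 - w\<^sub>1)\<close>, the
  first path can be pulled across \<open>z\<^sub>1\<close> to the chord joining its end points (\<open>mu_rep_chord\<close>), and the integral over
  the chord is defined without any condition on \<open>arg z\<^sub>1\<close>.

  The derivative of the integral along \<open>\<eta>\<close> is the sum of the integrals of \<open>(\<partial>\<^sub>\<eta> \<psi>) u\<close> and \<open>\<psi> \<partial>\<^sub>\<eta> u\<close> and of a boundary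
  term from the end points of the first path (\<open>d_eta_mu_rep\<close>). The first two are null because the classes of
  \<open>\<psi>\<close> and \<open>u\<close> are constant along \<open>\<eta>\<close>; the boundary term is null because the end points are admissible whatever
  the argument of \<open>z\<^sub>1\<close>, so that it extends to \<open>V\<^sup>(\<^sup>{\<^sup>2\<^sup>,\<^sup>\<dots>\<^sup>,\<^sup>d\<^sup>}\<^sup>)\<close>.
\<close>

section \<open>Complex differentiable maps between complex normed spaces\<close>

text \<open>Complex scalar multiplication on real normed spaces, with the norm homogeneous over the complex numbers.\<close>

class cnormed = real_normed_vector + cscale +
  assumes scaleC_add_right: "c *\<^sub>C (x + y) = c *\<^sub>C x + c *\<^sub>C y"
    and scaleC_add_left: "(c + c') *\<^sub>C x = c *\<^sub>C x + c' *\<^sub>C x"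
    and scaleC_scaleC: "c *\<^sub>C c' *\<^sub>C x = (c * c') *\<^sub>C x"
    and scaleC_of_real: "of_real a *\<^sub>C x = a *\<^sub>R x"
    and norm_scaleC: "norm (c *\<^sub>C x) = cmod c * norm x"

instance complex :: cnormed
  by standard (auto simp: scaleC_complex_def algebra_simps norm_mult scaleR_conv_of_real)

instance prod :: (cnormed, cnormed) cnormed
proof
  fix c :: complex and x :: "'a \<times> 'b"
  have "norm (c *\<^sub>C x) = sqrt ((cmod c)\<^sup>2 * ((norm (fst x))\<^sup>2 + (norm (snd x))\<^sup>2))"
    by (simp add: scaleC_prod_def norm_Pair norm_scaleC power_mult_distrib distrib_left)
  then show "norm (c *\<^sub>C x) = cmod c * norm x"
    by (simp add: real_sqrt_mult norm_prod_def)
qed (auto simp: scaleC_prod_def scaleC_add_right scaleC_add_left scaleC_scaleC scaleC_of_real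
      scaleR_prod_def)

instance vec :: (cnormed, finite) cnormed
proof
  fix c :: complex and x :: "'a ^ 'b"
  show "norm (c *\<^sub>C x) = cmod c * norm x"
    by (simp add: scaleC_vec_def norm_vec_def norm_scaleC L2_set_right_distrib)
qed (auto simp: scaleC_vec_def vec_eq_iff scaleC_add_right scaleC_add_left scaleC_scaleC
      scaleC_of_real)

lemma scaleC_complex [simp]: "c *\<^sub>C (x::complex) = c * x"
  by (simp add: scaleC_complex_def)

lemma scaleC_Pair [simp]: "c *\<^sub>C (x, y) = (c *\<^sub>C x, c *\<^sub>C y)"
  by (simp add: scaleC_prod_def)

lemma scaleC_vec_nth [simp]: "(c *\<^sub>C x) $ i = c *\<^sub>C (x $ i)"
  by (simp add: scaleC_vec_def)

lemma scaleC_zero_left [simp]: "0 *\<^sub>C (x::'a::cnormed) = 0"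
  using norm_scaleC [of 0 x] by simp

lemma scaleC_zero_right [simp]: "c *\<^sub>C (0::'a::cnormed) = 0"
  using norm_scaleC [of c "0::'a"] by simp

lemma scaleC_one [simp]: "1 *\<^sub>C (x::'a::cnormed) = x"
  using scaleC_of_real [of 1 x] by simp

lemma scaleR_scaleC: "(a *\<^sub>R c) *\<^sub>C (x::'a::cnormed) = a *\<^sub>R (c *\<^sub>C x)"
  by (simp flip: scaleC_of_real add: scaleC_scaleC scaleR_conv_of_real)

lemma bounded_linear_scaleC_left: "bounded_linear (\<lambda>c. c *\<^sub>C (x::'a::cnormed))"
  by (rule bounded_linear_intro [where K = "norm x"])
     (auto simp: scaleC_add_left norm_scaleC scaleR_scaleC)

text \<open>Complex differentiability of a map between complex normed spaces: a real Frechet derivative that is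
  complex linear. Sections in \<open>hol_sections\<close> are the functions with this property at every point.\<close>

definition cdiff_at :: "('a::cnormed \<Rightarrow> 'b::cnormed) \<Rightarrow> 'a \<Rightarrow> bool" where
  "cdiff_at f p \<longleftrightarrow> (\<exists>D. (f has_derivative D) (at p) \<and> (\<forall>c v. D (c *\<^sub>C v) = c *\<^sub>C D v))"

lemma hol_sections_iff: "f \<in> hol_sections V \<longleftrightarrow> (\<forall>p\<in>V. cdiff_at f p)"
  by (simp add: hol_sections_def cdiff_at_def)

lemma cdiff_at_const: "cdiff_at (\<lambda>p. k) p"
  unfolding cdiff_at_def by (rule exI [of _ "\<lambda>v. 0"]) auto

lemma cdiff_at_add: "cdiff_at f p \<Longrightarrow> cdiff_at g p \<Longrightarrow> cdiff_at (\<lambda>p. f p + g p) p"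
  unfolding cdiff_at_def
proof safe
  fix D E assume "(f has_derivative D) (at p)" "(g has_derivative E) (at p)"
    "\<forall>c v. D (c *\<^sub>C v) = c *\<^sub>C D v" "\<forall>c v. E (c *\<^sub>C v) = c *\<^sub>C E v"
  then show "\<exists>D. ((\<lambda>p. f p + g p) has_derivative D) (at p) \<and> (\<forall>c v. D (c *\<^sub>C v) = c *\<^sub>C D v)"
    by (intro exI [of _ "\<lambda>v. D v + E v"]) (auto intro!: derivative_intros simp: scaleC_add_right)
qed

lemma cdiff_at_compose: "cdiff_at g p \<Longrightarrow> cdiff_at f (g p) \<Longrightarrow> cdiff_at (\<lambda>p. f (g p)) p"
  unfolding cdiff_at_def
proof safe
  fix D E assume "(g has_derivative D) (at p)" "(f has_derivative E) (at (g p))"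
    "\<forall>c v. D (c *\<^sub>C v) = c *\<^sub>C D v" "\<forall>c v. E (c *\<^sub>C v) = c *\<^sub>C E v"
  then show "\<exists>D. ((\<lambda>p. f (g p)) has_derivative D) (at p) \<and> (\<forall>c v. D (c *\<^sub>C v) = c *\<^sub>C D v)"
    by (intro exI [of _ "\<lambda>v. E (D v)"]) (simp add: has_derivative_compose [of g D p UNIV f E])
qed

lemma cdiff_at_Pair: "cdiff_at f p \<Longrightarrow> cdiff_at g p \<Longrightarrow> cdiff_at (\<lambda>p. (f p, g p)) p"
  unfolding cdiff_at_def
proof safe
  fix D E assume "(f has_derivative D) (at p)" "(g has_derivative E) (at p)"
    "\<forall>c v. D (c *\<^sub>C v) = c *\<^sub>C D v" "\<forall>c v. E (c *\<^sub>C v) = c *\<^sub>C E v"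
  then show "\<exists>D. ((\<lambda>p. (f p, g p)) has_derivative D) (at p) \<and> (\<forall>c v. D (c *\<^sub>C v) = c *\<^sub>C D v)"
    by (intro exI [of _ "\<lambda>v. (D v, E v)"]) (auto intro!: derivative_intros)
qed

lemma cdiff_at_bounded_linear:
  assumes "bounded_linear f" "\<And>c v. f (c *\<^sub>C v) = c *\<^sub>C f v"
  shows "cdiff_at f p"
  unfolding cdiff_at_def using assms by (intro exI [of _ f]) (auto intro: bounded_linear_imp_has_derivative)

lemma cdiff_at_ident: "cdiff_at (\<lambda>p. p) p"
  by (rule cdiff_at_bounded_linear) (auto simp: bounded_linear_ident)

lemma cdiff_at_fst: "cdiff_at f p \<Longrightarrow> cdiff_at (\<lambda>p. fst (f p)) p"
  by (rule cdiff_at_compose [of f p fst], assumption, rule cdiff_at_bounded_linear)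
     (auto simp: bounded_linear_fst scaleC_prod_def)

lemma cdiff_at_snd: "cdiff_at f p \<Longrightarrow> cdiff_at (\<lambda>p. snd (f p)) p"
  by (rule cdiff_at_compose [of f p snd], assumption, rule cdiff_at_bounded_linear)
     (auto simp: bounded_linear_snd scaleC_prod_def)

lemma cdiff_at_nth: "cdiff_at f p \<Longrightarrow> cdiff_at (\<lambda>p. f p $ i) p"
  by (rule cdiff_at_compose [of f p "\<lambda>x. x $ i"], assumption, rule cdiff_at_bounded_linear)
     (auto simp: bounded_linear_vec_nth)

lemma cdiff_at_mult:
  fixes f g :: "'a::cnormed \<Rightarrow> complex"
  shows "cdiff_at f p \<Longrightarrow> cdiff_at g p \<Longrightarrow> cdiff_at (\<lambda>p. f p * g p) p"
  unfolding cdiff_at_def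
proof safe
  fix D E assume "(f has_derivative D) (at p)" "(g has_derivative E) (at p)"
    "\<forall>c v. D (c *\<^sub>C v) = c *\<^sub>C D v" "\<forall>c v. E (c *\<^sub>C v) = c *\<^sub>C E v"
  then show "\<exists>D. ((\<lambda>p. f p * g p) has_derivative D) (at p) \<and> (\<forall>c v. D (c *\<^sub>C v) = c *\<^sub>C D v)"
    by (intro exI [of _ "\<lambda>v. f p * E v + D v * g p"])
       (use has_derivative_mult [of f D p UNIV g E] in \<open>simp add: algebra_simps\<close>)
qed

lemma cdiff_at_scaleC:
  fixes k :: "'b::cnormed"
  shows "cdiff_at f p \<Longrightarrow> cdiff_at (\<lambda>p. f p *\<^sub>C k) p"
  by (rule cdiff_at_compose [of f p "\<lambda>c. c *\<^sub>C k"], assumption, rule cdiff_at_bounded_linear)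
     (auto simp: bounded_linear_scaleC_left scaleC_scaleC)

lemma cdiff_at_diff:
  fixes f g :: "'a::cnormed \<Rightarrow> complex"
  assumes "cdiff_at f p" "cdiff_at g p"
  shows "cdiff_at (\<lambda>p. f p - g p) p"
  using cdiff_at_add [OF assms(1) cdiff_at_mult [OF cdiff_at_const [of "-1"] assms(2)]] by simp

text \<open>In one complex variable this is the usual notion.\<close>

lemma cdiff_at_field:
  fixes f :: "complex \<Rightarrow> complex"
  shows "cdiff_at f x \<longleftrightarrow> f field_differentiable at x"
proof
  assume "cdiff_at f x"
  then obtain D where D: "(f has_derivative D) (at x)" "\<And>c v. D (c * v) = c * D v"
    by (auto simp: cdiff_at_def)
  have "D = (\<lambda>h. D 1 * h)"
    by (rule ext) (metis D(2) mult.commute mult.right_neutral)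
  with D(1) show "f field_differentiable at x"
    by (metis field_differentiable_def has_field_derivative_def)
next
  assume "f field_differentiable at x"
  then obtain D where "(f has_derivative (\<lambda>h. D * h)) (at x)"
    by (auto simp: field_differentiable_def has_field_derivative_def)
  then show "cdiff_at f x"
    unfolding cdiff_at_def by (intro exI conjI) auto
qed

lemma cdiff_at_cong:
  assumes "cdiff_at f p" "\<forall>\<^sub>F q in nhds p. f q = g q"
  shows "cdiff_at g p"
proof -
  have "f p = g p" using assms(2) eventually_nhds_x_imp_x by fastforce
  moreover have "\<forall>\<^sub>F q in at p. f q = g q" using assms(2) eventually_at_filter eventually_mono by fastforce
  ultimately show ?thesis using assms(1) unfolding cdiff_at_def
    by (metis UNIV_I has_derivative_transform_eventually)
qed

lemma cdiff_at_imp_continuous: "cdiff_at f p \<Longrightarrow> isCont f p"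
  by (auto simp: cdiff_at_def has_derivative_continuous)

lemma hol_sections_continuous_on: "f \<in> hol_sections (V::'a::cnormed set) \<Longrightarrow> continuous_on V f"
  by (rule continuous_at_imp_continuous_on) (simp add: hol_sections_iff cdiff_at_imp_continuous)

lemma hol_sections_holomorphic_on:
  assumes "f \<in> hol_sections V" "open S" "\<And>x. x \<in> S \<Longrightarrow> cdiff_at g x" "\<And>x. x \<in> S \<Longrightarrow> g x \<in> V"
  shows "(\<lambda>x::complex. f (g x)) holomorphic_on S"
proof -
  have "(\<lambda>x. f (g x)) field_differentiable at x" if "x \<in> S" for x
    using cdiff_at_compose [of g x f] assms that by (auto simp: cdiff_at_field hol_sections_iff)
  then show ?thesis
    using \<open>open S\<close> by (auto simp: holomorphic_on_open field_differentiable_def)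
qed

lemma hol_sections_zero: "(\<lambda>p. 0) \<in> hol_sections (V :: 'a::cnormed set)"
  by (simp add: hol_sections_iff cdiff_at_const)

lemma hol_sections_add:
  "f \<in> hol_sections V \<Longrightarrow> g \<in> hol_sections V \<Longrightarrow> (\<lambda>p. f p + g p) \<in> hol_sections (V :: 'a::cnormed set)"
  by (simp add: hol_sections_iff cdiff_at_add)

lemma hol_sections_sum:
  "(\<And>a. a \<in> I \<Longrightarrow> F a \<in> hol_sections V) \<Longrightarrow> (\<lambda>p. \<Sum>a\<in>I. F a p) \<in> hol_sections (V :: 'a::cnormed set)"
  by (induction I rule: infinite_finite_induct) (auto intro: hol_sections_add hol_sections_zero)

lemma hol_sections_lmul: "f \<in> hol_sections V \<Longrightarrow> (\<lambda>p. c * f p) \<in> hol_sections (V :: 'a::cnormed set)"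
  by (simp add: hol_sections_iff cdiff_at_mult cdiff_at_const)

lemma hol_sections_diff:
  "f \<in> hol_sections V \<Longrightarrow> g \<in> hol_sections V \<Longrightarrow> (\<lambda>p. f p - g p) \<in> hol_sections (V :: 'a::cnormed set)"
  by (simp add: hol_sections_iff cdiff_at_diff)

lemma hol_sections_mono: "f \<in> hol_sections V \<Longrightarrow> W \<subseteq> V \<Longrightarrow> f \<in> hol_sections (W :: 'a::cnormed set)"
  by (auto simp: hol_sections_iff)

lemma hol_sections_cong:
  assumes "f \<in> hol_sections V" "open V" "\<And>p. p \<in> V \<Longrightarrow> f p = g p"
  shows "g \<in> hol_sections (V :: 'a::cnormed set)"
  unfolding hol_sections_iff
proof
  fix p assume p: "p \<in> V"
  show "cdiff_at g p"
  proof (rule cdiff_at_cong)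
    show "cdiff_at f p" using assms p by (simp add: hol_sections_iff)
    show "\<forall>\<^sub>F q in nhds p. f q = g q"
      using eventually_nhds_in_open [OF assms(2) p] by eventually_elim (rule assms(3))
  qed
qed

text \<open>The derivative of \<open>f\<close> at \<open>p\<close> along the complex line in direction \<open>v\<close>. Where \<open>f\<close> is complex
  differentiable it is the value of the Frechet derivative at \<open>v\<close>; as a one variable derivative it is
  accessible to the Cauchy integral formula.\<close>

definition cderiv :: "('a::cnormed \<Rightarrow> complex) \<Rightarrow> 'a \<Rightarrow> 'a \<Rightarrow> complex" where
  "cderiv f p v = deriv (\<lambda>t. f (p + t *\<^sub>C v)) 0"

lemma cdiff_at_line: "cdiff_at (\<lambda>t. p + t *\<^sub>C (v::'a::cnormed)) t"
  by (intro cdiff_at_add cdiff_at_const cdiff_at_scaleC cdiff_at_ident)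

lemma cderiv_eqI:
  assumes "(f has_derivative D) (at p)" "\<And>c v. D (c *\<^sub>C v) = c * D v"
  shows "cderiv f p v = D v"
proof -
  have "((\<lambda>t. p + t *\<^sub>C v) has_derivative (\<lambda>t. t *\<^sub>C v)) (at 0)"
    using has_derivative_add [OF has_derivative_const [of p]
        bounded_linear_imp_has_derivative [OF bounded_linear_scaleC_left [of v]]] by simp
  then have "((\<lambda>t. f (p + t *\<^sub>C v)) has_derivative (\<lambda>t. D (t *\<^sub>C v))) (at 0)"
    using has_derivative_compose [of "\<lambda>t. p + t *\<^sub>C v" _ 0 UNIV f D] assms(1) by simp
  then have "((\<lambda>t. f (p + t *\<^sub>C v)) has_field_derivative D v) (at 0)"
    by (simp add: has_field_derivative_def assms(2) mult.commute[of _ "D v"])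
  then show ?thesis
    unfolding cderiv_def by (rule DERIV_imp_deriv)
qed

lemma cdiff_at_has_derivative:
  assumes "cdiff_at f p"
  shows "(f has_derivative cderiv f p) (at p)" "cderiv f p (c *\<^sub>C v) = c * cderiv f p v"
proof -
  obtain D where D: "(f has_derivative D) (at p)" "\<And>c v. D (c *\<^sub>C v) = c * D v"
    using assms by (auto simp: cdiff_at_def)
  then have "cderiv f p = D" using cderiv_eqI by blast
  then show "(f has_derivative cderiv f p) (at p)" "cderiv f p (c *\<^sub>C v) = c * cderiv f p v"
    using D by auto
qed

lemma cderiv_linear:
  assumes "cdiff_at f p"
  shows "cderiv f p (v + w) = cderiv f p v + cderiv f p w"
  using has_derivative_linear [OF cdiff_at_has_derivative(1) [OF assms]] linear_add by blast

lemma cderiv_cong: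
  assumes "cdiff_at f p" "\<forall>\<^sub>F q in nhds p. f q = g q"
  shows "cderiv g p v = cderiv f p v"
proof (rule cderiv_eqI [OF _ cdiff_at_has_derivative(2) [OF assms(1)]])
  have "f p = g p" using eventually_nhds_x_imp_x [OF assms(2)] .
  moreover have "\<forall>\<^sub>F q in at p. f q = g q" using assms(2) by (simp add: eventually_at_filter eventually_mono)
  ultimately show "(g has_derivative cderiv f p) (at p)"
    using has_derivative_transform_eventually [OF cdiff_at_has_derivative(1) [OF assms(1)]] by blast
qed

lemma cderiv_mult:
  assumes "cdiff_at f p" "cdiff_at g p"
  shows "cderiv (\<lambda>p. f p * g p) p v = f p * cderiv g p v + cderiv f p v * g p"
proof (rule cderiv_eqI)
  show "((\<lambda>p. f p * g p) has_derivative (\<lambda>v. f p * cderiv g p v + cderiv f p v * g p)) (at p)"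
    using assms by (intro has_derivative_mult cdiff_at_has_derivative)
qed (simp add: cdiff_at_has_derivative(2) [OF assms(1)] cdiff_at_has_derivative(2) [OF assms(2)] algebra_simps)

lemma has_field_derivative_line:
  assumes "cdiff_at f (p + x *\<^sub>C v)"
  shows "((\<lambda>t. f (p + t *\<^sub>C v)) has_field_derivative cderiv f (p + x *\<^sub>C v) v) (at x)"
proof -
  have "cdiff_at (\<lambda>t. f (p + t *\<^sub>C v)) x"
    by (rule cdiff_at_compose [OF cdiff_at_line assms])
  then have "(\<lambda>t. f (p + t *\<^sub>C v)) field_differentiable at x" by (simp add: cdiff_at_field)
  then have "((\<lambda>t. f (p + t *\<^sub>C v)) has_field_derivative deriv (\<lambda>t. f (p + t *\<^sub>C v)) x) (at x)"
    by (simp add: field_differentiable_derivI)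
  moreover have "deriv (\<lambda>t. f (p + t *\<^sub>C v)) x = cderiv f (p + x *\<^sub>C v) v"
    using deriv_shift_0 [of "\<lambda>t. f (p + t *\<^sub>C v)" x]
    by (simp add: cderiv_def o_def scaleC_add_left add.assoc)
  ultimately show ?thesis by simp
qed

lemma d_eta_eq_cderiv: "d_eta f (x, \<eta>) = cderiv f (x, \<eta>) (0, 1)"
  using deriv_shift_0 [of "\<lambda>s. f (x, s)" \<eta>] by (simp add: d_eta_def cderiv_def o_def)

section \<open>Contour integrals depending on holomorphic parameters\<close>

text \<open>The remainder of the first order expansion is quadratic in \<open>v\<close>, with a constant that depends only on the
  radius and on a bound for \<open>|f|\<close>: on each complex line through \<open>p\<close> the Cauchy inequality bounds the second derivative.
  This uniformity is what makes differentiation under the integral sign work.\<close>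

lemma cderiv_Taylor_bound:
  assumes f: "f \<in> hol_sections (ball p R)" and M: "\<And>q. q \<in> ball p R \<Longrightarrow> cmod (f q) \<le> M"
    and v: "4 * norm v < R"
  shows "cmod (f (p + v) - f p - cderiv f p v) \<le> 8 * M / R\<^sup>2 * (norm v)\<^sup>2"
proof (cases "v = 0")
  case True
  then show ?thesis by (simp add: cderiv_def)
next
  case False
\<comment> \<open>\<open>L\<close> is the radius, in the parameter \<open>t\<close>, of the disc in which the line stays in the ball.\<close>
  define L where "L = R / norm v"
  have L: "L > 4" using v False by (simp add: L_def field_simps)
  have R: "R > 0" using v by (smt (verit) norm_ge_zero)
  define g where "g = (\<lambda>t. f (p + t *\<^sub>C v))"
  have in_ball: "p + t *\<^sub>C v \<in> ball p R" if "t \<in> ball 0 L" for t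
  proof -
    have "dist p (p + t *\<^sub>C v) = cmod t * norm v"
      unfolding dist_norm by (simp add: norm_scaleC)
    then show ?thesis using that False by (simp add: L_def field_simps)
  qed
  have g: "g holomorphic_on ball 0 L"
    unfolding g_def
    by (rule hol_sections_holomorphic_on [OF f]) (auto intro: cdiff_at_line in_ball simp del: mem_ball)
  have gM: "cmod (g t) \<le> M" if "t \<in> ball 0 L" for t
    using M [OF in_ball [OF that]] by (simp add: g_def)
  have B: "cmod ((deriv ^^ 2) g t) \<le> 8 * M / L\<^sup>2" if t: "t \<in> cball 0 1" for t
  proof -
    have sub: "cball t (L/2) \<subseteq> ball 0 L"
      using t L by (auto simp: subset_iff dist_norm) (smt (verit) norm_triangle_sub norm_minus_commute)
    have "cmod ((deriv ^^ 2) g t) \<le> fact 2 * M / (L/2)^2"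
    proof (rule Cauchy_inequality)
      show "g holomorphic_on ball t (L/2)"
        using holomorphic_on_subset [OF g] sub ball_subset_cball by blast
      show "continuous_on (cball t (L/2)) g"
        using holomorphic_on_subset [OF g sub] holomorphic_on_imp_continuous_on by blast
      show "cmod (g x) \<le> M" if "cmod (t - x) = L/2" for x
        using sub that by (intro gM) (auto simp: dist_norm subset_iff)
    qed (use L in auto)
    then show ?thesis by (simp add: power2_eq_square field_simps)
  qed
  have "cmod ((deriv ^^ 0) g 1 - (\<Sum>i\<le>1. (deriv ^^ i) g 0 * (1 - 0) ^ i / fact i))
      \<le> 8 * M / L\<^sup>2 * cmod (1 - 0) ^ Suc 1 / fact 1"
  proof (rule complex_Taylor [of "cball 0 1" 1 "\<lambda>i. (deriv ^^ i) g"])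
    fix i x assume x: "x \<in> cball (0::complex) 1"
    have "((deriv ^^ i) g has_field_derivative (deriv ^^ Suc i) g x) (at x)"
      using holomorphic_derivI [OF holomorphic_higher_deriv [OF g, of i], of x] x L by auto
    then show "((deriv ^^ i) g has_field_derivative (deriv ^^ Suc i) g x) (at x within cball 0 1)"
      by (rule has_field_derivative_at_within)
    show "cmod ((deriv ^^ Suc 1) g x) \<le> 8 * M / L\<^sup>2"
      using B [OF x] by (simp add: numeral_2_eq_2)
  qed auto
  then have "cmod (g 1 - g 0 - deriv g 0) \<le> 8 * M / L\<^sup>2"
    by (simp add: algebra_simps)
  then show ?thesis
    using False R by (simp add: g_def cderiv_def L_def field_simps)
qed

text \<open>A tube lemma with a bound: over a compact set of \<open>x\<close> the point \<open>q\<close> may be moved by a uniform amount.\<close>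

lemma compact_slice_nhd:
  fixes q :: "'q::{real_normed_vector,heine_borel}" and H :: "'q \<times> complex \<Rightarrow> complex"
  assumes "open \<Omega>" "continuous_on \<Omega> H" "compact K" "\<And>x. x \<in> K \<Longrightarrow> (q, x) \<in> \<Omega>"
  shows "\<exists>R>0. \<exists>M\<ge>0. \<forall>q'. dist q q' < R \<longrightarrow> (\<forall>x\<in>K. (q', x) \<in> \<Omega> \<and> cmod (H (q', x)) \<le> M)"
proof (cases "K = {}")
  case True
  then show ?thesis by (intro exI [of _ 1] exI [of _ 0]) auto
next
  case False
  have "compact ({q} \<times> K)" using assms by (intro compact_Times) auto
  moreover have "{q} \<times> K \<subseteq> \<Omega>" using assms by auto
  ultimately obtain e where e: "e > 0" "{x. infdist x ({q} \<times> K) \<le> e} \<subseteq> \<Omega>"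
    using compact_in_open_separated [of "{q} \<times> K" \<Omega>] False assms by auto
  have sub: "cball q e \<times> K \<subseteq> \<Omega>"
  proof safe
    fix q' x assume "q' \<in> cball q e" "x \<in> K"
    then have "infdist (q', x) ({q} \<times> K) \<le> dist (q', x) (q, x)"
      by (intro infdist_le) auto
    also have "\<dots> \<le> e" using \<open>q' \<in> cball q e\<close> by (simp add: dist_Pair_Pair dist_commute)
    finally show "(q', x) \<in> \<Omega>" using e by auto
  qed
  have "compact (H ` (cball q e \<times> K))"
    using assms sub by (intro compact_continuous_image compact_Times) (auto intro: continuous_on_subset)
  then obtain M where M: "\<And>y. y \<in> H ` (cball q e \<times> K) \<Longrightarrow> cmod y \<le> M"
    using compact_imp_bounded bounded_iff by metis
  have "(q', x) \<in> \<Omega> \<and> cmod (H (q', x)) \<le> max M 0" if "dist q q' < e" "x \<in> K" for q' x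
  proof -
    have "(q', x) \<in> cball q e \<times> K" using that by auto
    then show ?thesis using sub M [of "H (q', x)"] by fastforce
  qed
  moreover have "max M 0 \<ge> 0" by simp
  ultimately show ?thesis using e(1) by blast
qed

lemma cderiv_slice: "cderiv (\<lambda>q. H (q, x)) q v = cderiv H (q, x) (v, 0)"
  by (simp add: cderiv_def)

lemma hol_sections_slice:
  fixes H :: "'q::cnormed \<times> 'x::cnormed \<Rightarrow> complex"
  assumes "H \<in> hol_sections \<Omega>" "\<And>q. q \<in> S \<Longrightarrow> (q, x) \<in> \<Omega>"
  shows "(\<lambda>q. H (q, x)) \<in> hol_sections S"
  using assms unfolding hol_sections_iff
  by (auto intro!: cdiff_at_compose [of "\<lambda>q. (q, x)" _ H] cdiff_at_Pair cdiff_at_ident cdiff_at_const)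

lemma holomorphic_on_slice:
  fixes H :: "'q::cnormed \<times> complex \<Rightarrow> complex"
  assumes "H \<in> hol_sections \<Omega>" "open S" "\<And>x. x \<in> S \<Longrightarrow> (q, x) \<in> \<Omega>"
  shows "(\<lambda>x::complex. H (q, x)) holomorphic_on S"
  by (rule hol_sections_holomorphic_on [OF assms(1,2)])
     (auto intro: cdiff_at_Pair cdiff_at_ident cdiff_at_const assms)

lemma open_slice: "open \<Omega> \<Longrightarrow> open {x. (q, x) \<in> \<Omega>}"
  using open_vimage [of \<Omega> "\<lambda>x. (q, x)"] by (simp add: vimage_def continuous_on_Pair)

lemma cderiv_Taylor_bound_slice:
  fixes H :: "'q::cnormed \<times> complex \<Rightarrow> complex"
  assumes "H \<in> hol_sections \<Omega>" and "\<And>q'. dist q q' < R \<Longrightarrow> (q', x) \<in> \<Omega> \<and> cmod (H (q', x)) \<le> M"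
    and "4 * norm v < R"
  shows "cmod (H (q + v, x) - H (q, x) - cderiv H (q, x) (v, 0)) \<le> 8 * M / R\<^sup>2 * (norm v)\<^sup>2"
  using cderiv_Taylor_bound [of "\<lambda>q. H (q, x)" q R M v] assms hol_sections_slice [of H \<Omega> "ball q R" x]
  by (auto simp: cderiv_slice)

text \<open>The difference quotients in the parameter are holomorphic in \<open>x\<close>, and by the Taylor bound they converge
  locally uniformly in \<open>x\<close>.\<close>

lemma cderiv_slice_holomorphic:
  fixes H :: "'q::{euclidean_space,cnormed} \<times> complex \<Rightarrow> complex"
  assumes "open \<Omega>" and H: "H \<in> hol_sections \<Omega>"
  shows "(\<lambda>x. cderiv H (q, x) (v, 0)) holomorphic_on {x. (q, x) \<in> \<Omega>}"
proof -
  let ?S = "{x. (q, x) \<in> \<Omega>}"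
  have oS: "open ?S" by (rule open_slice) fact
  have "\<exists>d>0. (\<lambda>x. cderiv H (q, x) (v, 0)) holomorphic_on ball x0 d" if x0: "x0 \<in> ?S" for x0
  proof -
    obtain d where d: "d > 0" "cball x0 d \<subseteq> ?S"
      using iffD1 [OF spec [OF open_contains_cball_eq [OF oS]] x0] by (elim exE conjE) (rule that)
    have sub: "\<And>x. x \<in> cball x0 d \<Longrightarrow> (q, x) \<in> \<Omega>" using d by blast
    obtain R M where RM: "R > 0" "M \<ge> 0"
      "\<And>q' x. dist q q' < R \<Longrightarrow> x \<in> cball x0 d \<Longrightarrow> (q', x) \<in> \<Omega> \<and> cmod (H (q', x)) \<le> M"
      using compact_slice_nhd [OF \<open>open \<Omega>\<close> hol_sections_continuous_on [OF H] compact_cball [of x0 d] sub]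
      by blast
    define s where "s = R / (8 * (norm v + 1))"
    have s: "s > 0" using RM by (simp add: s_def add_nonneg_pos)
    define t where "t = (\<lambda>n. s / (real n + 1))"
    have t: "0 < t n" "t n \<le> s" for n
      using s by (auto simp: t_def field_simps)
    have tv: "4 * norm (complex_of_real (t n) *\<^sub>C v) < R" for n
    proof -
      have "t n * norm v \<le> s * (norm v + 1)" using t s by (intro mult_mono) (auto simp: less_imp_le)
      also have "\<dots> = R / 8" unfolding s_def by (simp add: field_simps add_nonneg_eq_0_iff)
      finally show ?thesis using t(1)[of n] RM by (simp add: norm_scaleC)
    qed
    define F where "F = (\<lambda>n x. (H (q + complex_of_real (t n) *\<^sub>C v, x) - H (q, x)) / t n)"
    have F: "F n holomorphic_on ball x0 d" for n
    proof -
      have "(q + complex_of_real (t n) *\<^sub>C v, x) \<in> \<Omega>" if "x \<in> ball x0 d" for x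
      proof -
        have "dist q (q + complex_of_real (t n) *\<^sub>C v) < R"
          using tv [of n] norm_ge_zero [of "complex_of_real (t n) *\<^sub>C v"]
          unfolding dist_norm by (simp del: norm_ge_zero)
        then show ?thesis using RM(3) that by simp
      qed
      then show ?thesis
        unfolding F_def using d t(1)[of n]
        by (intro holomorphic_intros holomorphic_on_slice [OF H]) (auto simp: subset_iff)
    qed
    have est: "cmod (F n x - cderiv H (q, x) (v, 0)) \<le> 8 * M / R\<^sup>2 * (norm v)\<^sup>2 * t n"
      if "x \<in> cball x0 d" for n x
    proof -
      let ?t = "complex_of_real (t n)"
      have cd: "cdiff_at H (q, x)" using H d that by (auto simp: hol_sections_iff)
      have "cmod (H (q + ?t *\<^sub>C v, x) - H (q, x) - cderiv H (q, x) (?t *\<^sub>C v, 0))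
        \<le> 8 * M / R\<^sup>2 * (norm (?t *\<^sub>C v))\<^sup>2"
        by (rule cderiv_Taylor_bound_slice [OF H]) (use RM(3) that tv in auto)
      moreover have "cderiv H (q, x) (?t *\<^sub>C v, 0) = ?t * cderiv H (q, x) (v, 0)"
        using cdiff_at_has_derivative(2) [OF cd, of ?t "(v, 0)"] by simp
      moreover have "H (q + ?t *\<^sub>C v, x) - H (q, x) = ?t * F n x"
        using t(1)[of n] by (simp add: F_def)
      ultimately have "cmod (?t * (F n x - cderiv H (q, x) (v, 0))) \<le> 8 * M / R\<^sup>2 * (t n * norm v)\<^sup>2"
        using t(1)[of n] by (simp add: norm_scaleC algebra_simps)
      then have "t n * cmod (F n x - cderiv H (q, x) (v, 0)) \<le> t n * (8 * M / R\<^sup>2 * (norm v)\<^sup>2 * t n)"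
        using t(1)[of n] by (simp add: norm_mult power2_eq_square mult_ac)
      then show ?thesis using t(1)[of n] by (simp only: mult_le_cancel_left_pos)
    qed
    have lim: "(\<lambda>n. 8 * M / R\<^sup>2 * (norm v)\<^sup>2 * t n) \<longlonglongrightarrow> 0"
    proof -
      have "t \<longlonglongrightarrow> 0" unfolding t_def using LIMSEQ_Suc [OF lim_const_over_n [of s]]
        by (simp add: add.commute)
      then show ?thesis using tendsto_mult_right_zero by blast
    qed
    have ul: "uniform_limit (cball x0 d) F (\<lambda>x. cderiv H (q, x) (v, 0)) sequentially"
      unfolding uniform_limit_iff
    proof safe
      fix \<epsilon> :: real assume "\<epsilon> > 0"
      with lim have "\<forall>\<^sub>F n in sequentially. 8 * M / R\<^sup>2 * (norm v)\<^sup>2 * t n < \<epsilon>"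
        using order_tendstoD(2) by blast
      then show "\<forall>\<^sub>F n in sequentially. \<forall>x\<in>cball x0 d. dist (F n x) (cderiv H (q, x) (v, 0)) < \<epsilon>"
      proof eventually_elim
        case (elim n)
        show ?case
        proof
          fix x assume "x \<in> cball x0 d"
          from le_less_trans [OF est [OF this, of n] elim]
          show "dist (F n x) (cderiv H (q, x) (v, 0)) < \<epsilon>" unfolding dist_norm .
        qed
      qed
    qed
    have "(\<lambda>x. cderiv H (q, x) (v, 0)) holomorphic_on ball x0 d"
    proof (rule holomorphic_uniform_sequence [OF _ F])
      fix x assume "x \<in> ball x0 d"
      then obtain d' where "d' > 0" "cball x d' \<subseteq> ball x0 d" using open_contains_cball by blast
      moreover then have "uniform_limit (cball x d') F (\<lambda>x. cderiv H (q, x) (v, 0)) sequentially"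
        using uniform_limit_on_subset [OF ul] ball_subset_cball by blast
      ultimately show "\<exists>d'>0. cball x d' \<subseteq> ball x0 d \<and>
          uniform_limit (cball x d') F (\<lambda>x. cderiv H (q, x) (v, 0)) sequentially" by blast
    qed simp
    with d show ?thesis by blast
  qed
  then show ?thesis
    unfolding holomorphic_on_def
    by (metis (no_types, lifting) at_within_open centre_in_ball field_differentiable_at_within open_ball)
qed

text \<open>Holomorphy of an integral with respect to its parameters, with differentiation under the integral sign.
  The path is only piecewise smooth, so the bound on the remainder is integrated by means of a bound for
  contour integrals of functions that are holomorphic on a neighbourhood \<open>T\<close> of the path.\<close>

theorem contour_integral_param:
  fixes H :: "'q::{euclidean_space,cnormed} \<times> complex \<Rightarrow> complex"
  assumes "open \<Omega>" and H: "H \<in> hol_sections \<Omega>" and g: "valid_path g"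
    and im: "\<And>x. x \<in> path_image g \<Longrightarrow> (q, x) \<in> \<Omega>"
  shows "cdiff_at (\<lambda>q. contour_integral g (\<lambda>x. H (q, x))) q"
    and "cderiv (\<lambda>q. contour_integral g (\<lambda>x. H (q, x))) q v = contour_integral g (\<lambda>x. cderiv H (q, x) (v, 0))"
proof -
  define D where "D = (\<lambda>v. contour_integral g (\<lambda>x. cderiv H (q, x) (v, 0)))"
  let ?P = "path_image g" and ?S = "{x. (q, x) \<in> \<Omega>}"
  have oS: "open ?S" by (rule open_slice) fact
  have PS: "?P \<subseteq> ?S" using im by auto
  have cP: "compact ?P" using g by (simp add: compact_path_image valid_path_imp_path)
  obtain e where e: "e > 0" "{x. infdist x ?P \<le> e} \<subseteq> ?S"
    using compact_in_open_separated [OF _ cP oS PS] by auto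
  define T where "T = {x. infdist x ?P < e}"
  have oT: "open T" unfolding T_def by (intro open_Collect_less continuous_intros)
  have PT: "?P \<subseteq> T" using e by (auto simp: T_def)
  have cK: "compact {x. infdist x ?P \<le> e}"
    using compact_infdist_le [OF _ cP e(1)] by auto
  have sub: "\<And>x. x \<in> {x. infdist x ?P \<le> e} \<Longrightarrow> (q, x) \<in> \<Omega>" using e by blast
  obtain R M where RM: "R > 0" "M \<ge> 0"
    "\<And>q' x. dist q q' < R \<Longrightarrow> x \<in> {x. infdist x ?P \<le> e} \<Longrightarrow> (q', x) \<in> \<Omega> \<and> cmod (H (q', x)) \<le> M"
    using compact_slice_nhd [OF \<open>open \<Omega>\<close> hol_sections_continuous_on [OF H] cK sub] by blast
  have inT: "(q', x) \<in> \<Omega> \<and> cmod (H (q', x)) \<le> M" if "dist q q' < R" "x \<in> T" for q' x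
    using RM(3) [OF that(1), of x] that(2) by (auto simp: T_def)
  obtain L where L: "L > 0" "\<And>f B. f holomorphic_on T \<Longrightarrow> (\<And>z. z \<in> T \<Longrightarrow> cmod (f z) \<le> B)
      \<Longrightarrow> cmod (contour_integral g f) \<le> L * B"
    using contour_integral_bound_exists [OF oT g PT] by metis
  have holD: "(\<lambda>x. cderiv H (q, x) (v, 0)) holomorphic_on T" for v
    using holomorphic_on_subset [OF cderiv_slice_holomorphic [OF \<open>open \<Omega>\<close> H]] inT [of q] RM by auto
  have intgD: "(\<lambda>x. cderiv H (q, x) (v, 0)) contour_integrable_on g" for v
    by (rule contour_integrable_holomorphic_simple [OF holD oT g PT])
  have cd: "cdiff_at H (q, x)" if "x \<in> ?P" for x
    using H PS that by (auto simp: hol_sections_iff)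
  have D_scale: "D (c *\<^sub>C v) = c * D v" for c v
  proof -
    have "D (c *\<^sub>C v) = contour_integral g (\<lambda>x. c * cderiv H (q, x) (v, 0))"
      unfolding D_def
      by (rule contour_integral_eq) (use cdiff_at_has_derivative(2) [OF cd, of _ c "(v, 0)"] in simp)
    then show ?thesis by (simp add: D_def contour_integral_lmul intgD)
  qed
  have D_add: "D (v + w) = D v + D w" for v w
  proof -
    have "D (v + w) = contour_integral g (\<lambda>x. cderiv H (q, x) (v, 0) + cderiv H (q, x) (w, 0))"
      unfolding D_def
      by (rule contour_integral_eq) (use cderiv_linear [OF cd, of _ "(v, 0)" "(w, 0)"] in simp)
    then show ?thesis by (simp add: D_def contour_integral_add intgD)
  qed
  have "linear D"
    by (rule linearI) (simp_all add: D_add D_scale flip: scaleC_of_real add: scaleR_conv_of_real)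
  then have bD: "bounded_linear D" by (simp add: linear_conv_bounded_linear)
  define C where "C = L * (8 * M / R\<^sup>2)"
  have est: "cmod (contour_integral g (\<lambda>x. H (q + v, x)) - contour_integral g (\<lambda>x. H (q, x)) - D v)
      \<le> C * (norm v)\<^sup>2" if v: "4 * norm v < R" for v
  proof -
    have d: "dist q (q + v) < R" "dist q q < R" unfolding dist_norm using v RM(1) by auto
    have h: "(\<lambda>x. H (q + v, x)) holomorphic_on T" "(\<lambda>x. H (q, x)) holomorphic_on T"
      using inT d by (auto intro!: holomorphic_on_slice [OF H oT])
    have "contour_integral g (\<lambda>x. H (q + v, x)) - contour_integral g (\<lambda>x. H (q, x)) - D v
      = contour_integral g (\<lambda>x. H (q + v, x) - H (q, x) - cderiv H (q, x) (v, 0))"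
      using h holD intgD contour_integrable_holomorphic_simple [OF _ oT g PT]
      by (simp add: D_def contour_integral_diff contour_integrable_diff)
    also have "cmod \<dots> \<le> L * (8 * M / R\<^sup>2 * (norm v)\<^sup>2)"
    proof (rule L(2))
      show "(\<lambda>x. H (q + v, x) - H (q, x) - cderiv H (q, x) (v, 0)) holomorphic_on T"
        by (intro holomorphic_intros h holD)
      fix x assume "x \<in> T"
      then show "cmod (H (q + v, x) - H (q, x) - cderiv H (q, x) (v, 0)) \<le> 8 * M / R\<^sup>2 * (norm v)\<^sup>2"
        using inT by (intro cderiv_Taylor_bound_slice [OF H _ v]) auto
    qed
    finally show ?thesis by (simp add: C_def mult_ac)
  qed
  have "((\<lambda>q. contour_integral g (\<lambda>x. H (q, x))) has_derivative D) (at q)"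
    unfolding has_derivative_at
  proof (rule conjI [OF bD], rule Lim_null_comparison)
    have "\<forall>\<^sub>F v in at 0. v \<in> ball 0 (R/4) - {0::'q}"
      using RM(1) eventually_at_in_open [of "ball 0 (R/4)" "0::'q"] by simp
    then show "\<forall>\<^sub>F v in at 0. norm (cmod (contour_integral g (\<lambda>x. H (q + v, x)) -
        contour_integral g (\<lambda>x. H (q, x)) - D v) / norm v) \<le> C * norm v"
    proof eventually_elim
      case (elim v)
      then show ?case using est [of v] by (simp add: field_simps power2_eq_square)
    qed
    show "((\<lambda>v. C * norm v) \<longlongrightarrow> 0) (at (0::'q))"
      by (auto intro!: tendsto_eq_intros)
  qed
  then show "cdiff_at (\<lambda>q. contour_integral g (\<lambda>x. H (q, x))) q"
    and "cderiv (\<lambda>q. contour_integral g (\<lambda>x. H (q, x))) q v = contour_integral g (\<lambda>x. cderiv H (q, x) (v, 0))"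
    using D_scale cderiv_eqI [of _ D q v] by (auto simp: cdiff_at_def D_def)
qed

text \<open>Derivatives of holomorphic functions are holomorphic: by the Cauchy formula the derivative along \<open>v\<close> is
  an integral of \<open>f (q + x v) / x\<^sup>2\<close> over a small circle, in which \<open>q\<close> is a parameter.\<close>

theorem cderiv_hol_sections:
  fixes f :: "'q::{euclidean_space,cnormed} \<Rightarrow> complex"
  assumes "open \<Omega>" and f: "f \<in> hol_sections \<Omega>"
  shows "(\<lambda>p. cderiv f p v) \<in> hol_sections \<Omega>"
  unfolding hol_sections_iff
proof
  fix p assume "p \<in> \<Omega>"
  then obtain e where e: "e > 0" "ball p e \<subseteq> \<Omega>" using \<open>open \<Omega>\<close> openE by blast
  define R where "R = e / (4 * (norm v + 1))"
  have nv: "0 < norm v + 1" by (smt (verit) norm_ge_zero)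
  have R: "R > 0" using e nv by (simp add: R_def)
  have line: "q + t *\<^sub>C v \<in> \<Omega>" if "dist p q < e/2" "cmod t < 2 * R" for q t
  proof -
    have "cmod t * norm v \<le> 2 * R * (norm v + 1)" using that R by (intro mult_mono) auto
    also have "\<dots> = e / 2" unfolding R_def using nv by (simp add: field_simps)
    finally have "dist q (q + t *\<^sub>C v) \<le> e / 2" by (simp add: dist_norm norm_scaleC)
    then have "dist p (q + t *\<^sub>C v) < e" using that dist_triangle [of p "q + t *\<^sub>C v" q] by simp
    then show ?thesis using e by auto
  qed
  define W where "W = {(q, t::complex). q + t *\<^sub>C v \<in> \<Omega> \<and> t \<noteq> 0}"
  have cl: "cdiff_at (\<lambda>y. fst y + snd y *\<^sub>C v) y" for y
    by (intro cdiff_at_add cdiff_at_scaleC cdiff_at_fst cdiff_at_snd cdiff_at_ident)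
  have W: "open W"
  proof -
    have "continuous_on UNIV (\<lambda>y. fst y + snd y *\<^sub>C v)"
      by (rule continuous_at_imp_continuous_on) (simp add: cl cdiff_at_imp_continuous)
    then have "open ((\<lambda>y. fst y + snd y *\<^sub>C v) -` \<Omega>)" using \<open>open \<Omega>\<close> open_vimage by blast
    moreover have "open {y::'q \<times> complex. snd y \<noteq> 0}"
      by (intro open_Collect_neq continuous_intros)
    moreover have "W = (\<lambda>y. fst y + snd y *\<^sub>C v) -` \<Omega> \<inter> {y. snd y \<noteq> 0}" by (auto simp: W_def)
    ultimately show ?thesis by auto
  qed
  have hH: "(\<lambda>y. f (fst y + snd y *\<^sub>C v) * inverse (snd y ^ 2)) \<in> hol_sections W"
    unfolding hol_sections_iff
  proof
    fix y assume y: "y \<in> W"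
    have "cdiff_at (\<lambda>x::complex. inverse (x ^ 2)) (snd y)"
      using y by (auto simp: cdiff_at_field W_def intro!: derivative_intros)
    then have "cdiff_at (\<lambda>y. inverse (snd y ^ 2)) y"
      by (intro cdiff_at_compose [of snd y "\<lambda>x. inverse (x ^ 2)"] cdiff_at_snd cdiff_at_ident)
    moreover have "cdiff_at (\<lambda>y. f (fst y + snd y *\<^sub>C v)) y"
      using y f by (intro cdiff_at_compose [OF cl]) (auto simp: W_def hol_sections_iff)
    ultimately show "cdiff_at (\<lambda>y. f (fst y + snd y *\<^sub>C v) * inverse (snd y ^ 2)) y"
      by (rule cdiff_at_mult [rotated])
  qed
  have "cdiff_at (\<lambda>q. contour_integral (circlepath 0 R) (\<lambda>x. f (q + x *\<^sub>C v) * inverse (x ^ 2))) p"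
    using contour_integral_param(1) [OF W hH, of "circlepath 0 R" p] R e line [of p]
    by (fastforce simp: W_def)
  then have "cdiff_at (\<lambda>q. 1 / (2 * of_real pi * \<i>) *
      contour_integral (circlepath 0 R) (\<lambda>x. f (q + x *\<^sub>C v) * inverse (x ^ 2))) p"
    by (intro cdiff_at_mult cdiff_at_const)
  then show "cdiff_at (\<lambda>p. cderiv f p v) p"
  proof (rule cdiff_at_cong)
    have "\<forall>\<^sub>F q in nhds p. q \<in> ball p (e/2)" using e by (intro eventually_nhds_in_open) auto
    then show "\<forall>\<^sub>F q in nhds p. 1 / (2 * of_real pi * \<i>) *
      contour_integral (circlepath 0 R) (\<lambda>x. f (q + x *\<^sub>C v) * inverse (x ^ 2)) = cderiv f q v"
    proof eventually_elim
      case (elim q)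
      have h: "(\<lambda>t. f (q + t *\<^sub>C v)) holomorphic_on ball 0 (2 * R)"
        by (rule hol_sections_holomorphic_on [OF f]) (use line elim in \<open>auto intro: cdiff_at_line\<close>)
      have "contour_integral (circlepath 0 R) (\<lambda>t. f (q + t *\<^sub>C v) / (t - 0) ^ Suc 1)
        = 2 * pi * \<i> * (deriv ^^ 1) (\<lambda>t. f (q + t *\<^sub>C v)) 0 / fact 1"
      proof (rule Cauchy_contour_integral_circlepath)
        have "cball 0 R \<subseteq> ball (0::complex) (2 * R)" using R by auto
        then show "continuous_on (cball 0 R) (\<lambda>t. f (q + t *\<^sub>C v))"
          using h holomorphic_on_subset holomorphic_on_imp_continuous_on by blast
        have "ball 0 R \<subseteq> ball (0::complex) (2 * R)" using R by auto
        then show "(\<lambda>t. f (q + t *\<^sub>C v)) holomorphic_on ball 0 R"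
          using h holomorphic_on_subset by blast
      qed (use R in auto)
      moreover have "(\<lambda>x. f (q + x *\<^sub>C v) * inverse (x ^ 2)) = (\<lambda>t. f (q + t *\<^sub>C v) / (t - 0) ^ Suc 1)"
        by (simp add: divide_inverse numeral_2_eq_2)
      moreover have "(2::complex) * of_real pi * \<i> \<noteq> 0" by simp
      ultimately show ?case
        by (simp only: cderiv_def) simp
    qed
  qed
qed

lemma d_eta_hol_sections:
  fixes f :: "'b::{euclidean_space,cnormed} \<times> complex \<Rightarrow> complex"
  assumes "open V" "f \<in> hol_sections V"
  shows "d_eta f \<in> hol_sections V"
proof -
  have "d_eta f = (\<lambda>p. cderiv f p (0, 1))" using d_eta_eq_cderiv by fastforce
  then show ?thesis using cderiv_hol_sections [OF assms, of "(0, 1)"] by simp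
qed

section \<open>Iterated contour integrals\<close>

text \<open>Replacement of the \<open>k\<close>-th coordinate, as it occurs in \<open>prod_path_integral\<close>.\<close>

definition upd :: "(nat \<Rightarrow> 'n::finite) \<Rightarrow> nat \<Rightarrow> complex \<Rightarrow> complex ^ 'n \<Rightarrow> complex ^ 'n" where
  "upd e k x w = (\<chi> j. if j = e k then x else w $ j)"

lemma upd_nth: "upd e k x w $ j = (if j = e k then x else w $ j)"
  by (simp add: upd_def)

lemma prod_path_integral_Suc:
  "prod_path_integral e g (Suc k) F w =
     contour_integral (g (Suc k)) (\<lambda>x. prod_path_integral e g k F (upd e (Suc k) x w))"
  by (simp add: upd_def)

declare prod_path_integral.simps(2) [simp del]

lemma scaleC_axis: "c *\<^sub>C axis k (1::complex) = axis k c"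
  by (simp add: vec_eq_iff axis_def)

lemma upd_eq: "upd e k x w = w + (x - w $ e k) *\<^sub>C axis (e k) 1"
  by (simp add: vec_eq_iff upd_nth scaleC_axis) (simp add: axis_def)

lemma cdiff_at_upd: "cdiff_at f p \<Longrightarrow> cdiff_at g p \<Longrightarrow> cdiff_at (\<lambda>p. upd e k (f p) (g p)) p"
  unfolding upd_eq by (intro cdiff_at_add cdiff_at_diff cdiff_at_scaleC cdiff_at_nth)

lemma cdiff_imp_continuous_on: "(\<And>p. cdiff_at f p) \<Longrightarrow> continuous_on S f"
  by (simp add: cdiff_at_imp_continuous continuous_at_imp_continuous_on)

text \<open>The points \<open>(p, w)\<close> such that \<open>(p, x) \<in> \<Omega>\<close> whenever \<open>x\<close> arises from \<open>w\<close> by moving the first \<open>k\<close>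
  coordinates onto the paths.\<close>

primrec slab :: "(nat \<Rightarrow> 'n::finite) \<Rightarrow> (nat \<Rightarrow> real \<Rightarrow> complex) \<Rightarrow> nat \<Rightarrow>
    ('p \<times> (complex ^ 'n)) set \<Rightarrow> ('p \<times> (complex ^ 'n)) set" where
  "slab e g 0 \<Omega> = \<Omega>"
| "slab e g (Suc k) \<Omega> = {(p, w). \<forall>x\<in>path_image (g (Suc k)). (p, upd e (Suc k) x w) \<in> slab e g k \<Omega>}"

lemma slabI:
  assumes "inj_on e {1..k}"
    and "\<And>x. (\<And>i. i \<in> {1..k} \<Longrightarrow> x $ e i \<in> path_image (g i)) \<Longrightarrow>
       (\<And>j. j \<notin> e ` {1..k} \<Longrightarrow> x $ j = w $ j) \<Longrightarrow> (p, x) \<in> \<Omega>"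
  shows "(p, w) \<in> slab e g k \<Omega>"
  using assms
proof (induction k arbitrary: w)
  case 0
  then show ?case by (simp add: 0(2)[of w])
next
  case (Suc k)
  have inj: "inj_on e {1..k}" using Suc.prems(1) by (rule inj_on_subset) auto
  have "(p, upd e (Suc k) y w) \<in> slab e g k \<Omega>" if y: "y \<in> path_image (g (Suc k))" for y
  proof (rule Suc.IH [OF inj])
    fix x assume x: "\<And>i. i \<in> {1..k} \<Longrightarrow> x $ e i \<in> path_image (g i)"
      "\<And>j. j \<notin> e ` {1..k} \<Longrightarrow> x $ j = upd e (Suc k) y w $ j"
    have nin: "e (Suc k) \<notin> e ` {1..k}"
      using inj_on_image_mem_iff [OF Suc.prems(1), of "Suc k" "{1..k}"] by auto
    show "(p, x) \<in> \<Omega>"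
    proof (rule Suc.prems(2))
      show "x $ e i \<in> path_image (g i)" if "i \<in> {1..Suc k}" for i
        using x y nin that by (cases "i = Suc k") (auto simp: upd_nth)
      show "x $ j = w $ j" if "j \<notin> e ` {1..Suc k}" for j
      proof -
        have "j \<notin> e ` {1..k}" "j \<noteq> e (Suc k)" using that by auto
        then show ?thesis using x(2)[of j] by (simp add: upd_nth)
      qed
    qed
  qed
  then show ?case by simp
qed

lemma slabD:
  assumes "(p, w) \<in> slab e g k \<Omega>" "\<And>i. i \<in> {1..k} \<Longrightarrow> x $ e i \<in> path_image (g i)"
    "\<And>j. j \<notin> e ` {1..k} \<Longrightarrow> x $ j = w $ j"
  shows "(p, x) \<in> \<Omega>"
  using assms
proof (induction k arbitrary: w)
  case 0
  then have "x = w" by (simp add: vec_eq_iff)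
  with 0 show ?case by simp
next
  case (Suc k)
  show ?case
  proof (rule Suc.IH [of "upd e (Suc k) (x $ e (Suc k)) w"])
    show "(p, upd e (Suc k) (x $ e (Suc k)) w) \<in> slab e g k \<Omega>" using Suc.prems(1,2) by simp
    fix j assume j: "j \<notin> e ` {1..k}"
    show "x $ j = upd e (Suc k) (x $ e (Suc k)) w $ j"
    proof (cases "j = e (Suc k)")
      case False
      then have "j \<notin> e ` {1..Suc k}" using j by (auto simp: atLeastAtMostSuc_conv)
      then show ?thesis using Suc.prems(3) False by (simp add: upd_nth)
    qed (simp add: upd_nth)
  qed (use Suc.prems in auto)
qed

lemma prod_path_integral_slab_cong:
  assumes "(p, w) \<in> slab e g k \<Omega>" "\<And>x. (p, x) \<in> \<Omega> \<Longrightarrow> F x = G x"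
  shows "prod_path_integral e g k F w = prod_path_integral e g k G w"
  using assms(1)
proof (induction k arbitrary: w)
  case (Suc k)
  then show ?case unfolding prod_path_integral_Suc by (intro contour_integral_eq) auto
qed (simp add: assms(2))

lemma open_Ball_compact:
  fixes \<Omega> :: "('a::topological_space \<times> 'b::topological_space) set"
  assumes "open \<Omega>" "compact K"
  shows "open {q. \<forall>x\<in>K. (q, x) \<in> \<Omega>}"
proof (subst open_subopen, safe)
  fix q assume q: "\<forall>x\<in>K. (q, x) \<in> \<Omega>"
  have "\<forall>\<^sub>F q' in nhds q. \<forall>x\<in>K. (q', x) \<in> \<Omega>"
  proof -
    have "\<exists>A B. open A \<and> open B \<and> q \<in> A \<and> x \<in> B \<and> A \<times> B \<subseteq> \<Omega>" if "x \<in> K" for x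
    proof -
      have "(q, x) \<in> \<Omega>" using q that by blast
      then obtain A B where "open A" "open B" "(q, x) \<in> A \<times> B" "A \<times> B \<subseteq> \<Omega>"
        by (rule open_prod_elim [OF \<open>open \<Omega>\<close>])
      then show ?thesis by auto
    qed
    then obtain A B where AB: "\<And>x. x \<in> K \<Longrightarrow> open (A x) \<and> open (B x) \<and> q \<in> A x \<and> x \<in> B x \<and> A x \<times> B x \<subseteq> \<Omega>"
      by metis
    obtain D where D: "D \<subseteq> K" "finite D" "K \<subseteq> (\<Union>x\<in>D. B x)"
      using compactE_image [OF \<open>compact K\<close>, of K B] AB by blast
    have "\<forall>\<^sub>F q' in nhds q. \<forall>x\<in>D. q' \<in> A x"
      using D AB by (intro eventually_ball_finite) (auto intro: eventually_nhds_in_open)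
    then show ?thesis
      by eventually_elim (use AB D in blast)
  qed
  then show "\<exists>T. open T \<and> q \<in> T \<and> T \<subseteq> {q. \<forall>x\<in>K. (q, x) \<in> \<Omega>}"
    unfolding eventually_nhds by blast
qed

lemma open_slab:
  assumes "open \<Omega>" "\<And>i. i \<in> {1..k} \<Longrightarrow> path (g i)"
  shows "open (slab e g k (\<Omega> :: ('p::cnormed \<times> (complex ^ 'n::finite)) set))"
  using assms
proof (induction k)
  case (Suc k)
  then have o: "open (slab e g k \<Omega>)" by auto
  let ?L = "\<lambda>y::('p \<times> (complex ^ 'n)) \<times> complex. (fst (fst y), upd e (Suc k) (snd y) (snd (fst y)))"
  have "continuous_on UNIV ?L"
    by (intro cdiff_imp_continuous_on cdiff_at_Pair cdiff_at_upd cdiff_at_fst cdiff_at_snd cdiff_at_ident)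
  then have "open (?L -` slab e g k \<Omega>)" using o open_vimage by blast
  moreover have "compact (path_image (g (Suc k)))" using Suc.prems by (intro compact_path_image) auto
  moreover have "slab e g (Suc k) \<Omega> = {q. \<forall>x\<in>path_image (g (Suc k)). (q, x) \<in> ?L -` slab e g k \<Omega>}"
    by auto
  ultimately show ?case using open_Ball_compact by (simp only:)
qed simp

text \<open>The iterated integral is jointly holomorphic in the parameter \<open>p\<close> and in the coordinates that are not
  integrated, and derivatives in the parameter may be taken under the integral.\<close>

theorem prod_path_integral_hol:
  fixes F :: "'p::{euclidean_space,cnormed} \<times> (complex ^ 'n::finite) \<Rightarrow> complex"
  assumes "open \<Omega>" and F: "F \<in> hol_sections \<Omega>" and g: "\<And>i. i \<in> {1..k} \<Longrightarrow> valid_path (g i)"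
  shows "(\<lambda>(p, w). prod_path_integral e g k (\<lambda>x. F (p, x)) w) \<in> hol_sections (slab e g k \<Omega>)"
    and "(p, w) \<in> slab e g k \<Omega> \<Longrightarrow> cderiv (\<lambda>(p, w). prod_path_integral e g k (\<lambda>x. F (p, x)) w) (p, w) (v, 0)
       = prod_path_integral e g k (\<lambda>x. cderiv F (p, x) (v, 0)) w"
proof -
  have "(\<lambda>(p, w). prod_path_integral e g k (\<lambda>x. F (p, x)) w) \<in> hol_sections (slab e g k \<Omega>) \<and>
    (\<forall>p w. (p, w) \<in> slab e g k \<Omega> \<longrightarrow> cderiv (\<lambda>(p, w). prod_path_integral e g k (\<lambda>x. F (p, x)) w) (p, w) (v, 0)
       = prod_path_integral e g k (\<lambda>x. cderiv F (p, x) (v, 0)) w)"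
    using g
  proof (induction k)
    case 0
    have "(\<lambda>(p, w). F (p, w)) = F" by auto
    with F show ?case by simp
  next
    case (Suc k)
    define \<Phi> where "\<Phi> = (\<lambda>(p, w). prod_path_integral e g k (\<lambda>x. F (p, x)) w)"
    let ?S = "slab e g k \<Omega>"
    have \<Phi>: "\<Phi> \<in> hol_sections ?S"
      and d\<Phi>: "\<And>p w. (p, w) \<in> ?S \<Longrightarrow> cderiv \<Phi> (p, w) (v, 0) = prod_path_integral e g k (\<lambda>x. cderiv F (p, x) (v, 0)) w"
      using Suc by (auto simp: \<Phi>_def)
    have oS: "open ?S" using \<open>open \<Omega>\<close> Suc.prems by (intro open_slab valid_path_imp_path) auto
    define L where "L = (\<lambda>y::('p \<times> (complex ^ 'n)) \<times> complex. (fst (fst y), upd e (Suc k) (snd y) (snd (fst y))))"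
    have cL: "cdiff_at L y" for y
      unfolding L_def by (intro cdiff_at_Pair cdiff_at_upd cdiff_at_fst cdiff_at_snd cdiff_at_ident)
    have oL: "open (L -` ?S)" using oS open_vimage cdiff_imp_continuous_on [OF cL] by blast
    define H where "H = (\<lambda>y. \<Phi> (L y))"
    have H: "H \<in> hol_sections (L -` ?S)"
      unfolding H_def hol_sections_iff
      using \<Phi> by (auto simp: hol_sections_iff intro!: cdiff_at_compose [OF cL])
    have eq: "(\<lambda>(p, w). prod_path_integral e g (Suc k) (\<lambda>x. F (p, x)) w)
      = (\<lambda>q. contour_integral (g (Suc k)) (\<lambda>x. H (q, x)))"
      by (auto simp: prod_path_integral_Suc H_def \<Phi>_def L_def)
    have vg: "valid_path (g (Suc k))" using Suc.prems by simp
    have in_slab: "(q, x) \<in> L -` ?S" if "q \<in> slab e g (Suc k) \<Omega>" "x \<in> path_image (g (Suc k))" for q x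
      using that by (auto simp: L_def)
    have "cderiv (\<lambda>(p, w). prod_path_integral e g (Suc k) (\<lambda>x. F (p, x)) w) (p, w) (v, 0)
       = prod_path_integral e g (Suc k) (\<lambda>x. cderiv F (p, x) (v, 0)) w" if q: "(p, w) \<in> slab e g (Suc k) \<Omega>" for p w
    proof -
      have dH: "cderiv H ((p, w), x) ((v, 0), 0) = prod_path_integral e g k (\<lambda>x. cderiv F (p, x) (v, 0)) (upd e (Suc k) x w)"
        if x: "x \<in> path_image (g (Suc k))" for x
      proof -
        have "cderiv H ((p, w), x) ((v, 0), 0) = cderiv \<Phi> (p, upd e (Suc k) x w) (v, 0)"
          by (simp add: cderiv_def H_def L_def)
        then show ?thesis using d\<Phi> in_slab [OF q x] by (simp add: L_def)
      qed
      have "cderiv (\<lambda>(p, w). prod_path_integral e g (Suc k) (\<lambda>x. F (p, x)) w) (p, w) (v, 0)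
        = contour_integral (g (Suc k)) (\<lambda>x. cderiv H ((p, w), x) ((v, 0), 0))"
        unfolding eq by (rule contour_integral_param(2) [OF oL H vg in_slab [OF q]])
      also have "\<dots> = prod_path_integral e g (Suc k) (\<lambda>x. cderiv F (p, x) (v, 0)) w"
        unfolding prod_path_integral_Suc by (rule contour_integral_eq) (rule dH)
      finally show ?thesis .
    qed
    moreover have "(\<lambda>(p, w). prod_path_integral e g (Suc k) (\<lambda>x. F (p, x)) w) \<in> hol_sections (slab e g (Suc k) \<Omega>)"
      unfolding eq hol_sections_iff using contour_integral_param(1) [OF oL H vg in_slab] by blast
    ultimately show ?case by blast
  qed
  then show "(\<lambda>(p, w). prod_path_integral e g k (\<lambda>x. F (p, x)) w) \<in> hol_sections (slab e g k \<Omega>)"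
    and "(p, w) \<in> slab e g k \<Omega> \<Longrightarrow> cderiv (\<lambda>(p, w). prod_path_integral e g k (\<lambda>x. F (p, x)) w) (p, w) (v, 0)
       = prod_path_integral e g k (\<lambda>x. cderiv F (p, x) (v, 0)) w" by blast+
qed

text \<open>The outer integrations only see the values of the inner ones at points on the paths. Used with \<open>j = 0\<close> to
  change the paths or the integrand, and with \<open>j = 1\<close> after an integration by parts in the innermost
  variable.\<close>

lemma prod_path_integral_outer_cong:
  assumes inj: "inj_on e {1..m}" and "j \<le> m"
    and eq: "\<And>w'. (\<And>i. i \<in> {j<..m} \<Longrightarrow> w' $ e i \<in> path_image (g i)) \<Longrightarrow>
       (\<And>l. l \<notin> e ` {j<..m} \<Longrightarrow> w' $ l = w $ l) \<Longrightarrow>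
       prod_path_integral e g j F w' = prod_path_integral e g' j F' w'"
    and gg': "\<And>i. i \<in> {j<..m} \<Longrightarrow> g i = g' i"
  shows "prod_path_integral e g m F w = prod_path_integral e g' m F' w"
  using assms
proof (induction m arbitrary: w)
  case 0
  then show ?case by auto
next
  case (Suc m)
  show ?case
  proof (cases "j = Suc m")
    case True
    then show ?thesis using Suc.prems(3)[of w] by simp
  next
    case False
    then have jm: "j \<le> m" using Suc.prems by simp
    have inj: "inj_on e {1..m}" using Suc.prems(1) by (rule inj_on_subset) auto
    have nin: "e (Suc m) \<notin> e ` {j<..m}"
      using inj_on_image_mem_iff [OF Suc.prems(1), of "Suc m" "{j<..m}"] by (auto simp: subset_iff)
    have "prod_path_integral e g m F (upd e (Suc m) x w) = prod_path_integral e g' m F' (upd e (Suc m) x w)"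
      if x: "x \<in> path_image (g (Suc m))" for x
    proof (rule Suc.IH [OF inj jm])
      fix w' assume w': "\<And>i. i \<in> {j<..m} \<Longrightarrow> w' $ e i \<in> path_image (g i)"
        "\<And>l. l \<notin> e ` {j<..m} \<Longrightarrow> w' $ l = upd e (Suc m) x w $ l"
      show "prod_path_integral e g j F w' = prod_path_integral e g' j F' w'"
      proof (rule Suc.prems(3))
        show "w' $ e i \<in> path_image (g i)" if "i \<in> {j<..Suc m}" for i
          using w' x nin that by (cases "i = Suc m") (auto simp: upd_nth)
        show "w' $ l = w $ l" if "l \<notin> e ` {j<..Suc m}" for l
        proof -
          have "l \<notin> e ` {j<..m}" "l \<noteq> e (Suc m)" using that jm by auto
          then show ?thesis using w'(2)[of l] by (simp add: upd_nth)
        qed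
      qed
    qed (use Suc.prems(4) in auto)
    moreover have "g (Suc m) = g' (Suc m)" using Suc.prems(4) jm by simp
    ultimately show ?thesis
      unfolding prod_path_integral_Suc by (metis (no_types, lifting) contour_integral_eq)
  qed
qed

lemma prod_path_integral_indep:
  assumes "\<And>j. j \<notin> e ` {1..k} \<Longrightarrow> w $ j = w' $ j"
  shows "prod_path_integral e g k F w = prod_path_integral e g k F w'"
  using assms
proof (induction k arbitrary: w w')
  case 0
  then have "w = w'" by (simp add: vec_eq_iff)
  then show ?case by simp
next
  case (Suc k)
  have "prod_path_integral e g k F (upd e (Suc k) x w) = prod_path_integral e g k F (upd e (Suc k) x w')" for x
    by (rule Suc.IH) (use Suc.prems in \<open>auto simp: upd_nth atLeastAtMostSuc_conv\<close>)
  then show ?case by (simp add: prod_path_integral_Suc)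
qed

lemma contour_integral_lmul_any: "contour_integral g (\<lambda>x. c * f x) = c * contour_integral g f"
proof (cases "f contour_integrable_on g \<or> c = 0")
  case True
  then show ?thesis by (auto simp: contour_integral_lmul)
next
  case False
  then have "\<not> (\<lambda>x. c * f x) contour_integrable_on g"
    using contour_integrable_lmul [of "\<lambda>x. c * f x" g "inverse c"] by (auto simp flip: mult.assoc)
  with False show ?thesis by (simp add: not_integrable_contour_integral)
qed

text \<open>No integrability is needed here: by convention a function that is not integrable has integral \<open>0\<close>, and its
  nonzero multiples are not integrable either.\<close>

lemma prod_path_integral_lmul:
  "prod_path_integral e g k (\<lambda>x. c * F x) w = c * prod_path_integral e g k F w"
  by (induction k arbitrary: w) (simp_all add: prod_path_integral_Suc contour_integral_lmul_any)

lemma prod_path_integral_inner_holomorphic: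
  fixes F :: "'p::{euclidean_space,cnormed} \<times> (complex ^ 'n::finite) \<Rightarrow> complex"
  assumes "open \<Omega>" and F: "F \<in> hol_sections \<Omega>" and g: "\<And>i. i \<in> {1..k} \<Longrightarrow> valid_path (g i)"
    and "open S" and S: "\<And>x. x \<in> S \<Longrightarrow> (p, upd e l x w) \<in> slab e g k \<Omega>"
  shows "(\<lambda>x. prod_path_integral e g k (\<lambda>x. F (p, x)) (upd e l x w)) holomorphic_on S"
proof -
  have "(\<lambda>x. (\<lambda>(p, w). prod_path_integral e g k (\<lambda>x. F (p, x)) w) (p, upd e l x w)) holomorphic_on S"
    using prod_path_integral_hol(1) [OF assms(1-3)] \<open>open S\<close>
  proof (rule hol_sections_holomorphic_on)
    show "cdiff_at (\<lambda>x. (p, upd e l x w)) x" for x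
      by (intro cdiff_at_Pair cdiff_at_upd cdiff_at_const cdiff_at_ident)
  qed (use S in auto)
  then show ?thesis by simp
qed

lemma prod_path_integral_inner_integrable:
  fixes F :: "'p::{euclidean_space,cnormed} \<times> (complex ^ 'n::finite) \<Rightarrow> complex"
  assumes "open \<Omega>" and F: "F \<in> hol_sections \<Omega>" and g: "\<And>i. i \<in> {1..Suc k} \<Longrightarrow> valid_path (g i)"
    and pw: "(p, w) \<in> slab e g (Suc k) \<Omega>"
  shows "(\<lambda>x. prod_path_integral e g k (\<lambda>x. F (p, x)) (upd e (Suc k) x w)) contour_integrable_on g (Suc k)"
proof -
  have o: "open (slab e g k \<Omega>)"
    using assms by (intro open_slab) (auto intro: valid_path_imp_path)
  define S where "S = {x. (p, upd e (Suc k) x w) \<in> slab e g k \<Omega>}"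
  have "continuous_on UNIV (\<lambda>x. (p, upd e (Suc k) x w))"
    by (intro cdiff_imp_continuous_on cdiff_at_Pair cdiff_at_upd cdiff_at_const cdiff_at_ident)
  then have "open ((\<lambda>x. (p, upd e (Suc k) x w)) -` slab e g k \<Omega>)"
    using o open_vimage by blast
  then have "open S" by (simp add: S_def vimage_def)
  moreover have "(\<lambda>x. prod_path_integral e g k (\<lambda>x. F (p, x)) (upd e (Suc k) x w)) holomorphic_on S"
    using assms \<open>open S\<close> by (intro prod_path_integral_inner_holomorphic) (auto simp: S_def)
  ultimately show ?thesis
    using g pw by (intro contour_integrable_holomorphic_simple) (auto simp: S_def)
qed

lemma prod_path_integral_add:
  fixes F G :: "'p::{euclidean_space,cnormed} \<times> (complex ^ 'n::finite) \<Rightarrow> complex"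
  assumes "open \<Omega>" "F \<in> hol_sections \<Omega>" "G \<in> hol_sections \<Omega>"
    and "\<And>i. i \<in> {1..k} \<Longrightarrow> valid_path (g i)" and "(p, w) \<in> slab e g k \<Omega>"
  shows "prod_path_integral e g k (\<lambda>x. F (p, x) + G (p, x)) w =
    prod_path_integral e g k (\<lambda>x. F (p, x)) w + prod_path_integral e g k (\<lambda>x. G (p, x)) w"
  using assms(4,5)
proof (induction k arbitrary: w)
  case (Suc k)
  have "contour_integral (g (Suc k)) (\<lambda>y. prod_path_integral e g k (\<lambda>x. F (p, x) + G (p, x)) (upd e (Suc k) y w))
    = contour_integral (g (Suc k)) (\<lambda>y. prod_path_integral e g k (\<lambda>x. F (p, x)) (upd e (Suc k) y w) +
        prod_path_integral e g k (\<lambda>x. G (p, x)) (upd e (Suc k) y w))"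
    using Suc by (intro contour_integral_eq) auto
  then show ?case
    unfolding prod_path_integral_Suc
    using prod_path_integral_inner_integrable [OF assms(1,2) Suc.prems]
      prod_path_integral_inner_integrable [OF assms(1,3) Suc.prems]
    by (simp add: contour_integral_add)
qed simp

lemma prod_path_integral_zero: "prod_path_integral e g k (\<lambda>x. 0) w = 0"
  using prod_path_integral_lmul [of e g k 0 "\<lambda>x. 0" w] by simp

lemma prod_path_integral_sum:
  fixes F :: "'i \<Rightarrow> 'p::{euclidean_space,cnormed} \<times> (complex ^ 'n::finite) \<Rightarrow> complex"
  assumes "finite I" "open \<Omega>" "\<And>a. a \<in> I \<Longrightarrow> F a \<in> hol_sections \<Omega>"
    and "\<And>i. i \<in> {1..k} \<Longrightarrow> valid_path (g i)" and "(p, w) \<in> slab e g k \<Omega>"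
  shows "prod_path_integral e g k (\<lambda>x. \<Sum>a\<in>I. F a (p, x)) w =
    (\<Sum>a\<in>I. prod_path_integral e g k (\<lambda>x. F a (p, x)) w)"
  using assms(1,3)
proof (induction I rule: finite_induct)
  case (insert a I)
  have "(\<lambda>q. \<Sum>a\<in>I. F a q) \<in> hol_sections \<Omega>" using insert.prems by (intro hol_sections_sum) auto
  with insert show ?case
    using prod_path_integral_add [OF assms(2) _ _ assms(4,5), of "F a" "\<lambda>q. \<Sum>a\<in>I. F a q"] by simp
qed (simp add: prod_path_integral_zero)

text \<open>All paths may be replaced at once, each inside its own open set \<open>S i\<close>, as long as each replacement is
  harmless for functions of one variable that are holomorphic on \<open>S i\<close>.\<close>

lemma prod_path_integral_deform:
  fixes F :: "'p::{euclidean_space,cnormed} \<times> (complex ^ 'n::finite) \<Rightarrow> complex"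
  assumes e: "bij_betw e {1..n} UNIV" and "open \<Omega>" and F: "F \<in> hol_sections \<Omega>"
    and S: "\<And>i. i \<in> {1..n} \<Longrightarrow> open (S i)"
    and sub: "\<And>x. (\<And>i. i \<in> {1..n} \<Longrightarrow> x $ e i \<in> S i) \<Longrightarrow> (p, x) \<in> \<Omega>"
    and g: "\<And>i. i \<in> {1..n} \<Longrightarrow> valid_path (g i) \<and> path_image (g i) \<subseteq> S i"
    and g': "\<And>i. i \<in> {1..n} \<Longrightarrow> valid_path (g' i) \<and> path_image (g' i) \<subseteq> S i"
    and eq: "\<And>i f. i \<in> {1..n} \<Longrightarrow> f holomorphic_on S i \<Longrightarrow> contour_integral (g i) f = contour_integral (g' i) f"
  shows "prod_path_integral e g n (\<lambda>x. F (p, x)) w = prod_path_integral e g' n (\<lambda>x. F (p, x)) w"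
proof -
  have inj: "inj_on e {1..n}" using e by (simp add: bij_betw_def)
  have slab: "(p, w) \<in> slab e g' k \<Omega>" if "k \<le> n" "\<And>i. i \<in> {k<..n} \<Longrightarrow> w $ e i \<in> S i" for k w
  proof (rule slabI)
    show "inj_on e {1..k}" using inj that by (auto intro: inj_on_subset)
    fix x assume x: "\<And>i. i \<in> {1..k} \<Longrightarrow> x $ e i \<in> path_image (g' i)" "\<And>j. j \<notin> e ` {1..k} \<Longrightarrow> x $ j = w $ j"
    show "(p, x) \<in> \<Omega>"
    proof (rule sub)
      fix i assume i: "i \<in> {1..n}"
      show "x $ e i \<in> S i"
      proof (cases "i \<le> k")
        case True
        then show ?thesis using x(1) [of i] g' [of i] i by auto
      next
        case False
        then have "e i \<notin> e ` {1..k}"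
          using inj_on_image_mem_iff [OF inj i, of "{1..k}"] that(1) by auto
        then show ?thesis using x(2) that(2) [of i] False i by auto
      qed
    qed
  qed
  have "prod_path_integral e g k (\<lambda>x. F (p, x)) w = prod_path_integral e g' k (\<lambda>x. F (p, x)) w"
    if "k \<le> n" "\<And>i. i \<in> {k<..n} \<Longrightarrow> w $ e i \<in> S i" for k w
    using that
  proof (induction k arbitrary: w)
    case (Suc k)
    let ?i = "Suc k"
    have i: "?i \<in> {1..n}" using Suc.prems by simp
    have w: "upd e ?i y w $ e j \<in> S j" if "y \<in> S ?i" "j \<in> {k<..n}" for y j
    proof (cases "j = ?i")
      case False
      then have "e j \<noteq> e ?i" using inj_on_eq_iff [OF inj _ i, of j] Suc.prems(1) that by auto
      then show ?thesis using Suc.prems(2) [of j] False that by (auto simp: upd_nth)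
    qed (use that in \<open>simp add: upd_nth\<close>)
    have "contour_integral (g ?i) (\<lambda>y. prod_path_integral e g k (\<lambda>x. F (p, x)) (upd e ?i y w))
        = contour_integral (g ?i) (\<lambda>y. prod_path_integral e g' k (\<lambda>x. F (p, x)) (upd e ?i y w))"
      by (rule contour_integral_eq, rule Suc.IH) (use Suc.prems w g [OF i] in auto)
    also have "\<dots> = contour_integral (g' ?i) (\<lambda>y. prod_path_integral e g' k (\<lambda>x. F (p, x)) (upd e ?i y w))"
    proof (rule eq [OF i])
      show "(\<lambda>y. prod_path_integral e g' k (\<lambda>x. F (p, x)) (upd e ?i y w)) holomorphic_on S ?i"
        using \<open>open \<Omega>\<close> F
      proof (rule prod_path_integral_inner_holomorphic)
        show "(p, upd e ?i y w) \<in> slab e g' k \<Omega>" if "y \<in> S ?i" for y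
          by (rule slab) (use Suc.prems w that in auto)
      qed (use g' S [OF i] Suc.prems in auto)
    qed
    finally show ?case by (simp add: prod_path_integral_Suc)
  qed simp
  from this [of n w] show ?thesis by auto
qed

lemma prod_path_integral_trivial:
  assumes "j \<in> {1..k}" "\<And>f. contour_integral (g j) f = 0"
  shows "prod_path_integral e g k F w = 0"
  using assms(1)
proof (induction k arbitrary: w)
  case (Suc k)
  then show ?case
    using assms(2) by (cases "j = Suc k") (auto simp: prod_path_integral_Suc)
qed simp

lemma contour_integral_affine:
  assumes g: "valid_path g" and "b \<noteq> 0"
  shows "contour_integral (\<lambda>t. a + b * g t) f = b * contour_integral g (\<lambda>x. f (a + b * x))"
proof -
  obtain S where S: "finite S" "g C1_differentiable_on {0..1} - S"
    using g unfolding valid_path_def piecewise_C1_differentiable_on_def by blast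
  have vd: "vector_derivative (\<lambda>t. a + b * g t) (at t) = b * vector_derivative g (at t)"
    if "t \<in> {0..1} - S" for t
  proof -
    have "g differentiable at t"
      using S(2) that unfolding C1_differentiable_on_def
      by (auto dest: differentiableI_vector)
    then have "(g has_vector_derivative vector_derivative g (at t)) (at t)"
      by (simp add: vector_derivative_works)
    then have "((\<lambda>t. a + b * g t) has_vector_derivative b * vector_derivative g (at t)) (at t)"
      by (auto intro!: derivative_eq_intros)
    then show ?thesis by (rule vector_derivative_at)
  qed
  have "contour_integral (\<lambda>t. a + b * g t) f
    = integral {0..1} (\<lambda>t. f (a + b * g t) * vector_derivative (\<lambda>t. a + b * g t) (at t))"
    by (rule contour_integral_integral)
  also have "\<dots> = integral {0..1} (\<lambda>t. b * (f (a + b * g t) * vector_derivative g (at t)))"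
    by (rule integral_spike [of S]) (use S(1) vd in \<open>auto simp: negligible_finite\<close>)
  also have "\<dots> = b * integral {0..1} (\<lambda>t. f (a + b * g t) * vector_derivative g (at t))"
    by simp
  finally show ?thesis by (simp add: contour_integral_integral)
qed

lemma prod_path_integral_affine:
  fixes F :: "(complex ^ 'n::finite) \<Rightarrow> complex" and a b :: "complex ^ 'n"
  assumes "inj_on e {1..k}" and "\<And>i. i \<in> {1..k} \<Longrightarrow> valid_path (g i)" and b: "\<And>j. b $ j \<noteq> 0"
  shows "prod_path_integral e (\<lambda>i t. a $ e i + b $ e i * g i t) k F (\<chi> j. a $ j + b $ j * w $ j) =
    (\<Prod>i=1..k. b $ e i) * prod_path_integral e g k (\<lambda>x. F (\<chi> j. a $ j + b $ j * x $ j)) w"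
  using assms(1,2)
proof (induction k arbitrary: w)
  case (Suc k)
  have inj: "inj_on e {1..k}" using Suc.prems(1) by (rule inj_on_subset) auto
  have u: "upd e (Suc k) (a $ e (Suc k) + b $ e (Suc k) * y) (\<chi> j. a $ j + b $ j * w $ j)
    = (\<chi> j. a $ j + b $ j * upd e (Suc k) y w $ j)" for y
    by (simp add: vec_eq_iff upd_nth)
  have IH: "prod_path_integral e (\<lambda>i t. a $ e i + b $ e i * g i t) k F (\<chi> j. a $ j + b $ j * v $ j) =
    (\<Prod>i=1..k. b $ e i) * prod_path_integral e g k (\<lambda>x. F (\<chi> j. a $ j + b $ j * x $ j)) v" for v
    using Suc.prems(2) by (intro Suc.IH [OF inj]) auto
  show ?case
    unfolding prod_path_integral_Suc contour_integral_affine [OF Suc.prems(2) b, of "Suc k", simplified] u IH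
    by (simp add: contour_integral_lmul_any)
qed simp

section \<open>Values shared by all small parameters\<close>

text \<open>The integration cycle after the substitution \<open>w\<^sub>1 = z\<^sub>1 + \<eta> x\<^sub>1\<close>, \<open>w\<^sub>i = z\<^sub>i + x\<^sub>i\<close>: a path \<open>p\<close> for \<open>x\<^sub>1\<close>
  and circles of radius \<open>R\<close> around \<open>0\<close> for the other coordinates.\<close>

definition path_system :: "(real \<Rightarrow> complex) \<Rightarrow> real \<Rightarrow> nat \<Rightarrow> real \<Rightarrow> complex" where
  "path_system p R i = (if i = 1 then p else circlepath 0 R)"

text \<open>The integral over the product of the path \<open>P \<epsilon>\<close> and of circles of radius \<open>|\<eta>| / \<rho> + \<epsilon>\<close>, with the
  Jacobian \<open>\<eta>\<close> of the substitution \<open>w\<^sub>1 = z\<^sub>1 + \<eta> x\<^sub>1\<close>.\<close>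

definition scaled_integral :: "(nat \<Rightarrow> 'n::finite) \<Rightarrow> real \<Rightarrow> (((complex ^ 'n) \<times> complex) \<times> (complex ^ 'n) \<Rightarrow> complex) \<Rightarrow>
    (real \<Rightarrow> real \<Rightarrow> complex) \<Rightarrow> (complex ^ 'n) \<times> complex \<Rightarrow> real \<Rightarrow> complex" where
  "scaled_integral e \<rho> F P q \<epsilon> =
     snd q * prod_path_integral e (path_system (P \<epsilon>) (cmod (snd q) / \<rho> + \<epsilon>)) CARD('n) (\<lambda>x. F (q, x)) 0"

text \<open>The value shared by all sufficiently small \<open>\<epsilon>\<close>; it is meaningful only where there is one.\<close>

definition stable_integral :: "(nat \<Rightarrow> 'n::finite) \<Rightarrow> real \<Rightarrow> (((complex ^ 'n) \<times> complex) \<times> (complex ^ 'n) \<Rightarrow> complex) \<Rightarrow>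
    (real \<Rightarrow> real \<Rightarrow> complex) \<Rightarrow> (complex ^ 'n) \<times> complex \<Rightarrow> complex" where
  "stable_integral e \<rho> F P q = (THE c. \<forall>\<^sub>F \<epsilon> in at_right 0. scaled_integral e \<rho> F P q \<epsilon> = c)"

lemma The_eventually_const:
  assumes "\<forall>\<^sub>F \<epsilon> in at_right (0::real). f \<epsilon> = c"
  shows "(THE c. \<forall>\<^sub>F \<epsilon> in at_right (0::real). f \<epsilon> = c) = c"
proof (rule the_equality [where P = "\<lambda>c. \<forall>\<^sub>F \<epsilon> in at_right (0::real). f \<epsilon> = c", OF assms])
  fix c' assume "\<forall>\<^sub>F \<epsilon> in at_right (0::real). f \<epsilon> = c'"
  with assms have "\<forall>\<^sub>F \<epsilon> in at_right (0::real). c' = c" by eventually_elim simp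
  then show "c' = c" by simp
qed

lemma stable_integral_eqI: "\<forall>\<^sub>F \<epsilon> in at_right 0. scaled_integral e \<rho> F P q \<epsilon> = c \<Longrightarrow> stable_integral e \<rho> F P q = c"
  unfolding stable_integral_def by (rule The_eventually_const)

text \<open>A family of paths \<open>P \<delta>\<close>, \<open>\<delta> > 0\<close>, such that a change of \<open>\<delta>\<close> does not affect integrals of functions that
  are holomorphic near all the intermediate paths. For the family at hand the end points are fixed;
  constant families also qualify.\<close>

definition deformation_family :: "(real \<Rightarrow> real \<Rightarrow> complex) \<Rightarrow> bool" where
  "deformation_family P \<longleftrightarrow> (\<forall>\<delta>>0. valid_path (P \<delta>)) \<and>
    (\<forall>\<delta> \<delta>' f T. 0 < \<delta> \<longrightarrow> \<delta> \<le> \<delta>' \<longrightarrow> open T \<longrightarrow> (\<forall>\<delta>''. \<delta> \<le> \<delta>'' \<longrightarrow> \<delta>'' \<le> \<delta>' \<longrightarrow> path_image (P \<delta>'') \<subseteq> T) \<longrightarrow>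
       f holomorphic_on T \<longrightarrow> contour_integral (P \<delta>) f = contour_integral (P \<delta>') f)"

lemma deformation_family_const: "valid_path p \<Longrightarrow> deformation_family (\<lambda>\<delta>. p)"
  by (simp add: deformation_family_def)

text \<open>The paths are affine in their parameter, so the linear homotopy between two members of a family runs
  through the intermediate members.\<close>

lemma mem_segment_affine:
  assumes "y \<in> closed_segment (a + of_real \<delta> * b) (a + of_real \<delta>' * b)" "\<delta> \<le> \<delta>'"
  shows "\<exists>\<delta>''. \<delta> \<le> \<delta>'' \<and> \<delta>'' \<le> \<delta>' \<and> y = a + of_real \<delta>'' * (b::complex)"
proof -
  obtain u where u: "0 \<le> u" "u \<le> 1"
    "y = (1 - u) *\<^sub>R (a + of_real \<delta> * b) + u *\<^sub>R (a + of_real \<delta>' * b)"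
    using assms(1) by (auto simp: in_segment)
  define \<delta>'' where "\<delta>'' = (1 - u) * \<delta> + u * \<delta>'"
  have "y = a + of_real \<delta>'' * b"
    using u by (simp add: \<delta>''_def scaleR_conv_of_real algebra_simps)
  moreover have "\<delta>'' = \<delta> + u * (\<delta>' - \<delta>)" "\<delta>'' = \<delta>' - (1 - u) * (\<delta>' - \<delta>)"
    by (auto simp: \<delta>''_def algebra_simps)
  moreover have "0 \<le> u * (\<delta>' - \<delta>)" "0 \<le> (1 - u) * (\<delta>' - \<delta>)"
    using u assms(2) by (auto intro!: mult_nonneg_nonneg)
  ultimately show ?thesis by (intro exI [of _ \<delta>'']) auto
qed

lemma circlepath_invariant:
  assumes "R \<le> R'" "open T" "\<And>R''. R \<le> R'' \<Longrightarrow> R'' \<le> R' \<Longrightarrow> path_image (circlepath 0 R'') \<subseteq> T"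
    "f holomorphic_on T"
  shows "contour_integral (circlepath 0 R) f = contour_integral (circlepath 0 R') f"
proof (rule Cauchy_theorem_homotopic_loops [OF _ \<open>open T\<close> \<open>f holomorphic_on T\<close>])
  show "homotopic_loops T (circlepath 0 R) (circlepath 0 R')"
  proof (rule homotopic_loops_linear)
    fix t :: real assume t: "t \<in> {0..1}"
    have c: "circlepath 0 R t = 0 + of_real R * exp (2 * of_real pi * \<i> * of_real t)" for R
      by (simp add: circlepath)
    show "closed_segment (circlepath 0 R t) (circlepath 0 R' t) \<subseteq> T"
    proof
      fix y assume "y \<in> closed_segment (circlepath 0 R t) (circlepath 0 R' t)"
      then obtain R'' where "R \<le> R''" "R'' \<le> R'" "y = circlepath 0 R'' t"
        unfolding c using mem_segment_affine assms(1) by blast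
      then show "y \<in> T" using assms(3) [of R''] t by (auto simp: path_image_def)
    qed
  qed auto
qed auto

text \<open>Near each point of \<open>Q\<close> there are a parameter \<open>\<delta>0\<close> and a radius \<open>R0\<close>, independent of the point, such that the
  cycles with \<open>\<delta> \<le> \<delta>0\<close>, and with circles of radius between \<open>|\<eta>| / \<rho>\<close> and \<open>R0\<close>, stay in a product of open sets
  that lies in the domain \<open>\<Omega>\<close> of the integrand.\<close>

definition locally_deformable :: "(nat \<Rightarrow> 'n::finite) \<Rightarrow> real \<Rightarrow> (((complex ^ 'n) \<times> complex) \<times> (complex ^ 'n)) set \<Rightarrow>
    (real \<Rightarrow> real \<Rightarrow> complex) \<Rightarrow> ((complex ^ 'n) \<times> complex) set \<Rightarrow> bool" where
  "locally_deformable e \<rho> \<Omega> P Q \<longleftrightarrow> (\<forall>q0\<in>Q. \<exists>N \<delta>0 R0 S. open N \<and> q0 \<in> N \<and> 0 < \<delta>0 \<and>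
     (\<forall>q\<in>N. cmod (snd q) / \<rho> < R0 \<and> (\<forall>i\<in>{1..CARD('n)}. open (S q i)) \<and>
       (\<forall>x. (\<forall>i\<in>{1..CARD('n)}. x $ e i \<in> S q i) \<longrightarrow> (q, x) \<in> \<Omega>) \<and>
       (\<forall>\<delta>. 0 < \<delta> \<longrightarrow> \<delta> \<le> \<delta>0 \<longrightarrow> path_image (P \<delta>) \<subseteq> S q 1) \<and>
       (\<forall>R. cmod (snd q) / \<rho> < R \<longrightarrow> R \<le> R0 \<longrightarrow> (\<forall>i\<in>{2..CARD('n)}. path_image (circlepath 0 R) \<subseteq> S q i))))"

text \<open>Near a given point the integral over a fixed cycle, which does not move with \<open>\<eta>\<close>, is the value
  for all small \<open>\<epsilon>\<close>. This removes the dependence of the cycle on \<open>|\<eta>|\<close>, which is not holomorphic.\<close>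

lemma locally_deformable_local:
  fixes e :: "nat \<Rightarrow> 'n::finite"
  assumes e: "bij_betw e {1..CARD('n)} UNIV" and "open \<Omega>" and P: "deformation_family P"
    and def: "locally_deformable e \<rho> \<Omega> P Q" and "q0 \<in> Q" and "\<rho> > 0"
  obtains N \<delta> R where "open N" "q0 \<in> N" "\<delta> > 0"
    "\<And>q. q \<in> N \<Longrightarrow> (q, 0) \<in> slab e (path_system (P \<delta>) R) CARD('n) \<Omega>"
    "\<And>q. q \<in> N \<Longrightarrow> \<forall>\<^sub>F \<epsilon> in at_right 0. \<epsilon> > 0 \<and> (q, 0) \<in> slab e (path_system (P \<epsilon>) (cmod (snd q) / \<rho> + \<epsilon>)) CARD('n) \<Omega>"
    "\<And>q F. F \<in> hol_sections \<Omega> \<Longrightarrow> q \<in> N \<Longrightarrow>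
       \<forall>\<^sub>F \<epsilon> in at_right 0. scaled_integral e \<rho> F P q \<epsilon> = snd q * prod_path_integral e (path_system (P \<delta>) R) CARD('n) (\<lambda>x. F (q, x)) 0"
proof -
  obtain N \<delta> R S where N: "open N" "q0 \<in> N" "0 < \<delta>" and NR: "\<And>q. q \<in> N \<Longrightarrow> cmod (snd q) / \<rho> < R"
    and oS: "\<And>q i. q \<in> N \<Longrightarrow> i \<in> {1..CARD('n)} \<Longrightarrow> open (S q i)"
    and sub: "\<And>q x. q \<in> N \<Longrightarrow> (\<And>i. i \<in> {1..CARD('n)} \<Longrightarrow> x $ e i \<in> S q i) \<Longrightarrow> (q, x) \<in> \<Omega>"
    and PS: "\<And>q d. q \<in> N \<Longrightarrow> 0 < d \<Longrightarrow> d \<le> \<delta> \<Longrightarrow> path_image (P d) \<subseteq> S q 1"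
    and CS: "\<And>q R' i. q \<in> N \<Longrightarrow> cmod (snd q) / \<rho> < R' \<Longrightarrow> R' \<le> R \<Longrightarrow> i \<in> {2..CARD('n)} \<Longrightarrow>
       path_image (circlepath 0 R') \<subseteq> S q i"
    using bspec [OF def [unfolded locally_deformable_def] \<open>q0 \<in> Q\<close>]
  proof (elim exE conjE)
    fix N \<delta> R S
    assume N: "open N" "q0 \<in> N" "0 < \<delta>" and *: "\<forall>q\<in>N. cmod (snd q) / \<rho> < R \<and> (\<forall>i\<in>{1..CARD('n)}. open (S q i)) \<and>
       (\<forall>x. (\<forall>i\<in>{1..CARD('n)}. x $ e i \<in> S q i) \<longrightarrow> (q, x) \<in> \<Omega>) \<and>
       (\<forall>d. 0 < d \<longrightarrow> d \<le> \<delta> \<longrightarrow> path_image (P d) \<subseteq> S q 1) \<and>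
       (\<forall>R'. cmod (snd q) / \<rho> < R' \<longrightarrow> R' \<le> R \<longrightarrow> (\<forall>i\<in>{2..CARD('n)}. path_image (circlepath 0 R') \<subseteq> S q i))"
    show thesis
      by (rule that [OF N, of R S]) (use * in blast)+
  qed
  have inj: "inj_on e {1..CARD('n)}" using e by (simp add: bij_betw_def)
  have sysS: "valid_path (path_system (P d) R' i) \<and> path_image (path_system (P d) R' i) \<subseteq> S q i"
    if "q \<in> N" "0 < d" "d \<le> \<delta>" "cmod (snd q) / \<rho> < R'" "R' \<le> R" "i \<in> {1..CARD('n)}" for q d R' i
    using that PS [of q d] CS [of q R' i] P by (auto simp: path_system_def deformation_family_def)
  have slab: "(q, 0) \<in> slab e (path_system (P d) R') CARD('n) \<Omega>"
    if "q \<in> N" "0 < d" "d \<le> \<delta>" "cmod (snd q) / \<rho> < R'" "R' \<le> R" for q d R'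
  proof (rule slabI [OF inj])
    fix x assume "\<And>i. i \<in> {1..CARD('n)} \<Longrightarrow> x $ e i \<in> path_image (path_system (P d) R' i)"
    then show "(q, x) \<in> \<Omega>" using sysS [OF that] by (intro sub [OF that(1)]) auto
  qed
  have ev: "\<forall>\<^sub>F \<epsilon> in at_right 0. \<epsilon> > 0 \<and> \<epsilon> \<le> \<delta> \<and> cmod (snd q) / \<rho> + \<epsilon> \<le> R" if "q \<in> N" for q
  proof -
    have "\<forall>\<^sub>F \<epsilon> in at_right 0. \<epsilon> \<in> {0<..<min \<delta> (R - cmod (snd q) / \<rho>)}"
      using N(3) NR [OF that] by (intro eventually_at_right_real) auto
    then show ?thesis by eventually_elim auto
  qed
  show ?thesis
  proof (rule that [OF N])
    show "(q, 0) \<in> slab e (path_system (P \<delta>) R) CARD('n) \<Omega>" if "q \<in> N" for q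
      using slab [OF that N(3) order_refl NR [OF that] order_refl] .
    show "\<forall>\<^sub>F \<epsilon> in at_right 0. \<epsilon> > 0 \<and> (q, 0) \<in> slab e (path_system (P \<epsilon>) (cmod (snd q) / \<rho> + \<epsilon>)) CARD('n) \<Omega>" if "q \<in> N" for q
      using ev [OF that] by eventually_elim (use slab [OF that] in auto)
    fix q F assume F: "F \<in> hol_sections \<Omega>" and q: "q \<in> N"
    show "\<forall>\<^sub>F \<epsilon> in at_right 0. scaled_integral e \<rho> F P q \<epsilon> = snd q * prod_path_integral e (path_system (P \<delta>) R) CARD('n) (\<lambda>x. F (q, x)) 0"
      using ev [OF q]
    proof eventually_elim
      case (elim \<epsilon>)
      define R' where "R' = cmod (snd q) / \<rho> + \<epsilon>"
      have R': "cmod (snd q) / \<rho> < R'" "R' \<le> R" using elim by (auto simp: R'_def)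
      have "prod_path_integral e (path_system (P \<epsilon>) R') CARD('n) (\<lambda>x. F (q, x)) 0
        = prod_path_integral e (path_system (P \<delta>) R) CARD('n) (\<lambda>x. F (q, x)) 0"
      proof (rule prod_path_integral_deform [OF e \<open>open \<Omega>\<close> F oS [OF q] sub [OF q]])
        fix i f assume i: "i \<in> {1..CARD('n)}" and f: "f holomorphic_on S q i"
        show "contour_integral (path_system (P \<epsilon>) R' i) f = contour_integral (path_system (P \<delta>) R i) f"
        proof (cases "i = 1")
          case True
          have "\<forall>d. \<epsilon> \<le> d \<longrightarrow> d \<le> \<delta> \<longrightarrow> path_image (P d) \<subseteq> S q 1" using PS [OF q] elim by auto
          then show ?thesis
            using P elim oS [OF q i] f True unfolding deformation_family_def path_system_def by auto
        next
          case False
          then have "i \<in> {2..CARD('n)}" using i by auto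
          then have "contour_integral (circlepath 0 R') f = contour_integral (circlepath 0 R) f"
            using CS [OF q] R' oS [OF q i] f by (intro circlepath_invariant [where T = "S q i"]) auto
          then show ?thesis using False by (simp add: path_system_def)
        qed
      qed (use sysS [OF q] R' elim N(3) NR [OF q] in auto)
      then show ?case by (simp add: scaled_integral_def R'_def)
    qed
  qed
qed

lemma valid_path_path_system: "deformation_family P \<Longrightarrow> \<delta> > 0 \<Longrightarrow> valid_path (path_system (P \<delta>) R i)"
  by (simp add: path_system_def deformation_family_def)

context
  fixes e :: "nat \<Rightarrow> 'n::finite" and \<rho> :: real and \<Omega> P Q
  assumes e: "bij_betw e {1..CARD('n)} UNIV" and o: "open \<Omega>" and P: "deformation_family P"
    and def: "locally_deformable e \<rho> \<Omega> P Q" and \<rho>: "\<rho> > 0"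
begin

lemma eventually_scaled_integral_eq:
  assumes "F \<in> hol_sections \<Omega>" "q \<in> Q"
  shows "\<forall>\<^sub>F \<epsilon> in at_right 0. scaled_integral e \<rho> F P q \<epsilon> = stable_integral e \<rho> F P q"
proof -
  obtain N \<delta> R where N: "q \<in> N" and
    ev: "\<And>q F. F \<in> hol_sections \<Omega> \<Longrightarrow> q \<in> N \<Longrightarrow>
       \<forall>\<^sub>F \<epsilon> in at_right 0. scaled_integral e \<rho> F P q \<epsilon> = snd q * prod_path_integral e (path_system (P \<delta>) R) CARD('n) (\<lambda>x. F (q, x)) 0"
    by (rule locally_deformable_local [OF e o P def assms(2) \<rho>]) (rule that)
  show ?thesis using ev [OF assms(1) N] stable_integral_eqI [OF ev [OF assms(1) N]] by simp
qed

lemma eventually_slab: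
  assumes "q \<in> Q"
  shows "\<forall>\<^sub>F \<epsilon> in at_right 0. \<epsilon> > 0 \<and> (q, 0) \<in> slab e (path_system (P \<epsilon>) (cmod (snd q) / \<rho> + \<epsilon>)) CARD('n) \<Omega>"
  by (rule locally_deformable_local [OF e o P def assms \<rho>])

text \<open>The first summand of the derivative along \<open>\<eta>\<close> comes from the Jacobian factor \<open>\<eta>\<close> of \<open>scaled_integral\<close>.\<close>

theorem stable_integral_derivative:
  assumes F: "F \<in> hol_sections \<Omega>" and q0: "q0 \<in> Q"
  shows "cdiff_at (stable_integral e \<rho> F P) q0"
    and "snd q0 \<noteq> 0 \<Longrightarrow> cderiv (stable_integral e \<rho> F P) q0 (0, 1)
       = stable_integral e \<rho> F P q0 / snd q0 + stable_integral e \<rho> (\<lambda>p. cderiv F p ((0, 1), 0)) P q0"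
proof -
  obtain N \<delta> R where N: "open N" "q0 \<in> N" "\<delta> > 0" and
    slab: "\<And>q. q \<in> N \<Longrightarrow> (q, 0) \<in> slab e (path_system (P \<delta>) R) CARD('n) \<Omega>" and
    ev: "\<And>q F. F \<in> hol_sections \<Omega> \<Longrightarrow> q \<in> N \<Longrightarrow>
       \<forall>\<^sub>F \<epsilon> in at_right 0. scaled_integral e \<rho> F P q \<epsilon> = snd q * prod_path_integral e (path_system (P \<delta>) R) CARD('n) (\<lambda>x. F (q, x)) 0"
    by (rule locally_deformable_local [OF e o P def q0 \<rho>]) (rule that)
  let ?g = "path_system (P \<delta>) R" and ?n = "CARD('n)"
  have stable_integral: "stable_integral e \<rho> F P q = snd q * prod_path_integral e ?g ?n (\<lambda>x. F (q, x)) 0"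
    if "F \<in> hol_sections \<Omega>" "q \<in> N" for F q
    by (rule stable_integral_eqI [OF ev [OF that]])
  define J where "J = (\<lambda>(q, w). prod_path_integral e ?g ?n (\<lambda>x. F (q, x)) w)"
  have vp: "\<And>i. i \<in> {1..?n} \<Longrightarrow> valid_path (?g i)" using valid_path_path_system [OF P N(3)] by blast
  have J: "J \<in> hol_sections (slab e ?g ?n \<Omega>)"
    unfolding J_def by (rule prod_path_integral_hol(1) [OF o F vp])
  have cJ: "cdiff_at J (q0, 0)" using J slab [OF N(2)] by (auto simp: hol_sections_iff)
  have dJ: "cderiv J (q0, 0) (v, 0) = prod_path_integral e ?g ?n (\<lambda>x. cderiv F (q0, x) (v, 0)) 0" for v
    unfolding J_def by (rule prod_path_integral_hol(2) [OF o F vp slab [OF N(2)]])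
  have cj: "cdiff_at (\<lambda>q. J (q, 0)) q0"
    by (rule cdiff_at_compose [of "\<lambda>q. (q, 0)" _ J]) (intro cdiff_at_Pair cdiff_at_ident cdiff_at_const cJ)+
  have c: "cdiff_at (\<lambda>q. snd q * J (q, 0)) q0"
    by (intro cdiff_at_mult cdiff_at_snd cdiff_at_ident cj)
  have eqN: "\<forall>\<^sub>F q in nhds q0. snd q * J (q, 0) = stable_integral e \<rho> F P q"
    using eventually_nhds_in_open [OF N(1,2)]
    by eventually_elim (simp add: stable_integral F J_def)
  show "cdiff_at (stable_integral e \<rho> F P) q0" by (rule cdiff_at_cong [OF c eqN])
  then have "(stable_integral e \<rho> F P has_derivative cderiv (stable_integral e \<rho> F P) q0) (at q0)"
    by (rule cdiff_at_has_derivative)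
  assume nz: "snd q0 \<noteq> 0"
  have "((\<lambda>q. snd q * J (q, 0)) has_derivative
      (\<lambda>h. snd q0 * cderiv (\<lambda>q. J (q, 0)) q0 h + snd h * J (q0, 0))) (at q0)"
    by (rule has_derivative_mult [OF _ cdiff_at_has_derivative(1) [OF cj]])
       (rule bounded_linear_imp_has_derivative [OF bounded_linear_snd])
  moreover have "\<forall>\<^sub>F q in at q0. snd q * J (q, 0) = stable_integral e \<rho> F P q"
    using eqN by (simp add: eventually_at_filter eventually_mono)
  moreover have "snd q0 * J (q0, 0) = stable_integral e \<rho> F P q0" using eventually_nhds_x_imp_x [OF eqN] .
  ultimately have der: "(stable_integral e \<rho> F P has_derivative
      (\<lambda>h. snd q0 * cderiv (\<lambda>q. J (q, 0)) q0 h + snd h * J (q0, 0))) (at q0)"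
    using has_derivative_transform_eventually [of "\<lambda>q. snd q * J (q, 0)" _ q0 UNIV "stable_integral e \<rho> F P"] by blast
  have "cderiv (stable_integral e \<rho> F P) q0 (0, 1) = snd q0 * cderiv (\<lambda>q. J (q, 0)) q0 (0, 1) + snd (0::complex ^ 'n, 1::complex) * J (q0, 0)"
  proof (rule cderiv_eqI [OF der])
    fix c and v :: "(complex ^ 'n) \<times> complex"
    have "snd (c *\<^sub>C v) = c * snd v" by (simp add: scaleC_prod_def)
    then show "snd q0 * cderiv (\<lambda>q. J (q, 0)) q0 (c *\<^sub>C v) + snd (c *\<^sub>C v) * J (q0, 0) =
       c * (snd q0 * cderiv (\<lambda>q. J (q, 0)) q0 v + snd v * J (q0, 0))"
      by (simp add: cdiff_at_has_derivative(2) [OF cj] algebra_simps)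
  qed
  also have "cderiv (\<lambda>q. J (q, 0)) q0 (0, 1) = prod_path_integral e ?g ?n (\<lambda>x. cderiv F (q0, x) ((0, 1), 0)) 0"
    unfolding cderiv_slice by (rule dJ)
  also have "snd q0 * \<dots> = stable_integral e \<rho> (\<lambda>p. cderiv F p ((0, 1), 0)) P q0"
    by (subst stable_integral [OF cderiv_hol_sections [OF o F] N(2)]) simp
  also have "snd (0::complex ^ 'n, 1::complex) * J (q0, 0) = stable_integral e \<rho> F P q0 / snd q0"
    using \<open>snd q0 * J (q0, 0) = stable_integral e \<rho> F P q0\<close> nz by (simp add: field_simps)
  finally show "cderiv (stable_integral e \<rho> F P) q0 (0, 1)
       = stable_integral e \<rho> F P q0 / snd q0 + stable_integral e \<rho> (\<lambda>p. cderiv F p ((0, 1), 0)) P q0"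
    by (simp add: add.commute)
qed

lemma stable_integral_hol_sections: "F \<in> hol_sections \<Omega> \<Longrightarrow> stable_integral e \<rho> F P \<in> hol_sections Q"
  unfolding hol_sections_iff [of _ Q] using stable_integral_derivative(1) by blast

lemma stable_integral_sum:
  assumes "finite I" "\<And>a. a \<in> I \<Longrightarrow> F a \<in> hol_sections \<Omega>" "q \<in> Q"
  shows "stable_integral e \<rho> (\<lambda>p. \<Sum>a\<in>I. F a p) P q = (\<Sum>a\<in>I. stable_integral e \<rho> (F a) P q)"
proof (rule stable_integral_eqI)
  have "\<forall>\<^sub>F \<epsilon> in at_right 0. \<forall>a\<in>I. scaled_integral e \<rho> (F a) P q \<epsilon> = stable_integral e \<rho> (F a) P q"
    using assms by (intro eventually_ball_finite) (auto intro: eventually_scaled_integral_eq)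
  then show "\<forall>\<^sub>F \<epsilon> in at_right 0. scaled_integral e \<rho> (\<lambda>p. \<Sum>a\<in>I. F a p) P q \<epsilon> = (\<Sum>a\<in>I. stable_integral e \<rho> (F a) P q)"
    using eventually_slab [OF assms(3)]
  proof eventually_elim
    case (elim \<epsilon>)
    have "scaled_integral e \<rho> (\<lambda>p. \<Sum>a\<in>I. F a p) P q \<epsilon> = (\<Sum>a\<in>I. scaled_integral e \<rho> (F a) P q \<epsilon>)"
      unfolding scaled_integral_def sum_distrib_left [symmetric]
      by (subst prod_path_integral_sum [OF assms(1) o assms(2)]) (use elim valid_path_path_system [OF P] in auto)
    with elim show ?case by simp
  qed
qed

lemma stable_integral_add:
  assumes "F \<in> hol_sections \<Omega>" "G \<in> hol_sections \<Omega>" "q \<in> Q"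
  shows "stable_integral e \<rho> (\<lambda>p. F p + G p) P q = stable_integral e \<rho> F P q + stable_integral e \<rho> G P q"
  using stable_integral_sum [of "UNIV :: bool set" "\<lambda>b. if b then F else G" q] assms
  by (simp add: UNIV_bool add.commute)

lemma stable_integral_cong:
  assumes "q \<in> Q" and "\<And>x. (q, x) \<in> \<Omega> \<Longrightarrow> F (q, x) = G (q, x)"
    and "F \<in> hol_sections \<Omega>"
  shows "stable_integral e \<rho> F P q = stable_integral e \<rho> G P q"
proof -
  have "\<forall>\<^sub>F \<epsilon> in at_right 0. scaled_integral e \<rho> G P q \<epsilon> = stable_integral e \<rho> F P q"
    using eventually_scaled_integral_eq [OF assms(3,1)] eventually_slab [OF assms(1)]
  proof eventually_elim
    case (elim \<epsilon>)
    have "prod_path_integral e (path_system (P \<epsilon>) (cmod (snd q) / \<rho> + \<epsilon>)) CARD('n) (\<lambda>x. F (q, x)) 0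
      = prod_path_integral e (path_system (P \<epsilon>) (cmod (snd q) / \<rho> + \<epsilon>)) CARD('n) (\<lambda>x. G (q, x)) 0"
      using elim assms(2) by (intro prod_path_integral_slab_cong) auto
    with elim show ?case by (simp add: scaled_integral_def)
  qed
  then show ?thesis by (rule stable_integral_eqI [symmetric])
qed

end

lemma stable_integral_lmul:
  assumes "\<forall>\<^sub>F \<epsilon> in at_right 0. scaled_integral e \<rho> F P q \<epsilon> = stable_integral e \<rho> F P q"
  shows "stable_integral e \<rho> (\<lambda>p. c (fst p) * F p) P q = c q * stable_integral e \<rho> F P q"
proof (rule stable_integral_eqI)
  show "\<forall>\<^sub>F \<epsilon> in at_right 0. scaled_integral e \<rho> (\<lambda>p. c (fst p) * F p) P q \<epsilon> = c q * stable_integral e \<rho> F P q"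
    using assms by eventually_elim (simp add: scaled_integral_def prod_path_integral_lmul mult_ac)
qed

section \<open>Sectors and the first path\<close>

text \<open>The sector \<open>\<pi> / 2 - \<theta> < arg x < 3 \<pi> / 2 + \<theta>\<close> as a union of two open half planes, valid
  for \<open>0 < \<theta> < \<pi> / 2\<close>. Its complement is a closed convex cone around the positive real axis.\<close>

definition sector :: "real \<Rightarrow> complex set" where
  "sector \<theta> = {x. Re (x * cis \<theta>) < 0 \<or> Re (x * cis (- \<theta>)) < 0}"

lemma open_sector: "open (sector \<theta>)"
  unfolding sector_def by (intro open_Collect_disj open_Collect_less continuous_intros)

lemma Re_rcis_cis: "Re (rcis k \<phi> * cis \<alpha>) = k * cos (\<phi> + \<alpha>)"
  by (simp add: rcis_def cis_mult mult.assoc)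

lemma arg_between_eq_sector:
  assumes "0 < \<theta>" "\<theta> < pi / 2"
  shows "arg_between (pi / 2 - \<theta>) (3 * pi / 2 + \<theta>) = sector \<theta>"
proof (intro equalityI subsetI)
  fix x assume "x \<in> arg_between (pi / 2 - \<theta>) (3 * pi / 2 + \<theta>)"
  then obtain k \<phi> where k: "k > 0" "pi / 2 - \<theta> < \<phi>" "\<phi> < 3 * pi / 2 + \<theta>" "x = rcis k \<phi>"
    by (auto simp: arg_between_def)
  show "x \<in> sector \<theta>"
  proof (cases "\<phi> + \<theta> < 3 * pi / 2")
    case True
    have "cos (\<phi> + \<theta>) = - cos (\<phi> + \<theta> - pi)" by (simp add: cos_diff)
    moreover have "cos (\<phi> + \<theta> - pi) > 0" using k True by (intro cos_gt_zero_pi) auto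
    ultimately show ?thesis using k mult_pos_neg [of k "cos (\<phi> + \<theta>)"]
      unfolding sector_def mem_Collect_eq k(4) Re_rcis_cis by linarith
  next
    case False
    have "cos (\<phi> - \<theta>) = - cos (\<phi> - \<theta> - pi)" by (simp add: cos_diff)
    moreover have "cos (\<phi> - \<theta> - pi) > 0" using k False assms by (intro cos_gt_zero_pi) auto
    ultimately show ?thesis using k mult_pos_neg [of k "cos (\<phi> + - \<theta>)"]
      unfolding sector_def mem_Collect_eq k(4) Re_rcis_cis by simp
  qed
next
  fix x assume x: "x \<in> sector \<theta>"
  define \<phi> where "\<phi> = Arg x"
  have nz: "x \<noteq> 0" using x by (auto simp: sector_def)
  have x_eq: "x = rcis (cmod x) \<phi>" by (simp add: \<phi>_def rcis_cmod_Arg)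
  have bnd: "- pi < \<phi>" "\<phi> \<le> pi" using Arg_bounded by (auto simp: \<phi>_def)
  have neg: "cos (\<phi> + \<theta>) < 0 \<or> cos (\<phi> - \<theta>) < 0"
  proof -
    have "Re (rcis (cmod x) \<phi> * cis \<theta>) < 0 \<or> Re (rcis (cmod x) \<phi> * cis (- \<theta>)) < 0"
      using x x_eq by (simp add: sector_def)
    then show ?thesis using nz unfolding Re_rcis_cis mult_less_0_iff by auto
  qed
  show "x \<in> arg_between (pi / 2 - \<theta>) (3 * pi / 2 + \<theta>)"
  proof (cases "pi / 2 - \<theta> < \<phi>")
    case True
    then show ?thesis using bnd nz x_eq assms
      unfolding arg_between_def by (intro CollectI exI [of _ "cmod x"] exI [of _ \<phi>]) auto
  next
    case False
    have "\<phi> < \<theta> - pi / 2"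
    proof (rule ccontr)
      assume "\<not> \<phi> < \<theta> - pi / 2"
      then have "cos (\<phi> + \<theta>) \<ge> 0" "cos (\<phi> - \<theta>) \<ge> 0"
        using False assms by (auto intro!: cos_ge_zero)
      with neg show False by auto
    qed
    moreover have "x = rcis (cmod x) (\<phi> + 2 * pi)"
      using x_eq by (simp add: rcis_def flip: cis_mult)
    ultimately show ?thesis using bnd nz assms
      unfolding arg_between_def by (intro CollectI exI [of _ "cmod x"] exI [of _ "\<phi> + 2 * pi"]) auto
  qed
qed

text \<open>The condition \<open>Re (y exp (i \<phi>)) \<ge> 0\<close> passes from two angles to the angles between them, because
  \<open>exp (i \<phi>)\<close> is a combination with nonnegative coefficients of \<open>exp (i \<alpha>)\<close> and \<open>exp (i \<beta>)\<close>.\<close>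

lemma Re_cis_nonneg_between:
  assumes "\<alpha> \<le> \<phi>" "\<phi> \<le> \<beta>" "\<beta> - \<alpha> < pi" "0 \<le> Re (y * cis \<alpha>)" "0 \<le> Re (y * cis \<beta>)"
  shows "0 \<le> Re (y * cis \<phi>)"
proof (cases "\<alpha> = \<beta>")
  case False
  then have pos: "sin (\<beta> - \<alpha>) > 0" using assms by (intro sin_gt_zero) auto
  have "sin (\<beta> - \<alpha>) * Re (y * cis \<phi>) = sin (\<beta> - \<phi>) * Re (y * cis \<alpha>) + sin (\<phi> - \<alpha>) * Re (y * cis \<beta>)"
    by (simp add: sin_diff algebra_simps)
  moreover have "0 \<le> sin (\<beta> - \<phi>)" "0 \<le> sin (\<phi> - \<alpha>)" using assms by (auto intro!: sin_ge_zero)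
  ultimately have "0 \<le> sin (\<beta> - \<alpha>) * Re (y * cis \<phi>)" using assms by simp
  then show ?thesis using pos by (simp add: zero_le_mult_iff)
qed (use assms in auto)

lemma sector_mono:
  assumes "0 \<le> \<tau>" "\<tau> \<le> \<theta>" "\<theta> < pi / 2"
  shows "sector \<tau> \<subseteq> sector \<theta>"
proof
  fix x assume "x \<in> sector \<tau>"
  then show "x \<in> sector \<theta>"
    using Re_cis_nonneg_between [of "- \<theta>" \<tau> \<theta> x] Re_cis_nonneg_between [of "- \<theta>" "- \<tau>" \<theta> x] assms
    unfolding sector_def by (auto simp: not_less [symmetric] simp del: times_complex.sel)
qed

lemma not_sector_add: "x \<notin> sector \<tau> \<Longrightarrow> y \<notin> sector \<tau> \<Longrightarrow> x + y \<notin> sector \<tau>"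
  by (simp add: sector_def algebra_simps)

lemma sector_of_Re_neg:
  assumes "Re y < 0" "\<bar>a\<bar> \<le> \<theta>" "\<theta> < pi / 2"
  shows "y * cis a \<in> sector \<theta>"
proof (rule ccontr)
  assume "y * cis a \<notin> sector \<theta>"
  then have "0 \<le> Re (y * cis (a - \<theta>))" "0 \<le> Re (y * cis (a + \<theta>))"
    by (auto simp: sector_def mult.assoc cis_mult simp del: times_complex.sel)
  then have "0 \<le> Re (y * cis 0)"
    using assms by (intro Re_cis_nonneg_between [of "a - \<theta>" 0 "a + \<theta>"]) auto
  with assms show False by simp
qed

lemma cos_half_pi_plus: "cos ((pi + t) / 2 + b) = - sin (t / 2 + b)"
  by (simp add: add_divide_distrib cos_add sin_add)

text \<open>The path \<open>\<gamma>\<^sub>1\<close> for \<open>z\<^sub>1 = 0\<close> and \<open>\<eta> = 1\<close>, with end points \<open>beta0\<close> and \<open>beta1\<close>; the general one is its affine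
  image. The parameter is the \<open>\<epsilon>\<close> of the arc.\<close>

definition unit_gamma :: "real \<Rightarrow> real \<Rightarrow> real \<Rightarrow> real \<Rightarrow> complex" where
  "unit_gamma \<rho> \<theta> \<delta> = gamma_first \<delta> 0 1 \<rho> \<theta>"

lemma gamma_first_eq: "gamma_first \<epsilon> z \<eta> \<rho> \<theta> = (\<lambda>t. z + \<eta> * unit_gamma \<rho> \<theta> \<epsilon> t)"
  by (rule ext) (simp add: unit_gamma_def gamma_first_def Let_def joinpaths_def linepath_def
      scaleR_conv_of_real algebra_simps)

definition beta0 where "beta0 \<rho> \<theta> = rcis (\<rho> / 2) (- (pi + \<theta>) / 2)"
definition beta1 where "beta1 \<rho> \<theta> = rcis (\<rho> / 2) ((pi + \<theta>) / 2)"

definition unit_arc where "unit_arc \<rho> \<theta> \<delta> t = rcis (\<delta> * \<rho> / 2) ((pi + \<theta>) * (2 * t - 1) / 2)"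

lemma unit_gamma_eq: "unit_gamma \<rho> \<theta> \<delta> = linepath (beta0 \<rho> \<theta>) (of_real \<delta> * beta0 \<rho> \<theta>) +++
    (unit_arc \<rho> \<theta> \<delta> +++ linepath (of_real \<delta> * beta1 \<rho> \<theta>) (beta1 \<rho> \<theta>))"
proof -
  have "unit_arc \<rho> \<theta> \<delta> = (\<lambda>t. 0 + of_real (\<delta> * \<rho> / 2) * 1 * cis ((pi + \<theta>) * (2 * t - 1) / 2))"
    by (simp add: unit_arc_def rcis_def fun_eq_iff)
  then show ?thesis
    unfolding unit_gamma_def gamma_first_def Let_def by (simp add: beta0_def beta1_def rcis_def)
qed

lemma unit_arc_ends:
  "pathstart (unit_arc \<rho> \<theta> \<delta>) = of_real \<delta> * beta0 \<rho> \<theta>" "pathfinish (unit_arc \<rho> \<theta> \<delta>) = of_real \<delta> * beta1 \<rho> \<theta>"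
  by (simp_all add: pathstart_def pathfinish_def unit_arc_def beta0_def beta1_def rcis_def)

lemma pathstart_unit_gamma: "pathstart (unit_gamma \<rho> \<theta> \<delta>) = beta0 \<rho> \<theta>"
  and pathfinish_unit_gamma: "pathfinish (unit_gamma \<rho> \<theta> \<delta>) = beta1 \<rho> \<theta>"
  by (simp_all add: unit_gamma_eq)

lemma valid_path_unit_arc: "valid_path (unit_arc \<rho> \<theta> \<delta>)"
proof -
  have "unit_arc \<rho> \<theta> \<delta> = part_circlepath 0 (\<delta> * \<rho> / 2) (- (pi + \<theta>) / 2) ((pi + \<theta>) / 2)"
  proof
    fix t
    have "linepath (- (pi + \<theta>) / 2) ((pi + \<theta>) / 2) t = (pi + \<theta>) * (2 * t - 1) / 2"
      by (simp add: linepath_def field_simps)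
    then show "unit_arc \<rho> \<theta> \<delta> t = part_circlepath 0 (\<delta> * \<rho> / 2) (- (pi + \<theta>) / 2) ((pi + \<theta>) / 2) t"
      unfolding part_circlepath_def unit_arc_def rcis_def cis_conv_exp
      by (simp only: of_real_linepath [symmetric]) simp
  qed
  then show ?thesis by simp
qed

lemma valid_path_unit_gamma: "valid_path (unit_gamma \<rho> \<theta> \<delta>)"
  unfolding unit_gamma_eq by (intro valid_path_join valid_path_unit_arc valid_path_linepath) (simp_all add: unit_arc_ends)

text \<open>A point of the path has argument \<open>\<plusminus> (\<pi> + \<theta>) / 2\<close> or lies on the arc.\<close>

lemma unit_gamma_cases:
  assumes "x \<in> path_image (unit_gamma \<rho> \<theta> \<delta>)" "0 < \<delta>" "\<delta> \<le> 1" "0 < \<theta>"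
  shows "\<exists>k \<phi>. 0 < k \<and> k \<le> 1 \<and> x = rcis (k * \<rho> / 2) \<phi> \<and> \<bar>\<phi>\<bar> \<le> (pi + \<theta>) / 2 \<and>
    (\<bar>\<phi>\<bar> = (pi + \<theta>) / 2 \<or> k = \<delta>)"
proof -
  have chord: "0 < (1 - u) + u * \<delta>" "(1 - u) + u * \<delta> \<le> 1" if "0 \<le> u" "u \<le> 1" for u
  proof -
    have "u * \<delta> \<le> u * 1" using that assms by (intro mult_left_mono) auto
    then show "(1 - u) + u * \<delta> \<le> 1" by simp
    have "\<delta> * ((1 - u) + u) \<le> (1 - u) + u * \<delta>"
      using that assms mult_right_mono [of \<delta> 1 "1 - u"] by (simp add: algebra_simps)
    then show "0 < (1 - u) + u * \<delta>" using assms by simp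
  qed
  have abs: "\<bar>- (pi + \<theta>) / 2\<bar> = (pi + \<theta>) / 2" "\<bar>(pi + \<theta>) / 2\<bar> = (pi + \<theta>) / 2"
  proof -
    have "0 \<le> (pi + \<theta>) / 2" using assms(4) pi_gt_zero by simp
    then show "\<bar>(pi + \<theta>) / 2\<bar> = (pi + \<theta>) / 2" by (rule abs_of_nonneg)
    then show "\<bar>- (pi + \<theta>) / 2\<bar> = (pi + \<theta>) / 2"
      by (simp only: minus_divide_left [symmetric] abs_minus_cancel)
  qed
  consider "x \<in> closed_segment (of_real \<delta> * beta0 \<rho> \<theta>) (beta0 \<rho> \<theta>)" | "x \<in> path_image (unit_arc \<rho> \<theta> \<delta>)"
    | "x \<in> closed_segment (of_real \<delta> * beta1 \<rho> \<theta>) (beta1 \<rho> \<theta>)"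
    using assms(1) by (auto simp: unit_gamma_eq path_image_join unit_arc_ends closed_segment_commute)
  then show ?thesis
  proof cases
    case 1
    then obtain u where u: "0 \<le> u" "u \<le> 1" "x = (1 - u) *\<^sub>R (of_real \<delta> * beta0 \<rho> \<theta>) + u *\<^sub>R beta0 \<rho> \<theta>"
      by (auto simp: in_segment)
    have "x = rcis (((1 - (1 - u)) + (1 - u) * \<delta>) * \<rho> / 2) (- (pi + \<theta>) / 2)"
      by (simp add: u beta0_def rcis_def scaleR_conv_of_real algebra_simps add_divide_distrib diff_divide_distrib)
    then show ?thesis using chord [of "1 - u"] u(1,2) abs
      by (intro exI [of _ "(1 - (1 - u)) + (1 - u) * \<delta>"] exI [of _ "- (pi + \<theta>) / 2"]) auto
  next
    case 2
    then obtain t where t: "0 \<le> t" "t \<le> 1" "x = unit_arc \<rho> \<theta> \<delta> t" by (auto simp: path_image_def)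
    have "\<bar>(pi + \<theta>) * (2 * t - 1) / 2\<bar> = (pi + \<theta>) * \<bar>2 * t - 1\<bar> / 2"
      using assms(4) pi_gt_zero by (simp add: abs_mult)
    also have "\<dots> \<le> (pi + \<theta>) * 1 / 2"
      using assms(4) pi_gt_zero t by (intro divide_right_mono mult_left_mono) (auto simp: abs_le_iff)
    finally show ?thesis using t assms unfolding unit_arc_def
      by (intro exI [of _ \<delta>] exI [of _ "(pi + \<theta>) * (2 * t - 1) / 2"]) auto
  next
    case 3
    then obtain u where u: "0 \<le> u" "u \<le> 1" "x = (1 - u) *\<^sub>R (of_real \<delta> * beta1 \<rho> \<theta>) + u *\<^sub>R beta1 \<rho> \<theta>"
      by (auto simp: in_segment)
    have "x = rcis (((1 - (1 - u)) + (1 - u) * \<delta>) * \<rho> / 2) ((pi + \<theta>) / 2)"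
      by (simp add: u beta1_def rcis_def scaleR_conv_of_real algebra_simps add_divide_distrib diff_divide_distrib)
    then show ?thesis using chord [of "1 - u"] u(1,2) abs
      by (intro exI [of _ "(1 - (1 - u)) + (1 - u) * \<delta>"] exI [of _ "(pi + \<theta>) / 2"]) auto
  qed
qed

lemma unit_gamma_affine: "\<exists>a b. \<forall>\<delta>. unit_gamma \<rho> \<theta> \<delta> t = a + of_real \<delta> * b"
proof -
  consider "t \<le> 1/2" | "\<not> t \<le> 1/2" "2 * t - 1 \<le> 1/2" | "\<not> t \<le> 1/2" "\<not> 2 * t - 1 \<le> 1/2" by blast
  then show ?thesis
  proof cases
    case 1
    then show ?thesis
      by (intro exI [of _ "(1 - 2 * t) *\<^sub>R beta0 \<rho> \<theta>"] exI [of _ "(2 * t) *\<^sub>R beta0 \<rho> \<theta>"])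
         (simp add: unit_gamma_eq joinpaths_def linepath_def)
  next
    case 2
    then show ?thesis
      by (intro exI [of _ 0] exI [of _ "unit_arc \<rho> \<theta> 1 (2 * (2 * t - 1))"])
         (simp add: unit_gamma_eq joinpaths_def unit_arc_def rcis_def)
  next
    case 3
    then show ?thesis
      by (intro exI [of _ "(2 * (2 * t - 1) - 1) *\<^sub>R beta1 \<rho> \<theta>"] exI [of _ "(1 - (2 * (2 * t - 1) - 1)) *\<^sub>R beta1 \<rho> \<theta>"])
         (simp add: unit_gamma_eq joinpaths_def linepath_def)
  qed
qed

lemma deformation_family_unit_gamma: "deformation_family (unit_gamma \<rho> \<theta>)"
  unfolding deformation_family_def
proof (intro conjI allI impI valid_path_unit_gamma)
  fix \<delta> \<delta>' f T assume *: "0 < \<delta>" "\<delta> \<le> \<delta>'" "open T"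
    "\<forall>\<delta>''. \<delta> \<le> \<delta>'' \<longrightarrow> \<delta>'' \<le> \<delta>' \<longrightarrow> path_image (unit_gamma \<rho> \<theta> \<delta>'') \<subseteq> T" "f holomorphic_on T"
  have "homotopic_paths T (unit_gamma \<rho> \<theta> \<delta>) (unit_gamma \<rho> \<theta> \<delta>')"
  proof (rule homotopic_paths_linear)
    fix t :: real assume t: "t \<in> {0..1}"
    obtain a b where ab: "\<And>\<delta>. unit_gamma \<rho> \<theta> \<delta> t = a + of_real \<delta> * b" using unit_gamma_affine by metis
    show "closed_segment (unit_gamma \<rho> \<theta> \<delta> t) (unit_gamma \<rho> \<theta> \<delta>' t) \<subseteq> T"
    proof
      fix y assume "y \<in> closed_segment (unit_gamma \<rho> \<theta> \<delta> t) (unit_gamma \<rho> \<theta> \<delta>' t)"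
      then obtain \<delta>'' where "\<delta> \<le> \<delta>''" "\<delta>'' \<le> \<delta>'" "y = unit_gamma \<rho> \<theta> \<delta>'' t"
        unfolding ab using mem_segment_affine *(2) by blast
      then show "y \<in> T" using *(4) t unfolding path_image_def by blast
    qed
  qed (auto simp: pathstart_unit_gamma pathfinish_unit_gamma valid_path_unit_gamma valid_path_imp_path)
  then show "contour_integral (unit_gamma \<rho> \<theta> \<delta>) f = contour_integral (unit_gamma \<rho> \<theta> \<delta>') f"
    using * by (intro Cauchy_theorem_homotopic_paths) (auto simp: valid_path_unit_gamma)
qed

section \<open>The substitution and the domain of the integrand\<close>

text \<open>The substitution \<open>w = (z\<^sub>1 + \<eta> x\<^sub>1, z\<^sub>2 + x\<^sub>2, \<dots>, z\<^sub>n + x\<^sub>n)\<close>.\<close>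

definition shear :: "(nat \<Rightarrow> 'n::finite) \<Rightarrow> complex ^ 'n \<Rightarrow> complex \<Rightarrow> complex ^ 'n \<Rightarrow> complex ^ 'n" where
  "shear e z \<eta> x = (\<chi> j. z $ j + (if j = e 1 then \<eta> else 1) * x $ j)"

lemma shear_nth: "shear e z \<eta> x $ j = z $ j + (if j = e 1 then \<eta> else 1) * x $ j"
  by (simp add: shear_def)

lemma shear_eq: "shear e z \<eta> x = (z + x) + ((\<eta> - 1) * x $ e 1) *\<^sub>C axis (e 1) 1"
  by (simp add: vec_eq_iff shear_nth scaleC_axis) (simp add: axis_def algebra_simps)

lemma cdiff_at_shear:
  "cdiff_at f p \<Longrightarrow> cdiff_at g p \<Longrightarrow> cdiff_at h p \<Longrightarrow> cdiff_at (\<lambda>p. shear e (f p) (g p) (h p)) p"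
  unfolding shear_eq
  by (intro cdiff_at_add cdiff_at_scaleC cdiff_at_mult cdiff_at_diff cdiff_at_const cdiff_at_nth)

text \<open>The integrand in the variables \<open>((z, \<eta>), x)\<close>. The maps \<open>to_diag\<close> and \<open>to_Y\<close> below send these variables to
  the points where \<open>\<psi>\<close> and \<open>u\<close> are evaluated.\<close>

definition integrand :: "(nat \<Rightarrow> 'n::finite) \<Rightarrow> (((complex ^ 'n) \<times> (complex ^ 'n)) \<times> complex \<Rightarrow> complex) \<Rightarrow>
    ((complex ^ 'n) \<times> complex \<Rightarrow> complex) \<Rightarrow> ((complex ^ 'n) \<times> complex) \<times> (complex ^ 'n) \<Rightarrow> complex" where
  "integrand e \<psi> u = (\<lambda>((z, \<eta>), x). \<psi> ((z, shear e z \<eta> x), \<eta>) * u (shear e z \<eta> x, \<eta>))"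

definition to_diag :: "(nat \<Rightarrow> 'n::finite) \<Rightarrow> ((complex ^ 'n) \<times> complex) \<times> (complex ^ 'n) \<Rightarrow>
    ((complex ^ 'n) \<times> (complex ^ 'n)) \<times> complex" where
  "to_diag e y = ((fst (fst y), shear e (fst (fst y)) (snd (fst y)) (snd y)), snd (fst y))"

definition to_Y :: "(nat \<Rightarrow> 'n::finite) \<Rightarrow> ((complex ^ 'n) \<times> complex) \<times> (complex ^ 'n) \<Rightarrow> (complex ^ 'n) \<times> complex" where
  "to_Y e y = (shear e (fst (fst y)) (snd (fst y)) (snd y), snd (fst y))"

lemma integrand_eq: "integrand e \<psi> u = (\<lambda>y. \<psi> (to_diag e y) * u (to_Y e y))"
  by (auto simp: integrand_def to_diag_def to_Y_def)

lemma cdiff_at_to_diag: "cdiff_at (to_diag e) y" and cdiff_at_to_Y: "cdiff_at (to_Y e) y"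
  unfolding to_diag_def to_Y_def
  by (intro cdiff_at_Pair cdiff_at_shear cdiff_at_fst cdiff_at_snd cdiff_at_ident)+

lemma open_arg_sector: "open {\<eta>::complex. 0 < cmod \<eta> \<and> cmod \<eta> < r \<and> \<bar>Arg \<eta>\<bar> < t}" if "t \<le> pi"
proof -
  let ?D = "- (\<real>\<^sub>\<le>\<^sub>0 :: complex set)"
  have "open (?D \<inter> (\<lambda>\<eta>. \<bar>Arg \<eta>\<bar>) -` {..<t})"
    by (intro continuous_open_preimage continuous_intros continuous_on_rabs continuous_on_subset [OF continuous_on_Arg])
       auto
  moreover have "open {\<eta>::complex. 0 < cmod \<eta> \<and> cmod \<eta> < r}"
    by (intro open_Collect_conj open_Collect_less continuous_intros)
  moreover have "{\<eta>::complex. 0 < cmod \<eta> \<and> cmod \<eta> < r \<and> \<bar>Arg \<eta>\<bar> < t} =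
      {\<eta>. 0 < cmod \<eta> \<and> cmod \<eta> < r} \<inter> (?D \<inter> (\<lambda>\<eta>. \<bar>Arg \<eta>\<bar>) -` {..<t})"
  proof -
    have "\<eta> \<notin> \<real>\<^sub>\<le>\<^sub>0" if "\<eta> \<noteq> 0" "\<bar>Arg \<eta>\<bar> < t" for \<eta>
    proof
      assume "\<eta> \<in> \<real>\<^sub>\<le>\<^sub>0"
      then have "Re \<eta> < 0 \<and> Im \<eta> = 0" using that(1) by (auto simp: complex_nonpos_Reals_iff complex_eq_iff)
      then have "Arg \<eta> = pi" by (simp add: Arg_eq_pi)
      then show False using that(2) \<open>t \<le> pi\<close> by simp
    qed
    then show ?thesis by auto
  qed
  ultimately show ?thesis by auto
qed

lemma open_S_kappa: "t \<le> 4 * pi \<Longrightarrow> open (S_kappa (a, b, c, t))"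
  using open_arg_sector [of "t / 4" a] by simp

lemma open_Ball_finite: "finite I \<Longrightarrow> (\<And>i. i \<in> I \<Longrightarrow> open {x. P i x}) \<Longrightarrow> open {x. \<forall>i\<in>I. P i x}"
proof -
  assume "finite I" "\<And>i. i \<in> I \<Longrightarrow> open {x. P i x}"
  then have "open (\<Inter>i\<in>I. {x. P i x})" by blast
  moreover have "(\<Inter>i\<in>I. {x. P i x}) = {x. \<forall>i\<in>I. P i x}" by auto
  ultimately show ?thesis by simp
qed

lemma open_vimage_Collect:
  "open A \<Longrightarrow> continuous_on UNIV f \<Longrightarrow> open {x. f x \<in> A}"
  using open_vimage [of A f] by (simp add: vimage_def)

text \<open>The sets \<open>V\<^sup>(\<^sup>B\<^sup>)\<close> for \<open>Y\<close> and \<open>V\<^sup>(\<^sup>A\<^sup>)\<close> for the diagonal.\<close>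

definition VY_inter :: "(nat \<Rightarrow> 'n::finite) \<Rightarrow> kappa \<Rightarrow> nat set \<Rightarrow> ((complex ^ 'n) \<times> complex) set" where
  "VY_inter e \<kappa> B = cover_inter (U_Y e \<kappa>) (V_Y e \<kappa>) B"

definition VD_inter :: "(nat \<Rightarrow> 'n::finite) \<Rightarrow> kappa \<Rightarrow> nat set \<Rightarrow> (((complex ^ 'n) \<times> (complex ^ 'n)) \<times> complex) set" where
  "VD_inter e \<kappa> A = cover_inter (U_diag e \<kappa>) (V_diag e \<kappa>) A"

lemma VY_inter_iff:
  assumes "0 < t" "t < pi / 2" 
  shows "(z, \<eta>) \<in> VY_inter e (a, b, c, t) B \<longleftrightarrow> \<eta> \<in> S_kappa (a, b, c, t) \<and> cmod (z $ e 1) < c * cmod \<eta> \<and>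
    (\<forall>i\<in>{2..CARD('n::finite)}. cmod (z $ (e i :: 'n)) < b) \<and> (1 \<in> B \<longrightarrow> z $ e 1 \<in> sector t) \<and>
    (\<forall>i\<in>B - {1}. cmod \<eta> < c * cmod (z $ e i))"
  using arg_between_eq_sector [OF assms]
  by (auto simp: VY_inter_def cover_inter_def split: if_splits simp del: S_kappa.simps)

lemma VD_inter_iff:
  assumes "0 < t" "t < pi / 2" 
  shows "((z, w), \<eta>) \<in> VD_inter e (a, b, c, t) A \<longleftrightarrow> (\<forall>i\<in>{1..CARD('n)}. cmod (z $ e i) < b) \<and>
    \<eta> \<in> S_kappa (a, b, c, t) \<and> cmod (z $ e 1 - w $ e 1) < c * cmod \<eta> \<and>
    (\<forall>i\<in>{2..CARD('n::finite)}. cmod (z $ (e i :: 'n) - w $ e i) < b) \<and> (1 \<in> A \<longrightarrow> z $ e 1 - w $ e 1 \<in> sector t) \<and>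
    (\<forall>i\<in>A - {1}. cmod \<eta> < c * cmod (z $ e i - w $ e i))"
  using arg_between_eq_sector [OF assms]
  by (auto simp: VD_inter_def cover_inter_def split: if_splits simp del: S_kappa.simps)

lemma open_VY_inter:
  fixes e :: "nat \<Rightarrow> 'a::finite"
  assumes "0 < t" "t < pi / 2" "finite B"
  shows "open (VY_inter e (a, b, c, t) B)"
proof -
  have "VY_inter e (a, b, c, t) B = {p. snd p \<in> S_kappa (a, b, c, t) \<and> cmod (fst p $ e 1) < c * cmod (snd p) \<and>
    (\<forall>i\<in>{2..CARD('a)}. cmod (fst p $ e i) < b) \<and> (1 \<in> B \<longrightarrow> fst p $ e 1 \<in> sector t) \<and>
    (\<forall>i\<in>B - {1}. cmod (snd p) < c * cmod (fst p $ e i))}"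
    unfolding set_eq_iff split_paired_All mem_Collect_eq fst_conv snd_conv VY_inter_iff [OF assms(1,2)] by blast
  also have "open \<dots>"
    using assms open_S_kappa [of t a b c] open_sector [of t]
    by (intro open_Collect_conj open_Ball_finite open_Collect_imp open_Collect_less open_vimage_Collect continuous_intros)
       (auto simp del: S_kappa.simps)
  finally show ?thesis .
qed

lemma open_VD_inter:
  fixes e :: "nat \<Rightarrow> 'a::finite"
  assumes "0 < t" "t < pi / 2" "finite A"
  shows "open (VD_inter e (a, b, c, t) A)"
proof -
  have "VD_inter e (a, b, c, t) A = {p. (\<forall>i\<in>{1..CARD('a)}. cmod (fst (fst p) $ e i) < b) \<and> snd p \<in> S_kappa (a, b, c, t) \<and>
    cmod (fst (fst p) $ e 1 - snd (fst p) $ e 1) < c * cmod (snd p) \<and>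
    (\<forall>i\<in>{2..CARD('a)}. cmod (fst (fst p) $ e i - snd (fst p) $ e i) < b) \<and>
    (1 \<in> A \<longrightarrow> fst (fst p) $ e 1 - snd (fst p) $ e 1 \<in> sector t) \<and>
    (\<forall>i\<in>A - {1}. cmod (snd p) < c * cmod (fst (fst p) $ e i - snd (fst p) $ e i))}"
    unfolding set_eq_iff split_paired_All mem_Collect_eq fst_conv snd_conv VD_inter_iff [OF assms(1,2)] by blast
  also have "open \<dots>"
    using assms open_S_kappa [of t a b c] open_sector [of t]
    by (intro open_Collect_conj open_Ball_finite open_Collect_imp open_Collect_less open_vimage_Collect continuous_intros)
       (auto simp del: S_kappa.simps)
  finally show ?thesis .
qed

lemma VY_inter_mono: "B \<subseteq> B' \<Longrightarrow> VY_inter e k B' \<subseteq> VY_inter e k B"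
  and VD_inter_mono: "A \<subseteq> A' \<Longrightarrow> VD_inter e k A' \<subseteq> VD_inter e k A"
  by (auto simp: VY_inter_def VD_inter_def cover_inter_def)

lemma eq_rcis_Arg: "\<eta> = rcis (cmod \<eta>) (Arg \<eta>)" by (simp add: rcis_cmod_Arg)

text \<open>The standing hypotheses on the enumeration \<open>e\<close>, on \<open>d\<close> and on the two parameter tuples.\<close>

locale composition_setting =
  fixes e :: "nat \<Rightarrow> 'n::finite" and d :: nat
    and r r' \<rho> \<theta> s s' \<sigma> \<tau> :: real
  assumes e: "bij_betw e {1..CARD('n)} UNIV"
    and d: "1 \<le> d" "d \<le> CARD('n)"
    and r': "0 < r'" and \<theta>: "0 < \<theta>" "\<theta> < pi / 2" and \<rho>: "0 < \<rho>" "\<rho> < 1" and r: "0 < r" "r < \<rho> * r'"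
    and s': "0 < s'" and \<tau>: "0 < \<tau>" "\<tau> < pi / 2" and \<sigma>: "0 < \<sigma>" "\<sigma> < 1" and s: "0 < s" "s < \<sigma> * s'"
    and sr: "s < r" and s'r': "s' < r' / 2" and \<tau>\<theta>: "\<tau> < \<theta> / 4" and \<sigma>\<rho>: "\<sigma> < \<rho> / 2 * sin (\<theta> / 4)"
begin

abbreviation "\<kappa> \<equiv> (r, r', \<rho>, \<theta>)"
abbreviation "\<kappa>' \<equiv> (s, s', \<sigma>, \<tau>)"

lemma inj: "inj_on e {1..CARD('n)}" using e by (simp add: bij_betw_def)

lemma e_eq_iff: "i \<in> {1..CARD('n)} \<Longrightarrow> e i = e 1 \<longleftrightarrow> i = 1"
  using inj_on_eq_iff [OF inj, of i 1] by (auto simp: Suc_le_eq)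

lemma \<sigma>_less: "2 * \<sigma> < \<rho>"
proof -
  have "\<rho> / 2 * sin (\<theta> / 4) \<le> \<rho> / 2 * 1" using \<rho> by (intro mult_left_mono) auto
  with \<sigma>\<rho> show ?thesis by simp
qed

lemma S_kappaD:
  assumes "\<eta> \<in> S_kappa \<kappa>'"
  shows "0 < cmod \<eta>" "cmod \<eta> < s" "\<bar>Arg \<eta>\<bar> < \<tau> / 4" "\<eta> \<in> S_kappa \<kappa>"
  using assms sr \<tau>\<theta> \<tau> by auto

text \<open>The conditions on the \<open>i\<close>-th coordinate of \<open>x\<close>, where \<open>A\<close> and \<open>B\<close> list the coordinates in which \<open>z - w\<close> and \<open>w\<close>
  are restricted. If \<open>q = (z, \<eta>)\<close> belongs to one of the sets for \<open>\<kappa>'\<close>, these conditions together make \<open>(q, x)\<close>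
  admissible.\<close>

definition fibre :: "nat set \<Rightarrow> nat set \<Rightarrow> (complex ^ 'n) \<times> complex \<Rightarrow> nat \<Rightarrow> complex set" where
  "fibre A B q i = (if i = 1
     then {x. cmod x < \<rho> \<and> cmod (fst q $ e 1 + snd q * x) < \<rho> * cmod (snd q) \<and>
            (1 \<in> A \<longrightarrow> - (snd q * x) \<in> sector \<theta>) \<and> (1 \<in> B \<longrightarrow> fst q $ e 1 + snd q * x \<in> sector \<theta>)}
     else {x. cmod x < r' \<and> cmod (fst q $ e i + x) < r' \<and> (i \<in> A \<longrightarrow> cmod (snd q) < \<rho> * cmod x) \<and>
            (i \<in> B \<longrightarrow> cmod (snd q) < \<rho> * cmod (fst q $ e i + x))})"

text \<open>The domain of the integrand for \<open>\<psi>\<close> on \<open>V\<^sup>(\<^sup>A\<^sup>)\<close> of the diagonal and \<open>u\<close> on \<open>V\<^sup>(\<^sup>B\<^sup>)\<close> of \<open>Y\<close>.\<close>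

definition admissible :: "nat set \<Rightarrow> nat set \<Rightarrow> (((complex ^ 'n) \<times> complex) \<times> (complex ^ 'n)) set" where
  "admissible A B = {y. to_diag e y \<in> VD_inter e \<kappa> A \<and> to_Y e y \<in> VY_inter e \<kappa> B}"

lemma open_fibre: "open (fibre A B q i)"
  unfolding fibre_def
  by (auto intro!: open_Collect_conj open_Collect_imp open_Collect_less open_vimage_Collect continuous_intros
      open_sector)

lemma open_admissible: "finite A \<Longrightarrow> finite B \<Longrightarrow> open (admissible A B)"
  unfolding admissible_def using \<theta>
  by (intro open_Collect_conj open_vimage_Collect open_VD_inter open_VY_inter cdiff_imp_continuous_on cdiff_at_to_diag cdiff_at_to_Y)

lemma integrand_hol:
  assumes "\<psi> \<in> hol_sections (VD_inter e \<kappa> A)" "u \<in> hol_sections (VY_inter e \<kappa> B)"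
  shows "integrand e \<psi> u \<in> hol_sections (admissible A B)"
  using assms unfolding integrand_eq hol_sections_iff admissible_def
  by (auto intro!: cdiff_at_mult cdiff_at_compose [OF cdiff_at_to_diag] cdiff_at_compose [OF cdiff_at_to_Y])

lemma fibre_admissible:
  assumes q: "q \<in> VY_inter e \<kappa>' B'" and A: "A \<subseteq> {1..CARD('n)}" and B: "B \<subseteq> {1..d}"
    and x: "\<And>i. i \<in> {1..CARD('n)} \<Longrightarrow> x $ e i \<in> fibre A B q i"
  shows "(q, x) \<in> admissible A B"
proof -
  obtain z \<eta> where q_eq: "q = (z, \<eta>)" by fastforce
  have \<eta>: "\<eta> \<in> S_kappa \<kappa>'" "cmod (z $ e 1) < \<sigma> * cmod \<eta>" "\<And>i. i \<in> {2..CARD('n)} \<Longrightarrow> cmod (z $ e i) < s'"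
    using q VY_inter_iff [OF \<tau>, of z \<eta> e] by (auto simp: q_eq simp del: S_kappa.simps)
  note \<eta>' = S_kappaD [OF \<eta>(1)]
  have z: "cmod (z $ e i) < r'" if "i \<in> {1..CARD('n)}" for i
  proof (cases "i = 1")
    case True
    have "\<sigma> * cmod \<eta> \<le> 1 * cmod \<eta>" using \<sigma> by (intro mult_right_mono) auto
    also have "\<dots> < \<sigma> * s'" using \<eta>' s by simp
    also have "\<dots> \<le> 1 * s'" using \<sigma> s' by (intro mult_right_mono) auto
    finally show ?thesis using \<eta>(2) s'r' r' True by simp
  next
    case False
    then show ?thesis using \<eta>(3) [of i] that s'r' r' by auto
  qed
  have x1: "x $ e 1 \<in> fibre A B q 1" using x [of 1] by simp
  have xi: "cmod (x $ e i) < r'" "cmod (z $ e i + x $ e i) < r'" "i \<in> A \<Longrightarrow> cmod \<eta> < \<rho> * cmod (x $ e i)"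
      "i \<in> B \<Longrightarrow> cmod \<eta> < \<rho> * cmod (z $ e i + x $ e i)" if "i \<in> {2..CARD('n)}" for i
    using x [of i] that by (auto simp: fibre_def q_eq)
  have nth: "shear e z \<eta> x $ e i = z $ e i + x $ e i" if "i \<in> {2..CARD('n)}" for i
    using that e_eq_iff [of i] by (auto simp: shear_nth)
  have nth1: "shear e z \<eta> x $ e 1 = z $ e 1 + \<eta> * x $ e 1" by (simp add: shear_nth)
  have sub: "A - {1} \<subseteq> {2..CARD('n)}" "B - {1} \<subseteq> {2..CARD('n)}" using A B d by force+
  have "((z, shear e z \<eta> x), \<eta>) \<in> VD_inter e \<kappa> A"
    unfolding VD_inter_iff [OF \<theta>]
    using z \<eta>' x1 xi nth sub nth1
    by (auto simp: fibre_def q_eq norm_mult subset_iff simp del: S_kappa.simps)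
  moreover have "(shear e z \<eta> x, \<eta>) \<in> VY_inter e \<kappa> B"
    unfolding VY_inter_iff [OF \<theta>]
    using \<eta>' x1 xi nth sub nth1
    by (auto simp: fibre_def q_eq norm_mult subset_iff simp del: S_kappa.simps)
  ultimately show ?thesis by (simp add: admissible_def to_diag_def to_Y_def q_eq)
qed

end

section \<open>Position of the cycle\<close>

context composition_setting
begin

text \<open>Here and below \<open>a\<close> is the argument of \<open>\<eta>\<close> and \<open>\<phi>\<close> that of a point \<open>x\<close> of the first path; the lemma locates
  \<open>z\<^sub>1 - w\<^sub>1 = - \<eta> x\<close>.\<close>

lemma minus_rcis_in_sector:
  assumes "\<bar>\<phi>\<bar> \<le> (pi + \<theta>) / 2" "\<bar>a\<bar> < \<theta> / 4" "k > 0"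
  shows "- rcis k (a + \<phi>) \<in> sector \<theta>"
proof -
  have *: "cos (a + \<phi> + \<theta>) > 0 \<or> cos (a + \<phi> + - \<theta>) > 0"
  proof (cases "a + \<phi> + \<theta> < pi / 2")
    case True
    then have "cos (a + \<phi> + \<theta>) > 0" using assms \<theta> by (intro cos_gt_zero_pi) auto
    then show ?thesis by simp
  next
    case False
    then have "cos (a + \<phi> + - \<theta>) > 0" using assms \<theta> by (intro cos_gt_zero_pi) auto
    then show ?thesis by simp
  qed
  have R: "Re (- rcis k (a + \<phi>) * cis b) = - (k * cos (a + \<phi> + b))" for b
    using Re_rcis_cis [of k "a + \<phi>" b] by simp
  show ?thesis
    unfolding sector_def mem_Collect_eq R using * \<open>k > 0\<close> by (simp add: zero_less_mult_iff)
qed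

text \<open>On the two segments, \<open>- \<eta> x\<close> lies in the cone complementary to the sector for \<open>\<kappa>'\<close>. As that cone is closed
  under addition, \<open>z\<^sub>1 + \<eta> x\<close> cannot lie in it when \<open>z\<^sub>1\<close> does not: the segments stay in that sector however
  close \<open>z\<^sub>1\<close> is to its boundary.\<close>

lemma minus_rcis_not_in_sector:
  assumes "\<bar>\<phi>\<bar> = (pi + \<theta>) / 2" "\<bar>a\<bar> < \<tau> / 4" "k > 0"
  shows "- rcis k (a + \<phi>) \<notin> sector \<tau>"
proof -
  have *: "cos (a + \<phi> + b) \<le> 0" if "\<bar>b\<bar> \<le> \<tau>" for b
  proof (cases "\<phi> \<ge> 0")
    case True
    then have "a + \<phi> + b = (pi + \<theta>) / 2 + (a + b)" using assms by auto
    moreover have "sin (\<theta> / 2 + (a + b)) \<ge> 0" using that assms \<tau>\<theta> \<theta> by (intro sin_ge_zero) auto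
    ultimately show ?thesis by (simp only: cos_half_pi_plus)
  next
    case False
    then have "\<phi> = - ((pi + \<theta>) / 2)" using assms(1) by linarith
    then have "a + \<phi> + b = - ((pi + \<theta>) / 2 + - (a + b))" by simp
    moreover have "sin (\<theta> / 2 + - (a + b)) \<ge> 0" using that assms \<tau>\<theta> \<theta> by (intro sin_ge_zero) auto
    ultimately show ?thesis by (simp only: cos_half_pi_plus cos_minus)
  qed
  have R: "Re (- rcis k (a + \<phi>) * cis b) = - (k * cos (a + \<phi> + b))" for b
    using Re_rcis_cis [of k "a + \<phi>" b] by simp
  show ?thesis
    unfolding sector_def mem_Collect_eq R
    using *[of \<tau>] *[of "- \<tau>"] assms(3) \<tau> by (simp add: not_less mult_le_0_iff)
qed

lemma eta_mult_rcis: "\<eta> * rcis k \<phi> = rcis (cmod \<eta> * k) (Arg \<eta> + \<phi>)"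
  by (subst eq_rcis_Arg [of \<eta>]) (simp only: rcis_mult)

lemma sum_bound:
  assumes "cmod z < \<sigma> * cmod \<eta>" "cmod x \<le> \<rho> / 2"
  shows "cmod x < \<rho>" "cmod (z + \<eta> * x) < \<rho> * cmod \<eta>"
proof -
  show "cmod x < \<rho>" using assms \<rho> by simp
  have "cmod (z + \<eta> * x) \<le> cmod z + cmod \<eta> * cmod x" by (metis norm_mult norm_triangle_ineq)
  also have "\<dots> < \<sigma> * cmod \<eta> + cmod \<eta> * (\<rho> / 2)"
    using assms by (intro add_less_le_mono mult_left_mono) auto
  also have "\<dots> = (\<sigma> + \<rho> / 2) * cmod \<eta>" by (simp add: algebra_simps)
  also have "\<dots> \<le> \<rho> * cmod \<eta>" using \<sigma>_less by (intro mult_right_mono) auto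
  finally show "cmod (z + \<eta> * x) < \<rho> * cmod \<eta>" .
qed

lemma unit_gamma_facts:
  assumes \<eta>: "\<eta> \<in> S_kappa \<kappa>'" and z: "cmod z < \<sigma> * cmod \<eta>" and \<delta>: "0 < \<delta>" "\<delta> \<le> 1"
    and x: "x \<in> path_image (unit_gamma \<rho> \<theta> \<delta>)"
  shows "cmod x < \<rho>" "cmod (z + \<eta> * x) < \<rho> * cmod \<eta>" "- (\<eta> * x) \<in> sector \<theta>"
    and "z \<in> sector \<tau> \<Longrightarrow> (\<And>y. cmod (y - z) \<le> \<delta> * \<rho> * cmod \<eta> \<Longrightarrow> y \<in> sector \<theta>) \<Longrightarrow> z + \<eta> * x \<in> sector \<theta>"
proof -
  note \<eta>' = S_kappaD [OF \<eta>]
  obtain k \<phi> where k: "0 < k" "k \<le> 1" "x = rcis (k * \<rho> / 2) \<phi>" "\<bar>\<phi>\<bar> \<le> (pi + \<theta>) / 2"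
    "\<bar>\<phi>\<bar> = (pi + \<theta>) / 2 \<or> k = \<delta>"
    using unit_gamma_cases [OF x \<delta> \<theta>(1)] by blast
  have cx: "cmod x = k * \<rho> / 2" using k \<rho> by simp
  have "k * \<rho> \<le> 1 * \<rho>" using k \<rho> by (intro mult_right_mono) auto
  then have "cmod x \<le> \<rho> / 2" by (simp add: cx)
  then show "cmod x < \<rho>" "cmod (z + \<eta> * x) < \<rho> * cmod \<eta>" using sum_bound [OF z] by auto
  have \<eta>x: "\<eta> * x = rcis (cmod \<eta> * (k * \<rho> / 2)) (Arg \<eta> + \<phi>)" unfolding k(3) by (rule eta_mult_rcis)
  have pos: "cmod \<eta> * (k * \<rho> / 2) > 0" using k \<rho> \<eta>' by simp
  show "- (\<eta> * x) \<in> sector \<theta>" unfolding \<eta>x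
    by (rule minus_rcis_in_sector [OF k(4) _ pos]) (use \<eta>' \<tau>\<theta> \<tau> in auto)
  assume zs: "z \<in> sector \<tau>" and near: "\<And>y. cmod (y - z) \<le> \<delta> * \<rho> * cmod \<eta> \<Longrightarrow> y \<in> sector \<theta>"
  show "z + \<eta> * x \<in> sector \<theta>"
    using k(5)
  proof
    assume \<phi>: "\<bar>\<phi>\<bar> = (pi + \<theta>) / 2"
    have "- (\<eta> * x) \<notin> sector \<tau>" unfolding \<eta>x by (rule minus_rcis_not_in_sector [OF \<phi> \<eta>'(3) pos])
    then have "z + \<eta> * x \<in> sector \<tau>" using zs not_sector_add [of "z + \<eta> * x" \<tau> "- (\<eta> * x)"] by auto
    then show ?thesis using sector_mono [of \<tau> \<theta>] \<tau> \<tau>\<theta> \<theta> by auto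
  next
    assume "k = \<delta>"
    then have "cmod (\<eta> * x) = \<delta> * \<rho> * cmod \<eta> / 2" by (simp add: norm_mult cx)
    also have "\<dots> \<le> \<delta> * \<rho> * cmod \<eta>" using \<delta> \<rho> by simp
    finally show ?thesis by (intro near) simp
  qed
qed

text \<open>The chord joining the two end points of the first path lies far enough to the left that \<open>z\<^sub>1 + \<eta> x\<close> is in the
  sector for every \<open>z\<^sub>1\<close> with \<open>|z\<^sub>1| < \<sigma> |\<eta>|\<close>, whatever its argument. This is where
  \<open>\<sigma> < (\<rho> / 2) sin (\<theta> / 4)\<close> is used in full.\<close>

lemma segment_facts:
  assumes \<eta>: "\<eta> \<in> S_kappa \<kappa>'" and z: "cmod z < \<sigma> * cmod \<eta>"
    and x: "x \<in> closed_segment (beta0 \<rho> \<theta>) (beta1 \<rho> \<theta>)"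
  shows "cmod x < \<rho>" "cmod (z + \<eta> * x) < \<rho> * cmod \<eta>" "z + \<eta> * x \<in> sector \<theta>"
proof -
  note \<eta>' = S_kappaD [OF \<eta>]
  have "beta0 \<rho> \<theta> \<in> cball 0 (\<rho> / 2)" "beta1 \<rho> \<theta> \<in> cball 0 (\<rho> / 2)"
    using \<rho> by (simp_all add: beta0_def beta1_def)
  then have "closed_segment (beta0 \<rho> \<theta>) (beta1 \<rho> \<theta>) \<subseteq> cball 0 (\<rho> / 2)"
    by (intro closed_segment_subset) auto
  then have "cmod x \<le> \<rho> / 2" using x by auto
  then show "cmod x < \<rho>" "cmod (z + \<eta> * x) < \<rho> * cmod \<eta>" using sum_bound [OF z] by auto
  have cosn: "cos ((pi + \<theta>) / 2) = - sin (\<theta> / 2)" using cos_half_pi_plus [of \<theta> 0] by simp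
  then have "cos (- (pi + \<theta>) / 2) = - sin (\<theta> / 2)"
    by (simp only: minus_divide_left [symmetric] cos_minus)
  with cosn have Reb: "Re (beta0 \<rho> \<theta>) = - (\<rho> / 2 * sin (\<theta> / 2))" "Re (beta1 \<rho> \<theta>) = - (\<rho> / 2 * sin (\<theta> / 2))"
    by (simp_all only: beta0_def beta1_def Re_rcis)
  obtain u where u: "x = (1 - u) *\<^sub>R beta0 \<rho> \<theta> + u *\<^sub>R beta1 \<rho> \<theta>" using x by (auto simp: in_segment)
  have Rex: "Re x = - (\<rho> / 2 * sin (\<theta> / 2))" by (simp add: u Reb algebra_simps)
  have "sin (\<theta> / 4) \<le> sin (\<theta> / 2)" using \<theta> by (intro sin_monotone_2pi_le) auto
  then have "\<rho> / 2 * sin (\<theta> / 4) \<le> \<rho> / 2 * sin (\<theta> / 2)" using \<rho> by (intro mult_left_mono) auto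
  then have Rex': "Re x < - \<sigma>" using \<sigma>\<rho> Rex by linarith
\<comment> \<open>Rotating by \<open>- arg \<eta>\<close> makes the real part negative; rotating back by less than \<open>\<theta>\<close> stays in the sector.\<close>
  define y where "y = cis (- Arg \<eta>) * (z + \<eta> * x)"
  have cc: "cis (- Arg \<eta>) * cis (Arg \<eta>) = 1" by (simp add: cis_mult)
  have "y = cis (- Arg \<eta>) * z + of_real (cmod \<eta>) * x"
  proof -
    have "cis (- Arg \<eta>) * \<eta> = of_real (cmod \<eta>)"
      using cc by (subst (2) eq_rcis_Arg [of \<eta>]) (simp add: rcis_def mult.left_commute)
    then show ?thesis by (simp add: y_def distrib_left mult.assoc [symmetric])
  qed
  then have "Re y = Re (cis (- Arg \<eta>) * z) + cmod \<eta> * Re x" by simp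
  moreover have "Re (cis (- Arg \<eta>) * z) \<le> cmod z"
    using complex_Re_le_cmod [of "cis (- Arg \<eta>) * z"] by (simp add: norm_mult)
  moreover have "cmod \<eta> * Re x < cmod \<eta> * (- \<sigma>)" using Rex' \<eta>' by (intro mult_strict_left_mono) auto
  ultimately have "Re y < 0" using z by (simp add: mult.commute)
  then have "y * cis (Arg \<eta>) \<in> sector \<theta>"
    using \<eta>' \<tau>\<theta> \<tau> \<theta> by (intro sector_of_Re_neg) auto
  moreover have "y * cis (Arg \<eta>) = z + \<eta> * x" using cc by (simp add: y_def mult_ac)
  ultimately show "z + \<eta> * x \<in> sector \<theta>" by simp
qed

lemma VY'_memD:
  assumes "q \<in> VY_inter e \<kappa>' B"
  shows "snd q \<in> S_kappa \<kappa>'" "cmod (fst q $ e 1) < \<sigma> * cmod (snd q)"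
    "\<And>i. i \<in> {2..CARD('n)} \<Longrightarrow> cmod (fst q $ e i) < s'" "1 \<in> B \<Longrightarrow> fst q $ e 1 \<in> sector \<tau>"
    "\<And>i. i \<in> B \<Longrightarrow> i \<noteq> 1 \<Longrightarrow> cmod (snd q) < \<sigma> * cmod (fst q $ e i)"
  using assms VY_inter_iff [OF \<tau>, of "fst q" "snd q" e] by (auto simp del: S_kappa.simps)

text \<open>For \<open>i \<ge> 2\<close> the closed disc of radius \<open>R\<close> around \<open>z\<^sub>i\<close> satisfies the bounds \<open>|z\<^sub>i - w\<^sub>i| < r'\<close> and \<open>|w\<^sub>i| < r'\<close>, and for
  \<open>i \<in> B\<close> it avoids the excluded set \<open>\<rho> |w\<^sub>i| \<le> |\<eta>|\<close>.\<close>

definition disc_ok :: "nat set \<Rightarrow> (complex ^ 'n) \<times> complex \<Rightarrow> real \<Rightarrow> bool" where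
  "disc_ok B q R \<longleftrightarrow> (\<forall>i\<in>{2..CARD('n)}. \<forall>x. cmod x \<le> R \<longrightarrow> cmod x < r' \<and> cmod (fst q $ e i + x) < r' \<and>
     (i \<in> B \<longrightarrow> cmod (snd q) < \<rho> * cmod (fst q $ e i + x)))"

lemma disc_ok_mono: "disc_ok B q R \<Longrightarrow> R' \<le> R \<Longrightarrow> disc_ok B q R'"
  by (auto simp: disc_ok_def)

lemma disc_ok_neighbourhood:
  assumes q0: "q0 \<in> VY_inter e \<kappa>' B'" and B: "B - {1} \<subseteq> B'" "B \<subseteq> {1..d}"
  shows "\<exists>R N. open N \<and> q0 \<in> N \<and> (\<forall>q\<in>N. cmod (snd q) / \<rho> < R \<and> disc_ok B q R)"
proof -
  note q = VY'_memD [OF q0]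
  define c where "c = cmod (snd q0) / \<rho>"
  define W where "W = {R. \<forall>i\<in>{2..CARD('n)}. R + cmod (fst q0 $ e i) < r' \<and>
     (i \<in> B \<longrightarrow> cmod (snd q0) < \<rho> * (cmod (fst q0 $ e i) - R))}"
  have oW: "open W"
    unfolding W_def
    by (intro open_Ball_finite open_Collect_conj open_Collect_imp open_Collect_less continuous_intros) auto
\<comment> \<open>All conditions on the radius are open and hold at \<open>c = |\<eta>| / \<rho>\<close>, hence also slightly beyond.\<close>
  have "c \<in> W"
  proof -
    have "cmod (snd q0) < \<sigma> * s'" using S_kappaD [OF q(1)] s by simp
    also have "\<dots> \<le> \<rho> / 2 * s'" using \<sigma>_less s' by (intro mult_right_mono) auto
    finally have "c < s' / 2" using \<rho> by (simp add: c_def field_simps)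
    moreover have "cmod (snd q0) < \<rho> * (cmod (fst q0 $ e i) - c)" if "i \<in> B" "i \<in> {2..CARD('n)}" for i
    proof -
      have "cmod (snd q0) < \<sigma> * cmod (fst q0 $ e i)" using q(5) [of i] B that by auto
      moreover have "2 * \<sigma> * cmod (fst q0 $ e i) \<le> \<rho> * cmod (fst q0 $ e i)"
        using \<sigma>_less by (intro mult_right_mono) auto
      ultimately show ?thesis using \<rho> by (simp add: c_def right_diff_distrib)
    qed
    moreover have "c + cmod (fst q0 $ e i) < r'" if "i \<in> {2..CARD('n)}" for i
      using \<open>c < s' / 2\<close> q(3) [OF that] s'r' s' by linarith
    ultimately show ?thesis by (simp add: W_def)
  qed
  then have "\<forall>\<^sub>F R in at_right c. R \<in> W"
    using filter_leD [OF at_within_le_nhds eventually_nhds_in_open [OF oW]] by blast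
  moreover have "\<forall>\<^sub>F R in at_right c. c < R" by (rule eventually_at_right_less)
  ultimately have "\<forall>\<^sub>F R in at_right c. R \<in> W \<and> c < R" by (rule eventually_conj)
  then obtain R where R: "R \<in> W" "c < R"
    using eventually_happens trivial_limit_at_right_real by blast
  define N where "N = {q::(complex ^ 'n) \<times> complex. cmod (snd q) / \<rho> < R \<and> (\<forall>i\<in>{2..CARD('n)}. R + cmod (fst q $ e i) < r' \<and>
     (i \<in> B \<longrightarrow> cmod (snd q) < \<rho> * (cmod (fst q $ e i) - R)))}"
  have "open N"
    unfolding N_def using \<rho>
    by (intro open_Ball_finite open_Collect_conj open_Collect_imp open_Collect_less continuous_intros) auto
  moreover have "q0 \<in> N" using R by (auto simp: N_def W_def c_def)
  moreover have "cmod x < r' \<and> cmod (fst q $ e i + x) < r' \<and>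
       (i \<in> B \<longrightarrow> cmod (snd q) < \<rho> * cmod (fst q $ e i + x))"
    if q: "q \<in> N" and i: "i \<in> {2..CARD('n)}" and x: "cmod x \<le> R" for q i x
  proof -
    have *: "R + cmod (fst q $ e i) < r'" "i \<in> B \<Longrightarrow> cmod (snd q) < \<rho> * (cmod (fst q $ e i) - R)"
      using q i by (auto simp: N_def)
    have "cmod (fst q $ e i + x) \<le> cmod (fst q $ e i) + cmod x" by (rule norm_triangle_ineq)
    moreover have "cmod (fst q $ e i) - R \<le> cmod (fst q $ e i + x)"
      using norm_triangle_ineq2 [of "fst q $ e i" "- x"] x by simp
    then have "\<rho> * (cmod (fst q $ e i) - R) \<le> \<rho> * cmod (fst q $ e i + x)"
      using \<rho> by (intro mult_left_mono) auto
    ultimately show ?thesis using * x norm_ge_zero [of "fst q $ e i"] by linarith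
  qed
  ultimately show ?thesis by (intro exI [of _ R] exI [of _ N]) (auto simp: N_def disc_ok_def)
qed

lemma circle_in_fibre:
  assumes "disc_ok B q R0" "cmod (snd q) / \<rho> < R" "R \<le> R0" "i \<in> {2..CARD('n)}"
  shows "path_image (circlepath 0 R) \<subseteq> fibre A B q i"
proof
  fix x assume x: "x \<in> path_image (circlepath 0 R)"
  have "0 \<le> cmod (snd q) / \<rho>" using \<rho> by simp
  then have "R > 0" using assms by linarith
  then have "cmod x = R" using x by (auto simp: dist_norm)
  then show "x \<in> fibre A B q i" using assms \<rho> by (auto simp: fibre_def disc_ok_def field_simps)
qed

text \<open>Only the arc requires \<open>\<delta>\<close> to be small, and a bound for \<open>\<delta>\<close> can be chosen locally uniformly.\<close>

lemma unit_gamma_in_fibre: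
  assumes B: "B \<subseteq> {1..d}" and q0: "q0 \<in> VY_inter e \<kappa>' B"
  shows "\<exists>N \<delta>0. open N \<and> q0 \<in> N \<and> N \<subseteq> VY_inter e \<kappa>' B \<and> 0 < \<delta>0 \<and>
    (\<forall>q\<in>N. \<forall>\<delta>. 0 < \<delta> \<longrightarrow> \<delta> \<le> \<delta>0 \<longrightarrow> path_image (unit_gamma \<rho> \<theta> \<delta>) \<subseteq> fibre {1..CARD('n)} B q 1)"
proof -
  have "\<exists>c>0. 1 \<in> B \<longrightarrow> ball (fst q0 $ e 1) c \<subseteq> sector \<theta>"
  proof (cases "1 \<in> B")
    case True
    then have "fst q0 $ e 1 \<in> sector \<theta>" using VY'_memD(4) [OF q0] sector_mono [of \<tau> \<theta>] \<tau> \<tau>\<theta> \<theta> by auto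
    then show ?thesis using open_sector open_contains_ball by blast
  next
    case False
    then show ?thesis by (intro exI [of _ 1]) auto
  qed
  then obtain c where c: "c > 0" "1 \<in> B \<Longrightarrow> ball (fst q0 $ e 1) c \<subseteq> sector \<theta>" by blast
  define \<delta>0 where "\<delta>0 = min 1 (c / (2 * \<rho> * r))"
  define N where "N = VY_inter e \<kappa>' B \<inter> {q. cmod (fst q $ e 1 - fst q0 $ e 1) < c / 2}"
  have finB: "finite B" using B finite_subset by blast
  have "open N"
    unfolding N_def by (intro open_Int open_VY_inter \<tau> finB open_Collect_less continuous_intros)
  moreover have "q0 \<in> N" using q0 c by (simp add: N_def)
  moreover have "0 < \<delta>0" using c \<rho> r by (simp add: \<delta>0_def)
  moreover have "x \<in> fibre {1..CARD('n)} B q 1"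
    if q: "q \<in> N" and \<delta>: "0 < \<delta>" "\<delta> \<le> \<delta>0" and x: "x \<in> path_image (unit_gamma \<rho> \<theta> \<delta>)" for q \<delta> x
  proof -
    have qV: "q \<in> VY_inter e \<kappa>' B" using q by (auto simp: N_def)
    have \<delta>1: "\<delta> \<le> 1" "\<delta> \<le> c / (2 * \<rho> * r)" using \<delta> by (auto simp: \<delta>0_def)
    note f = unit_gamma_facts [OF VY'_memD(1,2) [OF qV] \<delta>(1) \<delta>1(1) x]
    have "fst q $ e 1 + snd q * x \<in> sector \<theta>" if "1 \<in> B"
    proof (rule f(4) [OF VY'_memD(4) [OF qV that]])
      fix y assume y: "cmod (y - fst q $ e 1) \<le> \<delta> * \<rho> * cmod (snd q)"
      have nn: "0 \<le> c / (2 * \<rho> * r)" "0 \<le> c / (2 * \<rho> * r) * \<rho>"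
        using c(1) \<rho>(1) r(1) by (intro mult_nonneg_nonneg divide_nonneg_nonneg; simp)+
      have "cmod (snd q) \<le> r" using S_kappaD [OF VY'_memD(1) [OF qV]] sr by linarith
      then have "\<delta> * \<rho> * cmod (snd q) \<le> c / (2 * \<rho> * r) * \<rho> * r"
        using \<delta>1(2) \<delta>(1) \<rho>(1) nn by (intro mult_mono) (simp_all only: order_less_imp_le norm_ge_zero)
      also have "\<dots> = c / 2" using \<rho> r by simp
      finally have "cmod (y - fst q0 $ e 1) < c"
        using y q norm_triangle_ineq [of "y - fst q $ e 1" "fst q $ e 1 - fst q0 $ e 1"]
        by (simp add: N_def)
      then show "y \<in> sector \<theta>" using c(2) [OF that] by (auto simp: dist_norm norm_minus_commute)
    qed
    then show ?thesis using f by (simp add: fibre_def)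
  qed
  ultimately show ?thesis by (intro exI [of _ N] exI [of _ \<delta>0]) (auto simp: N_def)
qed

text \<open>Small circles satisfy the conditions by \<open>disc_ok_neighbourhood\<close>, so only the first path and an open set \<open>T q\<close>
  around it remain to be examined.\<close>

lemma locally_deformableI:
  assumes B: "B - {1} \<subseteq> B'" "B \<subseteq> {1..d}" "B' \<subseteq> {1..d}"
    and P: "\<And>q0. q0 \<in> VY_inter e \<kappa>' B' \<Longrightarrow> \<exists>N \<delta>0. open N \<and> q0 \<in> N \<and> N \<subseteq> VY_inter e \<kappa>' B' \<and> 0 < \<delta>0 \<and>
      (\<forall>q\<in>N. \<forall>\<delta>. 0 < \<delta> \<longrightarrow> \<delta> \<le> \<delta>0 \<longrightarrow> path_image (P \<delta>) \<subseteq> T q)"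
    and oT: "\<And>q. open (T q)"
    and sub: "\<And>q x. q \<in> VY_inter e \<kappa>' B' \<Longrightarrow> x $ e 1 \<in> T q \<Longrightarrow>
      (\<And>i. i \<in> {2..CARD('n)} \<Longrightarrow> x $ e i \<in> fibre A B q i) \<Longrightarrow> (q, x) \<in> \<Omega>"
  shows "locally_deformable e \<rho> \<Omega> P (VY_inter e \<kappa>' B')"
  unfolding locally_deformable_def
proof
  fix q0 assume q0: "q0 \<in> VY_inter e \<kappa>' B'"
  obtain R0 N0 where N0: "open N0" "q0 \<in> N0" and R0: "\<forall>q\<in>N0. cmod (snd q) / \<rho> < R0 \<and> disc_ok B q R0"
    using disc_ok_neighbourhood [OF q0 B(1,2)] by blast
  obtain N1 \<delta>0 where N1: "open N1" "q0 \<in> N1" "N1 \<subseteq> VY_inter e \<kappa>' B'" "0 < \<delta>0"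
    "\<forall>q\<in>N1. \<forall>\<delta>. 0 < \<delta> \<longrightarrow> \<delta> \<le> \<delta>0 \<longrightarrow> path_image (P \<delta>) \<subseteq> T q"
    using P [OF q0] by blast
  define N where "N = N0 \<inter> N1"
  define S where "S = (\<lambda>q i. if i = 1 then T q else fibre A B q i)"
  show "\<exists>N \<delta>0 R0 S. open N \<and> q0 \<in> N \<and> 0 < \<delta>0 \<and>
     (\<forall>q\<in>N. cmod (snd q) / \<rho> < R0 \<and> (\<forall>i\<in>{1..CARD('n)}. open (S q i)) \<and>
       (\<forall>x. (\<forall>i\<in>{1..CARD('n)}. x $ e i \<in> S q i) \<longrightarrow> (q, x) \<in> \<Omega>) \<and>
       (\<forall>\<delta>. 0 < \<delta> \<longrightarrow> \<delta> \<le> \<delta>0 \<longrightarrow> path_image (P \<delta>) \<subseteq> S q 1) \<and>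
       (\<forall>R. cmod (snd q) / \<rho> < R \<longrightarrow> R \<le> R0 \<longrightarrow> (\<forall>i\<in>{2..CARD('n)}. path_image (circlepath 0 R) \<subseteq> S q i)))"
  proof (rule exI [of _ N], rule exI [of _ \<delta>0], rule exI [of _ R0], rule exI [of _ S],
      intro conjI ballI allI impI)
    show "open N" "q0 \<in> N" "0 < \<delta>0" using N0 N1 by (auto simp: N_def)
    fix q assume q: "q \<in> N"
    then have qV: "q \<in> VY_inter e \<kappa>' B'" and qN0: "q \<in> N0" and qN1: "q \<in> N1" using N1 by (auto simp: N_def)
    show "cmod (snd q) / \<rho> < R0" using R0 qN0 by blast
    show "open (S q i)" for i using oT open_fibre by (simp add: S_def)
    show "path_image (P \<delta>) \<subseteq> S q 1" if "0 < \<delta>" "\<delta> \<le> \<delta>0" for \<delta>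
      using N1(5) qN1 that by (simp add: S_def)
    show "path_image (circlepath 0 R) \<subseteq> S q i"
      if "cmod (snd q) / \<rho> < R" "R \<le> R0" "i \<in> {2..CARD('n)}" for R i
      using circle_in_fibre [OF _ that] R0 qN0 that(3) by (auto simp: S_def)
    show "(q, x) \<in> \<Omega>" if x: "\<forall>i\<in>{1..CARD('n)}. x $ e i \<in> S q i" for x
    proof (rule sub [OF qV])
      show "x $ e 1 \<in> T q" using bspec [OF x, of 1] by (simp add: S_def)
      show "x $ e i \<in> fibre A B q i" if "i \<in> {2..CARD('n)}" for i
        using bspec [OF x, of i] that by (simp add: S_def)
    qed
  qed
qed

lemma locally_deformable_unit_gamma:
  assumes B: "B \<subseteq> {1..d}"
  shows "locally_deformable e \<rho> (admissible {1..CARD('n)} B) (unit_gamma \<rho> \<theta>) (VY_inter e \<kappa>' B)"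
proof (rule locally_deformableI [OF _ B B unit_gamma_in_fibre [OF B] open_fibre])
  fix q x
  assume q: "q \<in> VY_inter e \<kappa>' B" and x: "x $ e 1 \<in> fibre {1..CARD('n)} B q 1"
    "\<And>i. i \<in> {2..CARD('n)} \<Longrightarrow> x $ e i \<in> fibre {1..CARD('n)} B q i"
  show "(q, x) \<in> admissible {1..CARD('n)} B"
  proof (rule fibre_admissible [OF q order_refl B])
    show "x $ e i \<in> fibre {1..CARD('n)} B q i" if "i \<in> {1..CARD('n)}" for i
      using x that by (cases "i = 1") auto
  qed
qed auto

text \<open>The pointwise form, which also gives the discs bounded by the circles.\<close>

lemma eventually_in_fibre:
  assumes B: "B \<subseteq> {1..d}" and q: "q \<in> VY_inter e \<kappa>' B"
  shows "\<forall>\<^sub>F \<epsilon> in at_right 0. \<epsilon> > 0 \<and> path_image (unit_gamma \<rho> \<theta> \<epsilon>) \<subseteq> fibre {1..CARD('n)} B q 1 \<and> disc_ok B q (cmod (snd q) / \<rho> + \<epsilon>)"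
proof -
  obtain R0 N0 where N0: "open N0" "q \<in> N0" and R0: "\<forall>q\<in>N0. cmod (snd q) / \<rho> < R0 \<and> disc_ok B q R0"
    using disc_ok_neighbourhood [OF q _ B] by blast
  obtain N1 \<delta>0 where N1: "open N1" "q \<in> N1" "N1 \<subseteq> VY_inter e \<kappa>' B" "0 < \<delta>0"
    "\<forall>q\<in>N1. \<forall>\<delta>. 0 < \<delta> \<longrightarrow> \<delta> \<le> \<delta>0 \<longrightarrow> path_image (unit_gamma \<rho> \<theta> \<delta>) \<subseteq> fibre {1..CARD('n)} B q 1"
    using unit_gamma_in_fibre [OF B q] by blast
  have "cmod (snd q) / \<rho> < R0" using R0 N0 by blast
  then have "\<forall>\<^sub>F \<epsilon> in at_right 0. \<epsilon> \<in> {0<..<min \<delta>0 (R0 - cmod (snd q) / \<rho>)}"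
    using N1(4) by (intro eventually_at_right_real) auto
  then show ?thesis
  proof eventually_elim
    case (elim \<epsilon>)
    then have "0 < \<epsilon>" "\<epsilon> \<le> \<delta>0" "cmod (snd q) / \<rho> + \<epsilon> \<le> R0" by auto
    then show ?case using N1(2,5) R0 N0(2) disc_ok_mono by blast
  qed
qed

text \<open>The constant family given by the segment from \<open>beta0\<close> to \<open>beta1\<close>.\<close>

definition chord :: "real \<Rightarrow> real \<Rightarrow> complex" where
  "chord \<delta> = linepath (beta0 \<rho> \<theta>) (beta1 \<rho> \<theta>)"

lemma deformation_family_chord: "deformation_family chord"
  unfolding chord_def [abs_def] by (rule deformation_family_const) simp

lemma locally_deformable_chord:
  "locally_deformable e \<rho> (admissible {2..CARD('n)} {1..d}) chord (VY_inter e \<kappa>' {2..d})"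
proof (rule locally_deformableI [where B = "{1..d}" and A = "{2..CARD('n)}"])
  fix q0 assume q0: "q0 \<in> VY_inter e \<kappa>' {2..d}"
  have "path_image (chord \<delta>) \<subseteq> fibre {2..CARD('n)} {1..d} q 1" if "q \<in> VY_inter e \<kappa>' {2..d}" for q \<delta>
    using segment_facts [OF VY'_memD(1,2) [OF that]] by (auto simp: chord_def fibre_def)
  then show "\<exists>N \<delta>0. open N \<and> q0 \<in> N \<and> N \<subseteq> VY_inter e \<kappa>' {2..d} \<and> 0 < \<delta>0 \<and>
      (\<forall>q\<in>N. \<forall>\<delta>. 0 < \<delta> \<longrightarrow> \<delta> \<le> \<delta>0 \<longrightarrow> path_image (chord \<delta>) \<subseteq> fibre {2..CARD('n)} {1..d} q 1)"
    using q0 open_VY_inter [OF \<tau>, of "{2..d}" e]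
    by (intro exI [of _ "VY_inter e \<kappa>' {2..d}"] exI [of _ "1::real"]) auto
next
  fix q x
  assume q: "q \<in> VY_inter e \<kappa>' {2..d}" and x: "x $ e 1 \<in> fibre {2..CARD('n)} {1..d} q 1"
    "\<And>i. i \<in> {2..CARD('n)} \<Longrightarrow> x $ e i \<in> fibre {2..CARD('n)} {1..d} q i"
  show "(q, x) \<in> admissible {2..CARD('n)} {1..d}"
  proof (rule fibre_admissible [OF q _ order_refl])
    show "x $ e i \<in> fibre {2..CARD('n)} {1..d} q i" if "i \<in> {1..CARD('n)}" for i
      using x that by (cases "i = 1") auto
  qed auto
qed (use open_fibre in auto)

end

section \<open>The composition of representatives\<close>

context composition_setting
begin

lemma gamma_path_eq:
  assumes "i \<in> {1..CARD('n)}"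
  shows "gamma_path e \<kappa> \<epsilon> z \<eta> i =
    (\<lambda>t. z $ e i + (\<chi> j. if j = e 1 then \<eta> else 1) $ e i * path_system (unit_gamma \<rho> \<theta> \<epsilon>) (cmod \<eta> / \<rho> + \<epsilon>) i t)"
  using e_eq_iff [OF assms] by (auto simp: path_system_def gamma_first_eq circlepath)

lemma gamma_integral_eq:
  assumes "\<eta> \<noteq> 0"
  shows "gamma_integral e \<kappa> \<epsilon> \<psi> u z \<eta> = scaled_integral e \<rho> (integrand e \<psi> u) (unit_gamma \<rho> \<theta>) (z, \<eta>) \<epsilon>"
proof -
  define b where "b = (\<chi> j. if j = e 1 then \<eta> else 1)"
  define g where "g = path_system (unit_gamma \<rho> \<theta> \<epsilon>) (cmod \<eta> / \<rho> + \<epsilon>)"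
  define F where "F = (\<lambda>w. \<psi> ((z, w), \<eta>) * u (w, \<eta>))"
  have range: "e ` {1..CARD('n)} = UNIV" using e by (simp add: bij_betw_def)
  have b: "b $ j \<noteq> 0" for j using assms by (simp add: b_def)
  have "gamma_integral e \<kappa> \<epsilon> \<psi> u z \<eta> = prod_path_integral e (\<lambda>i t. z $ e i + b $ e i * g i t) CARD('n) F 0"
    unfolding gamma_integral_def F_def g_def
    by (rule prod_path_integral_outer_cong [OF inj, of 0]) (use gamma_path_eq in \<open>auto simp: b_def\<close>)
  also have "\<dots> = prod_path_integral e (\<lambda>i t. z $ e i + b $ e i * g i t) CARD('n) F (\<chi> j. z $ j + b $ j * 0 $ j)"
    by (rule prod_path_integral_indep) (use range in blast)
  also have "\<dots> = (\<Prod>i=1..CARD('n). b $ e i) * prod_path_integral e g CARD('n) (\<lambda>x. F (\<chi> j. z $ j + b $ j * x $ j)) 0"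
    by (rule prod_path_integral_affine [OF inj _ b]) (simp add: g_def path_system_def valid_path_unit_gamma)
  also have "(\<lambda>x. F (\<chi> j. z $ j + b $ j * x $ j)) = (\<lambda>x. integrand e \<psi> u ((z, \<eta>), x))"
    by (simp add: F_def integrand_def shear_def b_def)
  also have "(\<Prod>i=1..CARD('n). b $ e i) = (\<Prod>i=1..CARD('n). if i = 1 then \<eta> else 1)"
    by (rule prod.cong) (use e_eq_iff in \<open>auto simp: b_def\<close>)
  also have "\<dots> = \<eta>" by (simp add: prod.delta)
  finally show ?thesis by (simp add: scaled_integral_def g_def)
qed

lemma VY'_nz: "q \<in> VY_inter e \<kappa>' B \<Longrightarrow> snd q \<noteq> 0"
  using VY'_memD(1) S_kappaD(1) by fastforce

lemma mu_rep_eq_stable_integral: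
  assumes "q \<in> VY_inter e \<kappa>' B"
  shows "mu_rep e \<kappa> \<psi> u q = stable_integral e \<rho> (integrand e \<psi> u) (unit_gamma \<rho> \<theta>) q"
  using VY'_nz [OF assms] by (cases q) (simp add: mu_rep_def stable_integral_def gamma_integral_eq)

lemma finite_B: "B \<subseteq> {1..d} \<Longrightarrow> finite B" using finite_subset by blast

lemma open_VY': "B \<subseteq> {1..d} \<Longrightarrow> open (VY_inter e \<kappa>' B)"
  by (rule open_VY_inter [OF \<tau> finite_B])

text \<open>A section \<open>u\<close> on \<open>V\<^sup>(\<^sup>B\<^sup>)\<close> yields a section on \<open>V\<^sup>(\<^sup>B\<^sup>)\<close> for every \<open>B\<close>. Hence \<open>mu_rep\<close> preserves the space of sections
  divided out, as far as the second argument is concerned.\<close>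

lemma mu_rep_hol:
  assumes B: "B \<subseteq> {1..d}" and "\<psi> \<in> hol_sections (VD_inter e \<kappa> {1..CARD('n)})" "u \<in> hol_sections (VY_inter e \<kappa> B)"
  shows "mu_rep e \<kappa> \<psi> u \<in> hol_sections (VY_inter e \<kappa>' B)"
proof (rule hol_sections_cong [OF _ open_VY' [OF B]])
  show "stable_integral e \<rho> (integrand e \<psi> u) (unit_gamma \<rho> \<theta>) \<in> hol_sections (VY_inter e \<kappa>' B)"
    using assms by (intro stable_integral_hol_sections [OF e open_admissible deformation_family_unit_gamma locally_deformable_unit_gamma [OF B] \<rho>(1)] integrand_hol)
      (use finite_B [OF B] in auto)
qed (simp add: mu_rep_eq_stable_integral)

lemma eventually_gamma_integral:
  assumes B: "B \<subseteq> {1..d}" and "\<psi> \<in> hol_sections (VD_inter e \<kappa> {1..CARD('n)})" "u \<in> hol_sections (VY_inter e \<kappa> B)"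
    and q: "(z, \<eta>) \<in> VY_inter e \<kappa>' B"
  shows "\<forall>\<^sub>F \<epsilon> in at_right 0. gamma_integral e \<kappa> \<epsilon> \<psi> u z \<eta> = mu_rep e \<kappa> \<psi> u (z, \<eta>)"
proof -
  have nz: "\<eta> \<noteq> 0" using VY'_nz [OF q] by simp
  show ?thesis
    unfolding gamma_integral_eq [OF nz] mu_rep_eq_stable_integral [OF q]
    using assms by (intro eventually_scaled_integral_eq [OF e open_admissible deformation_family_unit_gamma locally_deformable_unit_gamma [OF B] \<rho>(1)] integrand_hol)
      (use finite_B [OF B] in auto)
qed

lemma gamma_image_in:
  assumes q: "(z, \<eta>) \<in> VY_inter e \<kappa>' {1..d}"
  shows "\<forall>\<^sub>F \<epsilon> in at_right 0. \<forall>w\<in>gamma_image e \<kappa> \<epsilon> z \<eta>.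
    ((z, w), \<eta>) \<in> VD_inter e \<kappa> {1..CARD('n)} \<and> (w, \<eta>) \<in> VY_inter e \<kappa> {1..d}"
proof -
  have nz: "\<eta> \<noteq> 0" using VY'_nz [OF q] by simp
  have "\<forall>\<^sub>F \<epsilon> in at_right 0. \<epsilon> > 0 \<and> ((z, \<eta>), 0) \<in> slab e (path_system (unit_gamma \<rho> \<theta> \<epsilon>) (cmod (snd (z, \<eta>)) / \<rho> + \<epsilon>)) CARD('n) (admissible {1..CARD('n)} {1..d})"
    by (rule eventually_slab [OF e open_admissible deformation_family_unit_gamma locally_deformable_unit_gamma \<rho>(1) q]) auto
  then show ?thesis
  proof eventually_elim
    case (elim \<epsilon>)
    define b where "b = (\<chi> j. if j = e 1 then \<eta> else 1)"
    show ?case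
    proof
      fix w assume w: "w \<in> gamma_image e \<kappa> \<epsilon> z \<eta>"
      define x where "x = (\<chi> j. (w $ j - z $ j) / b $ j)"
      have "((z, \<eta>), x) \<in> admissible {1..CARD('n)} {1..d}"
      proof (rule slabD [OF conjunct2 [OF elim]])
        fix i assume i: "i \<in> {1..CARD('n)}"
        have "w $ e i \<in> path_image (gamma_path e \<kappa> \<epsilon> z \<eta> i)" using w i unfolding gamma_image_def by blast
        then obtain t where "t \<in> {0..1}" "w $ e i = z $ e i + b $ e i * path_system (unit_gamma \<rho> \<theta> \<epsilon>) (cmod \<eta> / \<rho> + \<epsilon>) i t"
          unfolding gamma_path_eq [OF i] by (auto simp: path_image_def b_def)
        then have "x $ e i = path_system (unit_gamma \<rho> \<theta> \<epsilon>) (cmod \<eta> / \<rho> + \<epsilon>) i t"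
          using nz by (simp add: x_def b_def)
        then show "x $ e i \<in> path_image (path_system (unit_gamma \<rho> \<theta> \<epsilon>) (cmod (snd (z, \<eta>)) / \<rho> + \<epsilon>) i)"
          using \<open>t \<in> {0..1}\<close> by (auto simp: path_image_def)
      qed (use e in \<open>simp add: bij_betw_def\<close>)
      moreover have "shear e z \<eta> x = w" using nz by (simp add: vec_eq_iff shear_nth x_def b_def)
      ultimately show "((z, w), \<eta>) \<in> VD_inter e \<kappa> {1..CARD('n)} \<and> (w, \<eta>) \<in> VY_inter e \<kappa> {1..d}"
        by (simp add: admissible_def to_diag_def to_Y_def)
    qed
  qed
qed

lemma fibre_mono: "A \<subseteq> A' \<Longrightarrow> fibre A' B q i \<subseteq> fibre A B q i"
  by (auto simp: fibre_def)

lemma path_system_in_fibre: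
  assumes \<epsilon>: "\<epsilon> > 0" and G: "path_image (unit_gamma \<rho> \<theta> \<epsilon>) \<subseteq> fibre {1..CARD('n)} B q 1"
    and C: "disc_ok B q (cmod (snd q) / \<rho> + \<epsilon>)"
    and i: "i \<in> {1..CARD('n)}"
  shows "path_image (path_system (unit_gamma \<rho> \<theta> \<epsilon>) (cmod (snd q) / \<rho> + \<epsilon>) i) \<subseteq> fibre {1..CARD('n)} B q i"
proof (cases "i = 1")
  case False
  then have "i \<in> {2..CARD('n)}" using i by auto
  from circle_in_fibre [OF C _ order_refl this] \<epsilon>
  have "path_image (circlepath 0 (cmod (snd q) / \<rho> + \<epsilon>)) \<subseteq> fibre {1..CARD('n)} B q i" by simp
  then show ?thesis using False by (simp add: path_system_def)
qed (use G in \<open>simp add: path_system_def\<close>)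

text \<open>Without the condition on \<open>z\<^sub>j - w\<^sub>j\<close>, \<open>j \<ge> 2\<close>, the integrand is holomorphic in the whole disc bounded by the
  \<open>j\<close>-th circle, so that circle can be contracted to a point.\<close>

lemma mu_rep_null:
  assumes h: "h \<in> hol_sections (VD_inter e \<kappa> ({1..CARD('n)} - {j}))" and u: "u \<in> hol_sections (VY_inter e \<kappa> {1..d})"
    and j: "j \<in> {2..CARD('n)}" and q: "q \<in> VY_inter e \<kappa>' {1..d}"
  shows "mu_rep e \<kappa> h u q = 0"
  unfolding mu_rep_eq_stable_integral [OF q]
proof (rule stable_integral_eqI)
  let ?A = "{1..CARD('n)} - {j}"
  let ?F = "integrand e h u"
  have F: "?F \<in> hol_sections (admissible ?A {1..d})" using h u by (rule integrand_hol)
  show "\<forall>\<^sub>F \<epsilon> in at_right 0. scaled_integral e \<rho> ?F (unit_gamma \<rho> \<theta>) q \<epsilon> = 0"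
    using eventually_in_fibre [OF order_refl q]
  proof eventually_elim
    case (elim \<epsilon>)
    define R where "R = cmod (snd q) / \<rho> + \<epsilon>"
    have R: "R > 0" using elim \<rho> by (simp add: R_def add_nonneg_pos)
    define g where "g = path_system (unit_gamma \<rho> \<theta> \<epsilon>) R"
    have g: "valid_path (g i) \<and> path_image (g i) \<subseteq> fibre ?A {1..d} q i" if "i \<in> {1..CARD('n)}" for i
      using path_system_in_fibre [of \<epsilon> "{1..d}" q i] elim that fibre_mono [of ?A "{1..CARD('n)}" "{1..d}" q i]
      by (auto simp: g_def R_def path_system_def valid_path_unit_gamma)
    have disc: "cball 0 R \<subseteq> fibre ?A {1..d} q j"
      using elim j by (auto simp: fibre_def R_def disc_ok_def)
    have "prod_path_integral e g CARD('n) (\<lambda>x. ?F (q, x)) 0 =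
      prod_path_integral e (g (j := linepath 0 0)) CARD('n) (\<lambda>x. ?F (q, x)) 0"
    proof (rule prod_path_integral_deform [OF e open_admissible F])
      show "(q, x) \<in> admissible ?A {1..d}" if "\<And>i. i \<in> {1..CARD('n)} \<Longrightarrow> x $ e i \<in> fibre ?A {1..d} q i" for x
        using fibre_admissible [OF q _ order_refl that] by blast
      show "valid_path ((g(j := linepath 0 0)) i) \<and> path_image ((g(j := linepath 0 0)) i) \<subseteq> fibre ?A {1..d} q i"
        if "i \<in> {1..CARD('n)}" for i
        using g [OF that] disc R by auto
      fix i f assume i: "i \<in> {1..CARD('n)}" and f: "f holomorphic_on fibre ?A {1..d} q i"
      show "contour_integral (g i) f = contour_integral ((g(j := linepath 0 0)) i) f"
      proof (cases "i = j")
        case True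
        have "(f has_contour_integral 0) (circlepath 0 R)"
        proof (rule Cauchy_theorem_convex_simple)
          show "f holomorphic_on cball 0 R" using f disc True holomorphic_on_subset by blast
        qed (use R in auto)
        then show ?thesis using True j by (simp add: g_def path_system_def contour_integral_unique)
      qed simp
    qed (use g open_fibre in auto)
    also have "\<dots> = 0"
      using j by (intro prod_path_integral_trivial [of j]) auto
    finally show ?case by (simp add: scaled_integral_def g_def R_def)
  qed
qed

text \<open>Without the condition on \<open>arg (z\<^sub>1 - w\<^sub>1)\<close> the domain in \<open>x\<^sub>1\<close> is star shaped: it is an intersection of two
  discs and, if \<open>1 \<in> B\<close>, of a union of two half planes, and all these convex sets contain a common point \<open>c\<close>.\<close>

lemma starlike_fibre_one:
  assumes q: "q \<in> VY_inter e \<kappa>' B'" and A: "1 \<notin> A"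
  shows "starlike (fibre A B q 1)"
proof -
  define z where "z = fst q $ e 1"
  define \<eta> where "\<eta> = snd q"
  have \<eta>: "\<eta> \<in> S_kappa \<kappa>'" "cmod z < \<sigma> * cmod \<eta>" using VY'_memD [OF q] by (auto simp: z_def \<eta>_def)
  have nz: "\<eta> \<noteq> 0" using S_kappaD [OF \<eta>(1)] by auto
  have mem: "x \<in> fibre A B q 1 \<longleftrightarrow> cmod x < \<rho> \<and> cmod (z + \<eta> * x) < \<rho> * cmod \<eta> \<and>
      (1 \<in> B \<longrightarrow> (\<exists>b\<in>{\<theta>, - \<theta>}. Re ((z + \<eta> * x) * cis b) < 0))" for x
    using A by (auto simp: fibre_def z_def \<eta>_def sector_def)
\<comment> \<open>The centre \<open>c\<close> corresponds to a negative real \<open>w\<^sub>1 = m\<close> whose modulus is less than \<open>(\<rho> - \<sigma>) |\<eta>|\<close>.\<close>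
  define m where "m = complex_of_real (- (\<rho> / 4) * cmod \<eta>)"
  define c where "c = (m - z) / \<eta>"
  have zc: "z + \<eta> * c = m" using nz by (simp add: c_def)
  have cm: "cmod m = \<rho> / 4 * cmod \<eta>" using \<rho> by (simp add: m_def norm_mult)
  have cc: "cmod c < \<rho>"
  proof -
    have "cmod (m - z) \<le> cmod m + cmod z" by (rule norm_triangle_ineq4)
    also have "\<dots> < \<rho> * cmod \<eta>"
    proof -
      have "2 * \<sigma> * cmod \<eta> \<le> \<rho> * cmod \<eta>" using \<sigma>_less by (intro mult_right_mono) auto
      moreover have "0 < \<rho> * cmod \<eta>" using \<rho> nz by simp
      ultimately show ?thesis using \<eta>(2) cm by linarith
    qed
    finally show ?thesis using nz by (simp add: c_def norm_divide field_simps)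
  qed
  have "0 < \<rho> * cmod \<eta>" using \<rho> nz by simp
  then have mlt: "cmod m < \<rho> * cmod \<eta>" using cm by linarith
  have mb: "Re (m * cis b) < 0" if "b \<in> {\<theta>, - \<theta>}" for b
  proof -
    have "cos \<theta> > 0" using \<theta> by (intro cos_gt_zero_pi) auto
    then show ?thesis using that \<rho> nz by (auto simp: m_def)
  qed
  have "closed_segment c y \<subseteq> fibre A B q 1" if y: "y \<in> fibre A B q 1" for y
  proof
    fix x assume "x \<in> closed_segment c y"
    then obtain t where t: "0 \<le> t" "t \<le> 1" "x = (1 - t) *\<^sub>R c + t *\<^sub>R y" by (auto simp: in_segment)
    have zx: "z + \<eta> * x = (1 - t) *\<^sub>R m + t *\<^sub>R (z + \<eta> * y)"
      unfolding zc [symmetric] by (simp add: t(3) scaleR_conv_of_real algebra_simps)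
    have "x \<in> ball 0 \<rho>" unfolding t(3)
      using y [unfolded mem] cc t by (intro convexD_alt [OF convex_ball]) auto
    moreover have "z + \<eta> * x \<in> ball 0 (\<rho> * cmod \<eta>)" unfolding zx
      using y [unfolded mem] mlt t by (intro convexD_alt [OF convex_ball]) auto
    moreover have "\<exists>b\<in>{\<theta>, - \<theta>}. Re ((z + \<eta> * x) * cis b) < 0" if "1 \<in> B"
    proof -
      have "\<exists>b\<in>{\<theta>, - \<theta>}. Re ((z + \<eta> * y) * cis b) < 0" using y [unfolded mem] that by (elim conjE) (rule mp)
      then obtain b where b: "b \<in> {\<theta>, - \<theta>}" "Re ((z + \<eta> * y) * cis b) < 0" by (rule bexE)
      have "Re ((z + \<eta> * x) * cis b) = (1 - t) * Re (m * cis b) + t * Re ((z + \<eta> * y) * cis b)"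
        unfolding zx by (simp add: algebra_simps)
      also have "\<dots> < 0" by (rule convex_bound_lt [OF mb [OF b(1)] b(2)]) (use t in auto)
      finally show ?thesis using b(1) by (rule bexI)
    qed
    ultimately show "x \<in> fibre A B q 1" unfolding mem by simp
  qed
  moreover have "c \<in> fibre A B q 1" unfolding mem zc using cc mlt mb by auto
  ultimately show ?thesis unfolding starlike_def by blast
qed

text \<open>Without the condition on \<open>arg (z\<^sub>1 - w\<^sub>1)\<close> the first path may be pulled across \<open>z\<^sub>1\<close> to the chord. The resulting
  integral no longer needs the condition on \<open>arg z\<^sub>1\<close>, so it belongs to the subspace divided out.\<close>

lemma mu_rep_chord:
  assumes h: "h \<in> hol_sections (VD_inter e \<kappa> {2..CARD('n)})" and u: "u \<in> hol_sections (VY_inter e \<kappa> {1..d})"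
    and q: "q \<in> VY_inter e \<kappa>' {1..d}"
  shows "mu_rep e \<kappa> h u q = stable_integral e \<rho> (integrand e h u) chord q"
  unfolding mu_rep_eq_stable_integral [OF q]
proof (rule stable_integral_eqI)
  let ?A = "{2..CARD('n)}"
  let ?F = "integrand e h u"
  have F: "?F \<in> hol_sections (admissible ?A {1..d})" using h u by (rule integrand_hol)
  have q2: "q \<in> VY_inter e \<kappa>' {2..d}" using q by (rule subsetD [OF VY_inter_mono, rotated]) auto
  have "\<forall>\<^sub>F \<epsilon> in at_right 0. scaled_integral e \<rho> ?F chord q \<epsilon> = stable_integral e \<rho> ?F chord q"
    by (rule eventually_scaled_integral_eq [OF e open_admissible deformation_family_chord locally_deformable_chord \<rho>(1) F q2]) auto
  then show "\<forall>\<^sub>F \<epsilon> in at_right 0. scaled_integral e \<rho> ?F (unit_gamma \<rho> \<theta>) q \<epsilon> = stable_integral e \<rho> ?F chord q"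
    using eventually_in_fibre [OF order_refl q]
  proof eventually_elim
    case (elim \<epsilon>)
    define R where "R = cmod (snd q) / \<rho> + \<epsilon>"
    have g: "valid_path (path_system (unit_gamma \<rho> \<theta> \<epsilon>) R i) \<and> path_image (path_system (unit_gamma \<rho> \<theta> \<epsilon>) R i) \<subseteq> fibre ?A {1..d} q i"
      if "i \<in> {1..CARD('n)}" for i
      using path_system_in_fibre [of \<epsilon> "{1..d}" q i] elim that fibre_mono [of ?A "{1..CARD('n)}" "{1..d}" q i]
      by (auto simp: R_def path_system_def valid_path_unit_gamma)
    have seg1: "path_image (chord \<epsilon>) \<subseteq> fibre ?A {1..d} q 1"
      using segment_facts [OF VY'_memD(1,2) [OF q]] by (auto simp: chord_def fibre_def)
    have "prod_path_integral e (path_system (unit_gamma \<rho> \<theta> \<epsilon>) R) CARD('n) (\<lambda>x. ?F (q, x)) 0 =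
      prod_path_integral e (path_system (chord \<epsilon>) R) CARD('n) (\<lambda>x. ?F (q, x)) 0"
    proof (rule prod_path_integral_deform [OF e open_admissible F])
      show "(q, x) \<in> admissible ?A {1..d}" if "\<And>i. i \<in> {1..CARD('n)} \<Longrightarrow> x $ e i \<in> fibre ?A {1..d} q i" for x
        using fibre_admissible [OF q _ order_refl that] by force
      show "valid_path (path_system (chord \<epsilon>) R i) \<and> path_image (path_system (chord \<epsilon>) R i) \<subseteq> fibre ?A {1..d} q i"
        if "i \<in> {1..CARD('n)}" for i
        using g [OF that] seg1 by (auto simp: path_system_def chord_def)
      fix i f assume i: "i \<in> {1..CARD('n)}" and f: "f holomorphic_on fibre ?A {1..d} q i"
      show "contour_integral (path_system (unit_gamma \<rho> \<theta> \<epsilon>) R i) f = contour_integral (path_system (chord \<epsilon>) R i) f"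
      proof (cases "i = 1")
        case True
        have "\<exists>p. \<forall>x\<in>fibre ?A {1..d} q 1. (p has_field_derivative f x) (at x)"
          using f starlike_fibre_one [OF q, of ?A] True open_fibre
          by (intro holomorphic_starlike_primitive [of _ _ "{}"])
             (auto simp: holomorphic_on_imp_continuous_on holomorphic_on_imp_differentiable_at)
        then obtain p where p: "\<And>x. x \<in> fibre ?A {1..d} q 1 \<Longrightarrow>
            (p has_field_derivative f x) (at x within fibre ?A {1..d} q 1)"
          using has_field_derivative_at_within by metis
        have "(f has_contour_integral (p (pathfinish (unit_gamma \<rho> \<theta> \<epsilon>)) - p (pathstart (unit_gamma \<rho> \<theta> \<epsilon>)))) (unit_gamma \<rho> \<theta> \<epsilon>)"
          by (rule contour_integral_primitive [OF p valid_path_unit_gamma])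
             (use g [OF i] True in \<open>simp_all add: path_system_def\<close>)
        moreover have "(f has_contour_integral (p (pathfinish (chord \<epsilon>)) - p (pathstart (chord \<epsilon>)))) (chord \<epsilon>)"
          by (rule contour_integral_primitive [OF p _ seg1]) (simp_all add: chord_def)
        ultimately show ?thesis
          using True by (simp add: path_system_def contour_integral_unique pathstart_unit_gamma pathfinish_unit_gamma chord_def)
      qed (simp add: path_system_def)
    qed (use g open_fibre in auto)
    then show ?case using elim(1) by (simp add: scaled_integral_def R_def)
  qed
qed

lemma stable_integral_chord_hol:
  assumes h: "h \<in> hol_sections (VD_inter e \<kappa> {2..CARD('n)})" and u: "u \<in> hol_sections (VY_inter e \<kappa> {1..d})"
  shows "stable_integral e \<rho> (integrand e h u) chord \<in> hol_sections (VY_inter e \<kappa>' {2..d})"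
  by (rule stable_integral_hol_sections [OF e open_admissible deformation_family_chord locally_deformable_chord \<rho>(1) integrand_hol [OF h u]]) auto

end

section \<open>The derivative along \<open>\<eta>\<close>\<close>

lemma shear_add_eta: "shear e z (\<eta> + t) x = shear e z \<eta> x + t *\<^sub>C (x $ e 1 *\<^sub>C axis (e 1) 1)"
  by (simp add: vec_eq_iff shear_nth axis_def algebra_simps)

lemma shear_add_axis: "shear e z \<eta> (x + t *\<^sub>C axis (e 1) 1) = shear e z \<eta> x + t *\<^sub>C (\<eta> *\<^sub>C axis (e 1) 1)"
  by (simp add: vec_eq_iff shear_nth axis_def algebra_simps)

lemma upd_add: "upd e k (x + t) w = upd e k x w + t *\<^sub>C axis (e k) 1"
  by (simp add: vec_eq_iff upd_nth axis_def)

text \<open>In the coordinates \<open>(z, \<eta>, x)\<close> with \<open>w\<^sub>1 = z\<^sub>1 + \<eta> x\<^sub>1\<close>, moving \<open>\<eta>\<close> moves \<open>w\<^sub>1\<close> with speed \<open>x\<^sub>1\<close> and moving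
  \<open>x\<^sub>1\<close> moves \<open>w\<^sub>1\<close> with speed \<open>\<eta>\<close>. Eliminating \<open>\<partial>/\<partial>w\<^sub>1\<close> expresses the derivative along \<open>\<eta>\<close> through
  \<open>\<partial>/\<partial>x\<^sub>1\<close> and the partial derivative in \<open>\<eta>\<close> at fixed \<open>w\<close>. Below, \<open>a\<close> is the direction of \<open>w\<^sub>1\<close>, \<open>b\<close>
  that of \<open>\<eta>\<close>, and \<open>c\<close> is \<open>x\<^sub>1\<close>.\<close>

lemma cderiv_eliminate:
  assumes f: "cdiff_at f (T y)" and v0: "\<And>t. T (y + t *\<^sub>C v0) = T y + t *\<^sub>C (c *\<^sub>C a + b)"
    and v1: "\<And>t. T (y + t *\<^sub>C v1) = T y + t *\<^sub>C (\<eta> *\<^sub>C a)"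
  shows "\<eta> * cderiv (\<lambda>y. f (T y)) y v0 = c * cderiv (\<lambda>y. f (T y)) y v1 + \<eta> * cderiv f (T y) b"
proof -
  have "cderiv (\<lambda>y. f (T y)) y v0 = cderiv f (T y) (c *\<^sub>C a + b)"
    "cderiv (\<lambda>y. f (T y)) y v1 = cderiv f (T y) (\<eta> *\<^sub>C a)"
    by (simp_all only: cderiv_def v0 v1)
  then show ?thesis
    by (simp add: cderiv_linear [OF f] cdiff_at_has_derivative(2) [OF f] algebra_simps)
qed

lemma cderiv_integrand:
  assumes \<psi>: "cdiff_at \<psi> (to_diag e ((z, \<eta>), x))" and u: "cdiff_at u (to_Y e ((z, \<eta>), x))" and nz: "\<eta> \<noteq> 0"
  shows "cderiv (integrand e \<psi> u) ((z, \<eta>), x) ((0, 1), 0) =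
    x $ e 1 * cderiv (integrand e \<psi> u) ((z, \<eta>), x) (0, axis (e 1) 1) / \<eta>
    + integrand e (d_eta \<psi>) u ((z, \<eta>), x) + integrand e \<psi> (d_eta u) ((z, \<eta>), x)"
proof -
  have c: "cdiff_at (\<lambda>y. \<psi> (to_diag e y)) ((z, \<eta>), x)" "cdiff_at (\<lambda>y. u (to_Y e y)) ((z, \<eta>), x)"
    by (rule cdiff_at_compose [OF cdiff_at_to_diag \<psi>], rule cdiff_at_compose [OF cdiff_at_to_Y u])
  define D where "D = cderiv (\<lambda>y. \<psi> (to_diag e y)) ((z, \<eta>), x)"
  define E where "E = cderiv (\<lambda>y. u (to_Y e y)) ((z, \<eta>), x)"
  have D: "\<eta> * D ((0, 1), 0) = x $ e 1 * D (0, axis (e 1) 1) + \<eta> * d_eta \<psi> (to_diag e ((z, \<eta>), x))"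
    unfolding D_def using cderiv_eliminate [of \<psi> "to_diag e" "((z, \<eta>), x)" "((0, 1), 0)" "x $ e 1"
        "((0, axis (e 1) 1), 0)" "(0, 1)" "(0, axis (e 1) 1)" \<eta>, OF \<psi>]
    by (simp add: to_diag_def shear_add_eta shear_add_axis d_eta_eq_cderiv zero_prod_def del: One_nat_def)
  have E: "\<eta> * E ((0, 1), 0) = x $ e 1 * E (0, axis (e 1) 1) + \<eta> * d_eta u (to_Y e ((z, \<eta>), x))"
    unfolding E_def using cderiv_eliminate [of u "to_Y e" "((z, \<eta>), x)" "((0, 1), 0)" "x $ e 1"
        "(axis (e 1) 1, 0)" "(0, 1)" "(0, axis (e 1) 1)" \<eta>, OF u]
    by (simp add: to_Y_def shear_add_eta shear_add_axis d_eta_eq_cderiv zero_prod_def del: One_nat_def)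
  define a where "a = \<psi> (to_diag e ((z, \<eta>), x))"
  define b where "b = u (to_Y e ((z, \<eta>), x))"
  have eq: "cderiv (integrand e \<psi> u) ((z, \<eta>), x) v = a * E v + D v * b" for v
    unfolding integrand_eq a_def b_def D_def E_def by (rule cderiv_mult [OF c])
  have "\<eta> * (a * E ((0, 1), 0) + D ((0, 1), 0) * b) = a * (\<eta> * E ((0, 1), 0)) + (\<eta> * D ((0, 1), 0)) * b"
    by (simp add: algebra_simps)
  also have "\<dots> = x $ e 1 * (a * E (0, axis (e 1) 1) + D (0, axis (e 1) 1) * b)
      + \<eta> * (d_eta \<psi> (to_diag e ((z, \<eta>), x)) * b + a * d_eta u (to_Y e ((z, \<eta>), x)))"
    unfolding D E by (simp add: algebra_simps)
  finally show ?thesis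
    unfolding eq using nz by (simp add: integrand_eq a_def b_def field_simps)
qed

context composition_setting
begin

text \<open>The boundary term of the integration by parts in the variable \<open>x\<^sub>1\<close>. It is written as an integral
  over the path \<open>[0, 1]\<close> of a function that does not depend on \<open>x\<^sub>1\<close>; the factor \<open>1 / \<eta>\<close> cancels the Jacobian.\<close>

definition boundary :: "(((complex ^ 'n) \<times> complex) \<times> (complex ^ 'n) \<Rightarrow> complex) \<Rightarrow>
    ((complex ^ 'n) \<times> complex) \<times> (complex ^ 'n) \<Rightarrow> complex" where
  "boundary F y = inverse (snd (fst y)) * (beta1 \<rho> \<theta> * F (fst y, upd e 1 (beta1 \<rho> \<theta>) (snd y))
     - beta0 \<rho> \<theta> * F (fst y, upd e 1 (beta0 \<rho> \<theta>) (snd y)))"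

text \<open>The points where \<open>boundary F\<close> is defined, for \<open>F\<close> on the full domain.\<close>

definition boundary_dom :: "(((complex ^ 'n) \<times> complex) \<times> (complex ^ 'n)) set" where
  "boundary_dom = {y. (fst y, upd e 1 (beta0 \<rho> \<theta>) (snd y)) \<in> admissible {1..CARD('n)} {1..d} \<and>
     (fst y, upd e 1 (beta1 \<rho> \<theta>) (snd y)) \<in> admissible {1..CARD('n)} {1..d}}"

lemma cdiff_upd_const: "cdiff_at (\<lambda>y. (fst y, upd e 1 c (snd y))) y"
  by (intro cdiff_at_Pair cdiff_at_upd cdiff_at_fst cdiff_at_snd cdiff_at_ident cdiff_at_const)

lemma open_boundary_dom: "open boundary_dom"
  unfolding boundary_dom_def
  by (intro open_Collect_conj open_vimage_Collect open_admissible cdiff_imp_continuous_on cdiff_upd_const) auto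

lemma admissible_nz: "y \<in> admissible A B \<Longrightarrow> snd (fst y) \<noteq> 0"
proof -
  assume "y \<in> admissible A B"
  then have "(shear e (fst (fst y)) (snd (fst y)) (snd y), snd (fst y)) \<in> VY_inter e \<kappa> B"
    by (simp add: admissible_def to_Y_def)
  then show ?thesis unfolding VY_inter_iff [OF \<theta>] by auto
qed

lemma cdiff_inverse_eta:
  fixes y :: "('a::cnormed \<times> complex) \<times> 'b::cnormed"
  shows "snd (fst y) \<noteq> 0 \<Longrightarrow> cdiff_at (\<lambda>y. inverse (snd (fst y))) y"
proof (rule cdiff_at_compose [of "\<lambda>y. snd (fst y)" y inverse])
  assume "snd (fst y) \<noteq> 0"
  then show "cdiff_at inverse (snd (fst y))"
    using field_differentiable_inverse [OF field_differentiable_ident, of "snd (fst y)"]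
    by (simp add: cdiff_at_field)
qed (intro cdiff_at_snd cdiff_at_fst cdiff_at_ident)

lemma boundary_hol:
  assumes "F \<in> hol_sections (admissible {1..CARD('n)} {1..d})"
  shows "boundary F \<in> hol_sections boundary_dom"
  unfolding hol_sections_iff
proof
  fix y assume y: "y \<in> boundary_dom"
  have "snd (fst y) \<noteq> 0" using y admissible_nz by (fastforce simp: boundary_dom_def)
  then show "cdiff_at (boundary F) y"
    unfolding boundary_def [abs_def]
    using y assms
    by (intro cdiff_at_mult cdiff_at_diff cdiff_at_const cdiff_inverse_eta
        cdiff_at_compose [of "\<lambda>y. (fst y, upd e 1 c (snd y))" y F for c y] cdiff_upd_const)
       (auto simp: boundary_dom_def hol_sections_iff)
qed

text \<open>The constant family given by the segment from \<open>0\<close> to \<open>1\<close>.\<close>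

definition unit_path :: "real \<Rightarrow> real \<Rightarrow> complex" where
  "unit_path \<delta> = linepath 0 1"

lemma deformation_family_unit_path: "deformation_family unit_path"
  unfolding unit_path_def [abs_def] by (rule deformation_family_const) simp

text \<open>The end points of the first path are admissible without any condition on \<open>arg z\<^sub>1\<close>; therefore the boundary
  term extends to \<open>V\<^sup>(\<^sup>{\<^sup>2\<^sup>,\<^sup>\<dots>\<^sup>,\<^sup>d\<^sup>}\<^sup>)\<close>.\<close>

lemma beta_in_fibre:
  assumes q: "q \<in> VY_inter e \<kappa>' B'" and b: "b = beta0 \<rho> \<theta> \<or> b = beta1 \<rho> \<theta>"
  shows "b \<in> fibre A B q 1"
proof -
  have "b \<in> closed_segment (beta0 \<rho> \<theta>) (beta1 \<rho> \<theta>)" using b by auto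
  moreover have "b \<in> path_image (unit_gamma \<rho> \<theta> 1)"
    using b pathstart_in_path_image [of "unit_gamma \<rho> \<theta> 1"] pathfinish_in_path_image [of "unit_gamma \<rho> \<theta> 1"]
    by (auto simp: pathstart_unit_gamma pathfinish_unit_gamma)
  ultimately show ?thesis
    using segment_facts [OF VY'_memD(1,2) [OF q]] unit_gamma_facts(3) [OF VY'_memD(1,2) [OF q], of 1] by (simp add: fibre_def)
qed

lemma locally_deformable_unit_path: "locally_deformable e \<rho> boundary_dom unit_path (VY_inter e \<kappa>' {2..d})"
proof (rule locally_deformableI [where B = "{1..d}" and A = "{1..CARD('n)}" and T = "\<lambda>q. UNIV"])
  fix q0 assume "q0 \<in> VY_inter e \<kappa>' {2..d}"
  then show "\<exists>N \<delta>0. open N \<and> q0 \<in> N \<and> N \<subseteq> VY_inter e \<kappa>' {2..d} \<and> 0 < \<delta>0 \<and>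
      (\<forall>q\<in>N. \<forall>\<delta>. 0 < \<delta> \<longrightarrow> \<delta> \<le> \<delta>0 \<longrightarrow> path_image (unit_path \<delta>) \<subseteq> UNIV)"
    using open_VY_inter [OF \<tau>, of "{2..d}" e]
    by (intro exI [of _ "VY_inter e \<kappa>' {2..d}"] exI [of _ "1::real"]) auto
next
  fix q x
  assume q: "q \<in> VY_inter e \<kappa>' {2..d}"
    and x: "\<And>i. i \<in> {2..CARD('n)} \<Longrightarrow> x $ e i \<in> fibre {1..CARD('n)} {1..d} q i"
  have "(q, upd e 1 b x) \<in> admissible {1..CARD('n)} {1..d}" if b: "b = beta0 \<rho> \<theta> \<or> b = beta1 \<rho> \<theta>" for b
  proof (rule fibre_admissible [OF q order_refl order_refl])
    fix i assume i: "i \<in> {1..CARD('n)}"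
    show "upd e 1 b x $ e i \<in> fibre {1..CARD('n)} {1..d} q i"
    proof (cases "i = 1")
      case False
      then show ?thesis using x [of i] i e_eq_iff [OF i] by (simp add: upd_nth)
    qed (use beta_in_fibre [OF q b] in \<open>simp add: upd_nth\<close>)
  qed
  then show "(q, x) \<in> boundary_dom" by (simp add: boundary_dom_def)
qed auto

text \<open>The derivative of \<open>x\<^sub>1 F / \<eta>\<close> with respect to \<open>x\<^sub>1\<close>.\<close>

definition total_deriv :: "(((complex ^ 'n) \<times> complex) \<times> (complex ^ 'n) \<Rightarrow> complex) \<Rightarrow>
    ((complex ^ 'n) \<times> complex) \<times> (complex ^ 'n) \<Rightarrow> complex" where
  "total_deriv F y = inverse (snd (fst y)) * (F y + snd y $ e 1 * cderiv F y (0, axis (e 1) 1))"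

lemma total_deriv_hol:
  assumes F: "F \<in> hol_sections (admissible {1..CARD('n)} {1..d})"
  shows "total_deriv F \<in> hol_sections (admissible {1..CARD('n)} {1..d})"
proof -
  have "(\<lambda>y. cderiv F y (0, axis (e 1) 1)) \<in> hol_sections (admissible {1..CARD('n)} {1..d})"
    by (rule cderiv_hol_sections [OF open_admissible F]) auto
  then show ?thesis
    using F admissible_nz unfolding total_deriv_def [abs_def] hol_sections_iff
    by (auto intro!: cdiff_at_mult cdiff_at_add cdiff_inverse_eta cdiff_at_nth cdiff_at_snd cdiff_at_ident)
qed

lemma has_field_derivative_total:
  assumes F: "cdiff_at F (q, upd e 1 x w)"
  shows "((\<lambda>x. inverse (snd q) * (x * F (q, upd e 1 x w))) has_field_derivative total_deriv F (q, upd e 1 x w)) (at x)"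
proof -
  define p0 where "p0 = (q, upd e 1 0 w)"
  have u: "(q, upd e 1 t w) = p0 + t *\<^sub>C (0, axis (e 1) 1)" for t
    using upd_add [of e 1 0 t w] by (simp add: p0_def)
  have "((\<lambda>t. F (q, upd e 1 t w)) has_field_derivative cderiv F (q, upd e 1 x w) (0, axis (e 1) 1)) (at x)"
    using has_field_derivative_line [of F p0 x "(0, axis (e 1) 1)"] F unfolding u .
  then have "((\<lambda>t. inverse (snd q) * (t * F (q, upd e 1 t w))) has_field_derivative
     inverse (snd q) * (1 * F (q, upd e 1 x w) + cderiv F (q, upd e 1 x w) (0, axis (e 1) 1) * x)) (at x)"
    by (intro DERIV_cmult DERIV_mult DERIV_ident)
  then show ?thesis by (simp add: total_deriv_def upd_nth mult.commute)
qed

lemma stable_integral_total_deriv: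
  assumes F: "F \<in> hol_sections (admissible {1..CARD('n)} {1..d})" and q: "q \<in> VY_inter e \<kappa>' {1..d}"
  shows "stable_integral e \<rho> (total_deriv F) (unit_gamma \<rho> \<theta>) q = stable_integral e \<rho> (boundary F) unit_path q"
proof (rule stable_integral_eqI)
  have q2: "q \<in> VY_inter e \<kappa>' {2..d}" using q by (rule subsetD [OF VY_inter_mono, rotated]) auto
  have "\<forall>\<^sub>F \<epsilon> in at_right 0. scaled_integral e \<rho> (boundary F) unit_path q \<epsilon> = stable_integral e \<rho> (boundary F) unit_path q"
    by (rule eventually_scaled_integral_eq [OF e open_boundary_dom deformation_family_unit_path locally_deformable_unit_path \<rho>(1) boundary_hol [OF F] q2])
  then show "\<forall>\<^sub>F \<epsilon> in at_right 0. scaled_integral e \<rho> (total_deriv F) (unit_gamma \<rho> \<theta>) q \<epsilon> = stable_integral e \<rho> (boundary F) unit_path q"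
    using eventually_in_fibre [OF order_refl q]
  proof eventually_elim
    case (elim \<epsilon>)
    define R where "R = cmod (snd q) / \<rho> + \<epsilon>"
    have g: "path_image (path_system (unit_gamma \<rho> \<theta> \<epsilon>) R i) \<subseteq> fibre {1..CARD('n)} {1..d} q i" if "i \<in> {1..CARD('n)}" for i
      using path_system_in_fibre [of \<epsilon> "{1..d}" q i] elim that by (auto simp: R_def)
    have "prod_path_integral e (path_system (unit_gamma \<rho> \<theta> \<epsilon>) R) CARD('n) (\<lambda>x. total_deriv F (q, x)) 0 =
      prod_path_integral e (path_system (unit_path \<epsilon>) R) CARD('n) (\<lambda>x. boundary F (q, x)) 0"
    proof (rule prod_path_integral_outer_cong [OF inj, of 1])
      fix w assume w: "\<And>i. i \<in> {1<..CARD('n)} \<Longrightarrow> w $ e i \<in> path_image (path_system (unit_gamma \<rho> \<theta> \<epsilon>) R i)"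
      have in_Om: "(q, upd e 1 x w) \<in> admissible {1..CARD('n)} {1..d}" if x: "x \<in> path_image (unit_gamma \<rho> \<theta> \<epsilon>)" for x
      proof (rule fibre_admissible [OF q order_refl order_refl])
        fix i assume i: "i \<in> {1..CARD('n)}"
        show "upd e 1 x w $ e i \<in> fibre {1..CARD('n)} {1..d} q i"
          using g [OF i] w [of i] x i e_eq_iff [OF i] by (cases "i = 1") (auto simp: upd_nth path_system_def)
      qed
      define p where "p = (\<lambda>x. inverse (snd q) * (x * F (q, upd e 1 x w)))"
      have "((\<lambda>x. total_deriv F (q, upd e 1 x w)) has_contour_integral
         (p (pathfinish (unit_gamma \<rho> \<theta> \<epsilon>)) - p (pathstart (unit_gamma \<rho> \<theta> \<epsilon>)))) (unit_gamma \<rho> \<theta> \<epsilon>)"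
      proof (rule contour_integral_primitive [OF _ valid_path_unit_gamma order_refl])
        fix x assume "x \<in> path_image (unit_gamma \<rho> \<theta> \<epsilon>)"
        then have "cdiff_at F (q, upd e 1 x w)" using in_Om F by (auto simp: hol_sections_iff)
        then show "(p has_field_derivative total_deriv F (q, upd e 1 x w)) (at x within path_image (unit_gamma \<rho> \<theta> \<epsilon>))"
          unfolding p_def by (rule has_field_derivative_at_within [OF has_field_derivative_total])
      qed
      then have L: "contour_integral (unit_gamma \<rho> \<theta> \<epsilon>) (\<lambda>x. total_deriv F (q, upd e 1 x w)) = p (beta1 \<rho> \<theta>) - p (beta0 \<rho> \<theta>)"
        by (simp add: contour_integral_unique pathstart_unit_gamma pathfinish_unit_gamma)
      have "boundary F (q, upd e 1 x w) = p (beta1 \<rho> \<theta>) - p (beta0 \<rho> \<theta>)" for x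
      proof -
        have "upd e 1 b (upd e 1 x w) = upd e 1 b w" for b by (simp add: vec_eq_iff upd_nth)
        then show ?thesis by (simp add: boundary_def p_def right_diff_distrib)
      qed
      then have "contour_integral (unit_path \<epsilon>) (\<lambda>x. boundary F (q, upd e 1 x w)) = p (beta1 \<rho> \<theta>) - p (beta0 \<rho> \<theta>)"
        by (simp add: unit_path_def contour_integral_unique [OF has_contour_integral_const_linepath])
      with L show "prod_path_integral e (path_system (unit_gamma \<rho> \<theta> \<epsilon>) R) 1 (\<lambda>x. total_deriv F (q, x)) w =
          prod_path_integral e (path_system (unit_path \<epsilon>) R) 1 (\<lambda>x. boundary F (q, x)) w"
        unfolding One_nat_def prod_path_integral_Suc by (simp add: path_system_def)
    qed (auto simp: path_system_def)
    then show ?case using elim(1) by (simp add: scaled_integral_def R_def)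
  qed
qed

text \<open>Differentiation along \<open>\<eta>\<close> obeys the Leibniz rule up to the boundary term, which is due to the motion of the
  end points of the first path.\<close>

theorem d_eta_mu_rep:
  assumes \<psi>: "\<psi> \<in> hol_sections (VD_inter e \<kappa> {1..CARD('n)})" and u: "u \<in> hol_sections (VY_inter e \<kappa> {1..d})"
    and q: "q \<in> VY_inter e \<kappa>' {1..d}"
  shows "d_eta (mu_rep e \<kappa> \<psi> u) q = stable_integral e \<rho> (boundary (integrand e \<psi> u)) unit_path q
     + (mu_rep e \<kappa> (d_eta \<psi>) u q + mu_rep e \<kappa> \<psi> (d_eta u) q)"
proof -
  let ?F = "integrand e \<psi> u" and ?O = "admissible {1..CARD('n)} {1..d}" and ?P = "unit_gamma \<rho> \<theta>"
  have oO: "open ?O" by (rule open_admissible) auto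
  note ctx = e oO deformation_family_unit_gamma locally_deformable_unit_gamma [OF order_refl] \<rho>(1)
  have F: "?F \<in> hol_sections ?O" using \<psi> u by (rule integrand_hol)
  have d\<psi>: "d_eta \<psi> \<in> hol_sections (VD_inter e \<kappa> {1..CARD('n)})"
    by (rule d_eta_hol_sections [OF open_VD_inter [OF \<theta>] \<psi>]) auto
  have du: "d_eta u \<in> hol_sections (VY_inter e \<kappa> {1..d})"
    by (rule d_eta_hol_sections [OF open_VY_inter [OF \<theta>] u]) auto
  let ?F1 = "integrand e (d_eta \<psi>) u" and ?F2 = "integrand e \<psi> (d_eta u)"
  have F1: "?F1 \<in> hol_sections ?O" using d\<psi> u by (rule integrand_hol)
  have F2: "?F2 \<in> hol_sections ?O" using \<psi> du by (rule integrand_hol)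
  let ?dF = "\<lambda>p. cderiv ?F p ((0, 1), 0)"
  have dF: "?dF \<in> hol_sections ?O" by (rule cderiv_hol_sections [OF oO F])
  have nz: "snd q \<noteq> 0" by (rule VY'_nz [OF q])
  have Finv: "(\<lambda>p. inverse (snd (fst p)) * ?F p) \<in> hol_sections ?O"
    using F admissible_nz unfolding hol_sections_iff by (auto intro!: cdiff_at_mult cdiff_inverse_eta)
  have ev: "\<forall>\<^sub>F p in nhds q. stable_integral e \<rho> ?F ?P p = mu_rep e \<kappa> \<psi> u p"
    using eventually_nhds_in_open [OF open_VY' [OF order_refl] q]
    by eventually_elim (simp add: mu_rep_eq_stable_integral)
  have "d_eta (mu_rep e \<kappa> \<psi> u) q = cderiv (mu_rep e \<kappa> \<psi> u) q (0, 1)"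
    by (metis d_eta_eq_cderiv prod.collapse)
  also have "\<dots> = cderiv (stable_integral e \<rho> ?F ?P) q (0, 1)"
    by (rule cderiv_cong [OF stable_integral_derivative(1) [OF ctx F q] ev])
  also have "\<dots> = stable_integral e \<rho> ?F ?P q / snd q + stable_integral e \<rho> ?dF ?P q"
    by (rule stable_integral_derivative(2) [OF ctx F q nz])
  also have "stable_integral e \<rho> ?F ?P q / snd q = stable_integral e \<rho> (\<lambda>p. inverse (snd (fst p)) * ?F p) ?P q"
    by (subst stable_integral_lmul [OF eventually_scaled_integral_eq [OF ctx F q]]) (simp add: divide_inverse mult.commute)
  also have "\<dots> + stable_integral e \<rho> ?dF ?P q = stable_integral e \<rho> (\<lambda>p. inverse (snd (fst p)) * ?F p + ?dF p) ?P q"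
    by (rule stable_integral_add [OF ctx Finv dF q, symmetric])
  also have "\<dots> = stable_integral e \<rho> (\<lambda>p. total_deriv ?F p + (?F1 p + ?F2 p)) ?P q"
  proof (rule stable_integral_cong [OF ctx q _ hol_sections_add [OF Finv dF]])
    fix x assume x: "(q, x) \<in> ?O"
    obtain z \<eta> where q_eq: "q = (z, \<eta>)" by fastforce
    have "cdiff_at \<psi> (to_diag e ((z, \<eta>), x))" "cdiff_at u (to_Y e ((z, \<eta>), x))"
      using x \<psi> u by (auto simp: admissible_def q_eq hol_sections_iff)
    from cderiv_integrand [OF this] nz
    show "inverse (snd (fst (q, x))) * ?F (q, x) + ?dF (q, x) = total_deriv ?F (q, x) + (?F1 (q, x) + ?F2 (q, x))"
      by (simp add: total_deriv_def q_eq field_simps)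
  qed
  also have "\<dots> = stable_integral e \<rho> (total_deriv ?F) ?P q + stable_integral e \<rho> (\<lambda>p. ?F1 p + ?F2 p) ?P q"
    by (rule stable_integral_add [OF ctx total_deriv_hol [OF F] hol_sections_add [OF F1 F2] q])
  also have "stable_integral e \<rho> (\<lambda>p. ?F1 p + ?F2 p) ?P q = stable_integral e \<rho> ?F1 ?P q + stable_integral e \<rho> ?F2 ?P q"
    by (rule stable_integral_add [OF ctx F1 F2 q])
  finally show ?thesis
    by (simp add: stable_integral_total_deriv [OF F q] mu_rep_eq_stable_integral [OF q])
qed

lemma stable_integral_boundary_hol:
  assumes "\<psi> \<in> hol_sections (VD_inter e \<kappa> {1..CARD('n)})" "u \<in> hol_sections (VY_inter e \<kappa> {1..d})"
  shows "stable_integral e \<rho> (boundary (integrand e \<psi> u)) unit_path \<in> hol_sections (VY_inter e \<kappa>' {2..d})"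
  by (rule stable_integral_hol_sections [OF e open_boundary_dom deformation_family_unit_path locally_deformable_unit_path \<rho>(1) boundary_hol [OF integrand_hol [OF assms]]])

end

section \<open>Passage to the quotients\<close>

text \<open>The functions that represent the zero class.\<close>

definition null_sections :: "'a::{real_normed_vector,cscale} set \<Rightarrow> (nat \<Rightarrow> 'a set) \<Rightarrow> nat \<Rightarrow> ('a \<Rightarrow> complex) set" where
  "null_sections U V m = {w. \<exists>h. (\<forall>\<alpha>\<in>P_vee m. h \<alpha> \<in> hol_sections (cover_inter U V \<alpha>)) \<and>
     (\<forall>p\<in>cover_inter U V {1..m}. w p = (\<Sum>\<alpha>\<in>P_vee m. h \<alpha> p))}"

lemma quot_rel_iff:
  "(u, v) \<in> quot_rel U V m \<longleftrightarrow> u \<in> hol_sections (cover_inter U V {1..m}) \<and>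
     v \<in> hol_sections (cover_inter U V {1..m}) \<and> (\<lambda>p. u p - v p) \<in> null_sections U V m"
  by (simp add: quot_rel_def null_sections_def)

lemma finite_P_vee: "finite (P_vee m)"
  by (rule finite_subset [of _ "Pow {1..m}"]) (auto simp: P_vee_def)

lemma P_vee_cases:
  assumes "\<alpha> \<in> P_vee m" "1 \<le> m"
  obtains j where "j \<in> {1..m}" "\<alpha> = {1..m} - {j}"
proof -
  have a: "\<alpha> \<subseteq> {1..m}" "card \<alpha> = m - 1" using assms by (auto simp: P_vee_def)
  then have "card ({1..m} - \<alpha>) = 1" using assms(2) by (simp add: card_Diff_subset finite_subset)
  then obtain j where "{1..m} - \<alpha> = {j}" by (auto simp: card_1_singleton_iff)
  then show ?thesis using a by (intro that [of j]) auto
qed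

lemma P_vee_tail: "1 \<le> m \<Longrightarrow> {2..m} \<in> P_vee m"
  by (auto simp: P_vee_def)

lemma tail_eq: "{1..m} - {1} = {2..m::nat}" by auto

lemma P_vee_subset: "\<alpha> \<in> P_vee m \<Longrightarrow> \<alpha> \<subseteq> {1..m}"
  by (auto simp: P_vee_def)

lemma cover_inter_mono: "\<alpha> \<subseteq> \<beta> \<Longrightarrow> cover_inter U V \<beta> \<subseteq> cover_inter U V \<alpha>"
  by (auto simp: cover_inter_def)

lemma null_sections_cong: "w \<in> null_sections U V m \<Longrightarrow> (\<And>p. p \<in> cover_inter U V {1..m} \<Longrightarrow> w p = w' p) \<Longrightarrow> w' \<in> null_sections U V m"
  by (auto simp: null_sections_def)

lemma null_sections_zero: "(\<lambda>p. 0) \<in> null_sections (U :: 'a::cnormed set) V m"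
  unfolding null_sections_def by (intro CollectI exI [of _ "\<lambda>\<alpha> p. 0"]) (auto intro: hol_sections_zero)

lemma null_sections_add:
  assumes "v \<in> null_sections (U :: 'a::cnormed set) V m" "w \<in> null_sections U V m"
  shows "(\<lambda>p. v p + w p) \<in> null_sections U V m"
proof -
  obtain h k where "\<forall>\<alpha>\<in>P_vee m. h \<alpha> \<in> hol_sections (cover_inter U V \<alpha>)"
     "\<forall>p\<in>cover_inter U V {1..m}. v p = (\<Sum>\<alpha>\<in>P_vee m. h \<alpha> p)"
     "\<forall>\<alpha>\<in>P_vee m. k \<alpha> \<in> hol_sections (cover_inter U V \<alpha>)"
     "\<forall>p\<in>cover_inter U V {1..m}. w p = (\<Sum>\<alpha>\<in>P_vee m. k \<alpha> p)"
    using assms by (auto simp: null_sections_def)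
  then show ?thesis unfolding null_sections_def
    by (intro CollectI exI [of _ "\<lambda>\<alpha> p. h \<alpha> p + k \<alpha> p"]) (auto intro: hol_sections_add simp: sum.distrib)
qed

lemma null_sections_lmul:
  assumes "w \<in> null_sections (U :: 'a::cnormed set) V m"
  shows "(\<lambda>p. c * w p) \<in> null_sections U V m"
proof -
  obtain k where "\<forall>\<alpha>\<in>P_vee m. k \<alpha> \<in> hol_sections (cover_inter U V \<alpha>)"
     "\<forall>p\<in>cover_inter U V {1..m}. w p = (\<Sum>\<alpha>\<in>P_vee m. k \<alpha> p)"
    using assms by (auto simp: null_sections_def)
  then show ?thesis unfolding null_sections_def
    by (intro CollectI exI [of _ "\<lambda>\<alpha> p. c * k \<alpha> p"]) (auto intro: hol_sections_lmul simp: sum_distrib_left)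
qed

lemma null_sections_single:
  assumes "f \<in> hol_sections (cover_inter (U :: 'a::cnormed set) V \<beta>)" "\<beta> \<in> P_vee m"
  shows "f \<in> null_sections U V m"
  unfolding null_sections_def
proof (intro CollectI exI [of _ "\<lambda>\<alpha> p. if \<alpha> = \<beta> then f p else 0"] conjI ballI)
  show "(\<lambda>p. if \<alpha> = \<beta> then f p else 0) \<in> hol_sections (cover_inter U V \<alpha>)" for \<alpha>
    using assms(1) by (cases "\<alpha> = \<beta>") (simp_all add: hol_sections_zero)
qed (simp add: assms(2) finite_P_vee)

text \<open>The derivative of a sum of sections over the \<open>V\<^sup>(\<^sup>\<alpha>\<^sup>)\<close> is again such a sum, because these sets are open.\<close>

lemma null_sections_d_eta:
  fixes U :: "('b::{euclidean_space,cnormed} \<times> complex) set"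
  assumes o: "\<And>\<alpha>. \<alpha> \<subseteq> {1..m} \<Longrightarrow> open (cover_inter U V \<alpha>)"
    and w: "w \<in> null_sections U V m"
  shows "d_eta w \<in> null_sections U V m"
proof -
  obtain h where h: "\<And>\<alpha>. \<alpha> \<in> P_vee m \<Longrightarrow> h \<alpha> \<in> hol_sections (cover_inter U V \<alpha>)"
     and eq: "\<And>p. p \<in> cover_inter U V {1..m} \<Longrightarrow> w p = (\<Sum>\<alpha>\<in>P_vee m. h \<alpha> p)"
    using w by (auto simp: null_sections_def)
  let ?V = "cover_inter U V {1..m}"
  have "d_eta w p = (\<Sum>\<alpha>\<in>P_vee m. d_eta (h \<alpha>) p)" if p: "p \<in> ?V" for p
  proof -
    have c: "cdiff_at (h \<alpha>) p" if "\<alpha> \<in> P_vee m" for \<alpha>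
      using h [OF that] p cover_inter_mono [OF P_vee_subset [OF that], of U V] by (auto simp: hol_sections_iff)
    have ev: "\<forall>\<^sub>F q in nhds p. (\<Sum>\<alpha>\<in>P_vee m. h \<alpha> q) = w q"
      using eventually_nhds_in_open [OF o [OF order_refl] p] by eventually_elim (simp add: eq)
    have "((\<lambda>q. \<Sum>\<alpha>\<in>P_vee m. h \<alpha> q) has_derivative (\<lambda>v. \<Sum>\<alpha>\<in>P_vee m. cderiv (h \<alpha>) p v)) (at p)"
      using c by (intro has_derivative_sum cdiff_at_has_derivative)
    moreover have "(\<Sum>\<alpha>\<in>P_vee m. cderiv (h \<alpha>) p (k *\<^sub>C v)) = k * (\<Sum>\<alpha>\<in>P_vee m. cderiv (h \<alpha>) p v)" for k v
      using cdiff_at_has_derivative(2) [OF c] by (simp add: sum_distrib_left)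
    ultimately have "cderiv (\<lambda>q. \<Sum>\<alpha>\<in>P_vee m. h \<alpha> q) p (0, 1) = (\<Sum>\<alpha>\<in>P_vee m. cderiv (h \<alpha>) p (0, 1))"
      and "cdiff_at (\<lambda>q. \<Sum>\<alpha>\<in>P_vee m. h \<alpha> q) p"
      using cderiv_eqI by (blast, auto simp: cdiff_at_def)
    then show ?thesis
      using cderiv_cong [OF _ ev, of "(0, 1)"] by (cases p) (simp add: d_eta_eq_cderiv)
  qed
  moreover have "d_eta (h \<alpha>) \<in> hol_sections (cover_inter U V \<alpha>)" if "\<alpha> \<in> P_vee m" for \<alpha>
    using d_eta_hol_sections [OF o [OF P_vee_subset [OF that]] h [OF that]] .
  ultimately show ?thesis unfolding null_sections_def by (intro CollectI exI [of _ "\<lambda>\<alpha>. d_eta (h \<alpha>)"]) auto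
qed

lemma equiv_quot_rel: "equiv (hol_sections (cover_inter U V {1..m})) (quot_rel (U :: 'a::cnormed set) V m)"
proof (rule equivI)
  show "quot_rel U V m \<subseteq> hol_sections (cover_inter U V {1..m}) \<times> hol_sections (cover_inter U V {1..m})"
    by (auto simp: quot_rel_iff)
  show "refl_on (hol_sections (cover_inter U V {1..m})) (quot_rel U V m)"
    unfolding refl_on_def by (auto simp: quot_rel_iff null_sections_zero)
  show "sym (quot_rel U V m)"
    using null_sections_lmul [of _ U V m "-1"] by (force simp: sym_def quot_rel_iff)
  show "trans (quot_rel U V m)"
  proof (rule transI)
    fix x y z assume "(x, y) \<in> quot_rel U V m" "(y, z) \<in> quot_rel U V m"
    then show "(x, z) \<in> quot_rel U V m"
      using null_sections_add [of "\<lambda>p. x p - y p" U V m "\<lambda>p. y p - z p"] by (auto simp: quot_rel_iff)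
  qed
qed

context
  fixes U :: "'a::cnormed set" and V :: "nat \<Rightarrow> 'a set" and m :: nat and R H
  assumes R_def: "R = quot_rel U V m" and H_def: "H = hol_sections (cover_inter U V {1..m})"
begin

lemma R_iff: "(u, v) \<in> R \<longleftrightarrow> u \<in> H \<and> v \<in> H \<and> (\<lambda>p. u p - v p) \<in> null_sections U V m"
  by (simp add: R_def H_def quot_rel_iff)

lemma equiv_R: "equiv H R" unfolding R_def H_def by (rule equiv_quot_rel)

lemma quotient_memD:
  assumes "A \<in> H // R" "u \<in> A"
  shows "u \<in> H" "A = R `` {u}"
proof -
  show "A = R `` {u}" using assms equiv_R by (metis Image_singleton_iff equiv_class_eq quotientE)
  show "u \<in> H" using assms equiv_R R_iff by (metis Image_singleton_iff quotientE)
qed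

lemma class_eqI: "(u, v) \<in> R \<Longrightarrow> R `` {u} = R `` {v}"
  using equiv_R by (rule equiv_class_eq)

lemma class_selfI: "u \<in> H \<Longrightarrow> u \<in> R `` {u}"
  using equiv_R by (rule equiv_class_self)

lemma class_add_eq:
  assumes "u \<in> H" "v \<in> H"
  shows "class_add R (R `` {u}) (R `` {v}) = R `` {\<lambda>p. u p + v p}"
proof -
  have *: "R `` {\<lambda>p. u' p + v' p} = R `` {\<lambda>p. u p + v p}" if "u' \<in> R `` {u}" "v' \<in> R `` {v}" for u' v'
  proof (rule class_eqI [symmetric])
    show "(\<lambda>p. u p + v p, \<lambda>p. u' p + v' p) \<in> R"
      using that null_sections_add [of "\<lambda>p. u p - u' p" U V m "\<lambda>p. v p - v' p"]
      by (auto simp: R_iff H_def hol_sections_add algebra_simps)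
  qed
  have **: "(\<Union>v'\<in>R `` {v}. R `` {\<lambda>p. u' p + v' p}) = R `` {\<lambda>p. u p + v p}" if "u' \<in> R `` {u}" for u'
    by (rule UN_constant_eq [OF class_selfI [OF assms(2)]]) (intro ballI * that)
  show ?thesis
    unfolding class_add_def by (rule UN_constant_eq [OF class_selfI [OF assms(1)]]) (intro ballI **)
qed

lemma class_scale_eq:
  assumes "u \<in> H"
  shows "class_scale R c (R `` {u}) = R `` {\<lambda>p. c * u p}"
proof -
  have *: "R `` {\<lambda>p. c * u' p} = R `` {\<lambda>p. c * u p}" if "u' \<in> R `` {u}" for u'
  proof (rule class_eqI [symmetric])
    show "(\<lambda>p. c * u p, \<lambda>p. c * u' p) \<in> R"
      using that null_sections_lmul [of "\<lambda>p. u p - u' p" U V m c]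
      by (auto simp: R_iff H_def hol_sections_lmul algebra_simps)
  qed
  show ?thesis
    unfolding class_scale_def by (rule UN_constant_eq [OF class_selfI [OF assms]]) (intro ballI *)
qed

end

text \<open>The condition on a class in \<open>eta_constant_classes\<close> can be tested on any representative.\<close>

lemma eta_constant_classes_iff:
  fixes U :: "('b::{euclidean_space,cnormed} \<times> complex) set"
  assumes o: "\<And>\<alpha>. \<alpha> \<subseteq> {1..m} \<Longrightarrow> open (cover_inter U V \<alpha>)"
    and u: "u \<in> hol_sections (cover_inter U V {1..m})"
  shows "quot_rel U V m `` {u} \<in> eta_constant_classes U V m \<longleftrightarrow> d_eta u \<in> null_sections U V m"
proof -
  let ?R = "quot_rel U V m" and ?H = "hol_sections (cover_inter U V {1..m})"
  note R = R_iff [OF refl refl, of _ _ U V m]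
  have dH: "d_eta v \<in> ?H" if "v \<in> ?H" for v by (rule d_eta_hol_sections [OF o [OF order_refl] that])
  have deq: "?R `` {d_eta v} = ?R `` {d_eta u}" if v: "v \<in> ?R `` {u}" for v
  proof (rule class_eqI [OF refl refl, symmetric])
    have v': "v \<in> ?H" "(\<lambda>p. u p - v p) \<in> null_sections U V m" using v by (auto simp: R)
    have diff: "d_eta (\<lambda>p. u p - v p) p = d_eta u p - d_eta v p" if p: "p \<in> cover_inter U V {1..m}" for p
    proof -
      have c: "cdiff_at u p" "cdiff_at v p" using u v' p by (auto simp: hol_sections_iff)
      have "cderiv (\<lambda>p. u p - v p) p (0, 1) = cderiv u p (0, 1) - cderiv v p (0, 1)"
        by (rule cderiv_eqI [OF has_derivative_diff])
           (auto intro: cdiff_at_has_derivative c simp: cdiff_at_has_derivative(2) [OF c(1)] cdiff_at_has_derivative(2) [OF c(2)] algebra_simps)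
      then show ?thesis by (cases p) (simp add: d_eta_eq_cderiv)
    qed
    have "(\<lambda>p. d_eta u p - d_eta v p) \<in> null_sections U V m"
      by (rule null_sections_cong [OF null_sections_d_eta [OF o v'(2)] diff])
    then show "(d_eta u, d_eta v) \<in> ?R" using dH u v' by (simp add: R)
  qed
  have "class_d_eta ?R (?R `` {u}) = ?R `` {d_eta u}"
    unfolding class_d_eta_def by (rule UN_constant_eq [OF class_selfI [OF refl refl u]]) (intro ballI deq)
  moreover have "?R `` {u} \<in> ?H // ?R" using u by (rule quotientI)
  moreover have "?R `` {d_eta u} = ?R `` {\<lambda>p. 0} \<longleftrightarrow> (d_eta u, \<lambda>p. 0) \<in> ?R"
    using eq_equiv_class_iff [OF equiv_quot_rel dH [OF u] hol_sections_zero] by simp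
  ultimately show ?thesis
    unfolding eta_constant_classes_def using dH [OF u] by (simp add: R hol_sections_zero)
qed

context composition_setting
begin

text \<open>The null sections for \<open>Y\<close> and for the diagonal, and the sections over the sets \<open>V\<^sup>(\<^sup>*\<^sup>)\<close>.\<close>

abbreviation "NY k \<equiv> null_sections (U_Y e k) (V_Y e k) d"
abbreviation "ND \<equiv> null_sections (U_diag e \<kappa>) (V_diag e \<kappa>) CARD('n)"
abbreviation "HY \<equiv> hol_sections (VY_inter e \<kappa> {1..d})"
abbreviation "HY' \<equiv> hol_sections (VY_inter e \<kappa>' {1..d})"
abbreviation "HD \<equiv> hol_sections (VD_inter e \<kappa> {1..CARD('n)})"

lemma card_ge_one: "1 \<le> CARD('n)" by (simp add: Suc_le_eq)

lemma open_admissible_full: "open (admissible {1..CARD('n)} {1..d})" by (rule open_admissible) auto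

text \<open>Linearity in the product \<open>\<psi> u\<close>, stated so that it covers sums in either argument.\<close>

lemma mu_rep_sum:
  assumes "finite I" "\<And>a. a \<in> I \<Longrightarrow> \<psi> a \<in> HD" "\<And>a. a \<in> I \<Longrightarrow> u a \<in> HY" "\<phi> \<in> HD" "v \<in> HY"
    and eq: "\<And>y. y \<in> admissible {1..CARD('n)} {1..d} \<Longrightarrow> \<phi> (to_diag e y) * v (to_Y e y) = (\<Sum>a\<in>I. \<psi> a (to_diag e y) * u a (to_Y e y))"
    and q: "q \<in> VY_inter e \<kappa>' {1..d}"
  shows "mu_rep e \<kappa> \<phi> v q = (\<Sum>a\<in>I. mu_rep e \<kappa> (\<psi> a) (u a) q)"
proof -
  note ctx = e open_admissible_full deformation_family_unit_gamma locally_deformable_unit_gamma [OF order_refl] \<rho>(1)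
  have "stable_integral e \<rho> (integrand e \<phi> v) (unit_gamma \<rho> \<theta>) q = stable_integral e \<rho> (\<lambda>y. \<Sum>a\<in>I. integrand e (\<psi> a) (u a) y) (unit_gamma \<rho> \<theta>) q"
    by (rule stable_integral_cong [OF ctx q _ integrand_hol [OF assms(4,5)]]) (simp add: integrand_eq eq)
  also have "\<dots> = (\<Sum>a\<in>I. stable_integral e \<rho> (integrand e (\<psi> a) (u a)) (unit_gamma \<rho> \<theta>) q)"
    by (rule stable_integral_sum [OF ctx assms(1) _ q]) (intro integrand_hol assms)
  finally show ?thesis by (simp add: mu_rep_eq_stable_integral [OF q])
qed

lemma mu_rep_add:
  assumes "\<psi>1 \<in> HD" "\<psi>2 \<in> HD" "u1 \<in> HY" "u2 \<in> HY" "\<phi> \<in> HD" "v \<in> HY"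
    and eq: "\<And>y. y \<in> admissible {1..CARD('n)} {1..d} \<Longrightarrow> \<phi> (to_diag e y) * v (to_Y e y)
      = \<psi>1 (to_diag e y) * u1 (to_Y e y) + \<psi>2 (to_diag e y) * u2 (to_Y e y)"
    and q: "q \<in> VY_inter e \<kappa>' {1..d}"
  shows "mu_rep e \<kappa> \<phi> v q = mu_rep e \<kappa> \<psi>1 u1 q + mu_rep e \<kappa> \<psi>2 u2 q"
proof -
  have "mu_rep e \<kappa> \<phi> v q = (\<Sum>b\<in>{True, False}. mu_rep e \<kappa> (if b then \<psi>1 else \<psi>2) (if b then u1 else u2) q)"
    by (rule mu_rep_sum) (use assms in auto)
  then show ?thesis by simp
qed

lemma mu_rep_scale:
  assumes "\<psi> \<in> HD" "u \<in> HY" "q \<in> VY_inter e \<kappa>' {1..d}"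
  shows "mu_rep e \<kappa> (\<lambda>p. c * \<psi> p) u q = c * mu_rep e \<kappa> \<psi> u q"
    and "mu_rep e \<kappa> \<psi> (\<lambda>p. c * u p) q = c * mu_rep e \<kappa> \<psi> u q"
proof -
  note ctx = e open_admissible_full deformation_family_unit_gamma locally_deformable_unit_gamma [OF order_refl] \<rho>(1)
  have "stable_integral e \<rho> (\<lambda>p. c * integrand e \<psi> u p) (unit_gamma \<rho> \<theta>) q = c * stable_integral e \<rho> (integrand e \<psi> u) (unit_gamma \<rho> \<theta>) q"
    using stable_integral_lmul [OF eventually_scaled_integral_eq [OF ctx integrand_hol [OF assms(1,2)] assms(3)], of "\<lambda>p. c"] .
  then show "mu_rep e \<kappa> (\<lambda>p. c * \<psi> p) u q = c * mu_rep e \<kappa> \<psi> u q"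
    and "mu_rep e \<kappa> \<psi> (\<lambda>p. c * u p) q = c * mu_rep e \<kappa> \<psi> u q"
    by (simp_all add: mu_rep_eq_stable_integral [OF assms(3)] integrand_eq mult_ac)
qed

lemma admissible_memD: "y \<in> admissible A B \<Longrightarrow> to_diag e y \<in> VD_inter e \<kappa> A" "y \<in> admissible A B \<Longrightarrow> to_Y e y \<in> VY_inter e \<kappa> B"
  by (auto simp: admissible_def)

lemma mu_rep_null_sections_Y:
  assumes \<psi>: "\<psi> \<in> HD" and w: "w \<in> HY" "w \<in> NY \<kappa>"
  shows "mu_rep e \<kappa> \<psi> w \<in> NY \<kappa>'"
proof -
  obtain h where h: "\<And>\<alpha>. \<alpha> \<in> P_vee d \<Longrightarrow> h \<alpha> \<in> hol_sections (VY_inter e \<kappa> \<alpha>)"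
     and eq: "\<And>p. p \<in> VY_inter e \<kappa> {1..d} \<Longrightarrow> w p = (\<Sum>\<alpha>\<in>P_vee d. h \<alpha> p)"
    using w(2) by (auto simp: null_sections_def VY_inter_def)
  have hY: "h \<alpha> \<in> HY" if "\<alpha> \<in> P_vee d" for \<alpha>
    using h [OF that] VY_inter_mono [OF P_vee_subset [OF that]] by (rule hol_sections_mono)
  have "mu_rep e \<kappa> \<psi> w q = (\<Sum>\<alpha>\<in>P_vee d. mu_rep e \<kappa> \<psi> (h \<alpha>) q)" if q: "q \<in> VY_inter e \<kappa>' {1..d}" for q
    by (rule mu_rep_sum [OF finite_P_vee \<psi> hY \<psi> w(1) _ q]) (simp_all add: eq admissible_memD sum_distrib_left)
  moreover have "mu_rep e \<kappa> \<psi> (h \<alpha>) \<in> hol_sections (VY_inter e \<kappa>' \<alpha>)" if "\<alpha> \<in> P_vee d" for \<alpha>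
    using mu_rep_hol [OF P_vee_subset [OF that] \<psi> h [OF that]] .
  ultimately show ?thesis
    unfolding null_sections_def VY_inter_def [symmetric] by (intro CollectI exI [of _ "\<lambda>\<alpha>. mu_rep e \<kappa> \<psi> (h \<alpha>)"]) auto
qed

text \<open>Of the summands of a null section on the diagonal only the one for \<open>{2, \<dots>, n}\<close> contributes.\<close>

lemma mu_rep_null_sections_D:
  assumes w: "w \<in> HD" "w \<in> ND" and u: "u \<in> HY"
  shows "mu_rep e \<kappa> w u \<in> NY \<kappa>'"
proof -
  obtain h where h: "\<And>\<alpha>. \<alpha> \<in> P_vee CARD('n) \<Longrightarrow> h \<alpha> \<in> hol_sections (VD_inter e \<kappa> \<alpha>)"
     and eq: "\<And>p. p \<in> VD_inter e \<kappa> {1..CARD('n)} \<Longrightarrow> w p = (\<Sum>\<alpha>\<in>P_vee CARD('n). h \<alpha> p)"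
    using w(2) by (auto simp: null_sections_def VD_inter_def)
  let ?t = "{2..CARD('n)}"
  have t: "?t \<in> P_vee CARD('n)" by (rule P_vee_tail [OF card_ge_one])
  have hD: "h \<alpha> \<in> HD" if "\<alpha> \<in> P_vee CARD('n)" for \<alpha>
    using h [OF that] VD_inter_mono [OF P_vee_subset [OF that]] by (rule hol_sections_mono)
  have "mu_rep e \<kappa> w u q = stable_integral e \<rho> (integrand e (h ?t) u) chord q" if q: "q \<in> VY_inter e \<kappa>' {1..d}" for q
  proof -
    have "mu_rep e \<kappa> w u q = (\<Sum>\<alpha>\<in>P_vee CARD('n). mu_rep e \<kappa> (h \<alpha>) u q)"
      by (rule mu_rep_sum [OF finite_P_vee hD u w(1) u _ q]) (simp_all add: eq admissible_memD sum_distrib_right)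
    also have "\<dots> = (\<Sum>\<alpha>\<in>P_vee CARD('n). if \<alpha> = ?t then mu_rep e \<kappa> (h ?t) u q else 0)"
    proof (rule sum.cong [OF refl])
      fix \<alpha> assume \<alpha>: "\<alpha> \<in> P_vee CARD('n)"
      then obtain j where j: "j \<in> {1..CARD('n)}" "\<alpha> = {1..CARD('n)} - {j}" using P_vee_cases card_ge_one by blast
      show "mu_rep e \<kappa> (h \<alpha>) u q = (if \<alpha> = ?t then mu_rep e \<kappa> (h ?t) u q else 0)"
      proof (cases "j = 1")
        case True
        then show ?thesis using j tail_eq [of "CARD('n)"] by simp
      next
        case False
        then have "1 \<in> \<alpha>" using j(2) card_ge_one by simp
        moreover have "1 \<notin> ?t" by simp
        ultimately have "\<alpha> \<noteq> ?t" by metis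
        moreover have "mu_rep e \<kappa> (h \<alpha>) u q = 0"
          using h [OF \<alpha>] u q j False by (intro mu_rep_null [of _ j]) auto
        ultimately show ?thesis by simp
      qed
    qed
    also have "\<dots> = mu_rep e \<kappa> (h ?t) u q" using t by (simp add: finite_P_vee)
    also have "\<dots> = stable_integral e \<rho> (integrand e (h ?t) u) chord q" by (rule mu_rep_chord [OF h [OF t] u q])
    finally show ?thesis .
  qed
  moreover have "stable_integral e \<rho> (integrand e (h ?t) u) chord \<in> NY \<kappa>'"
    using stable_integral_chord_hol [OF h [OF t] u] d by (intro null_sections_single [of _ _ _ "{2..d}"]) (simp_all add: VY_inter_def P_vee_tail)
  ultimately show ?thesis by (rule_tac null_sections_cong) (auto simp: VY_inter_def)
qed

lemma mu_rep_in_HY': "\<psi> \<in> HD \<Longrightarrow> u \<in> HY \<Longrightarrow> mu_rep e \<kappa> \<psi> u \<in> HY'"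
  by (rule mu_rep_hol) auto

lemma d_eta_mu_rep_null_sections:
  assumes \<psi>: "\<psi> \<in> HD" "d_eta \<psi> \<in> ND" and u: "u \<in> HY" "d_eta u \<in> NY \<kappa>"
  shows "d_eta (mu_rep e \<kappa> \<psi> u) \<in> NY \<kappa>'"
proof -
  have d\<psi>: "d_eta \<psi> \<in> HD" by (rule d_eta_hol_sections [OF open_VD_inter [OF \<theta>] \<psi>(1)]) auto
  have du: "d_eta u \<in> HY" by (rule d_eta_hol_sections [OF open_VY_inter [OF \<theta>] u(1)]) auto
  have "stable_integral e \<rho> (boundary (integrand e \<psi> u)) unit_path \<in> NY \<kappa>'"
    using stable_integral_boundary_hol [OF \<psi>(1) u(1)] d
    by (intro null_sections_single [of _ _ _ "{2..d}"]) (simp_all add: VY_inter_def P_vee_tail)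
  then have "(\<lambda>q. stable_integral e \<rho> (boundary (integrand e \<psi> u)) unit_path q
     + (mu_rep e \<kappa> (d_eta \<psi>) u q + mu_rep e \<kappa> \<psi> (d_eta u) q)) \<in> NY \<kappa>'"
    using mu_rep_null_sections_D [OF d\<psi> \<psi>(2) u(1)] mu_rep_null_sections_Y [OF \<psi>(1) du u(2)]
    by (intro null_sections_add)
  then show ?thesis
    by (rule null_sections_cong) (simp add: d_eta_mu_rep [OF \<psi>(1) u(1)] VY_inter_def)
qed

lemma ER_rel_iff: "(\<psi>, \<psi>') \<in> ER_rel e \<kappa> \<longleftrightarrow> \<psi> \<in> HD \<and> \<psi>' \<in> HD \<and> (\<lambda>p. \<psi> p - \<psi>' p) \<in> ND"
  by (simp add: ER_rel_def quot_rel_iff VD_inter_def)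

lemma CR_rel_iff: "(u, v) \<in> CR_rel e d k \<longleftrightarrow> u \<in> hol_sections (VY_inter e k {1..d}) \<and> v \<in> hol_sections (VY_inter e k {1..d}) \<and>
    (\<lambda>p. u p - v p) \<in> NY k"
  by (simp add: CR_rel_def quot_rel_iff VY_inter_def)

lemma mu_rep_respects:
  assumes \<psi>: "(\<psi>, \<psi>') \<in> ER_rel e \<kappa>" and u: "(u, u') \<in> CR_rel e d \<kappa>"
  shows "(mu_rep e \<kappa> \<psi> u, mu_rep e \<kappa> \<psi>' u') \<in> CR_rel e d \<kappa>'"
proof -
  have *: "\<psi> \<in> HD" "\<psi>' \<in> HD" "(\<lambda>p. \<psi> p - \<psi>' p) \<in> ND" "u \<in> HY" "u' \<in> HY" "(\<lambda>p. u p - u' p) \<in> NY \<kappa>"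
    using \<psi> u by (auto simp: ER_rel_iff CR_rel_iff)
  have dD: "(\<lambda>p. \<psi> p - \<psi>' p) \<in> HD" and dY: "(\<lambda>p. u p - u' p) \<in> HY"
    using * by (auto intro: hol_sections_diff)
  have "mu_rep e \<kappa> \<psi> u q - mu_rep e \<kappa> \<psi>' u' q = mu_rep e \<kappa> (\<lambda>p. \<psi> p - \<psi>' p) u q + mu_rep e \<kappa> \<psi>' (\<lambda>p. u p - u' p) q"
    if q: "q \<in> VY_inter e \<kappa>' {1..d}" for q
  proof -
    have "mu_rep e \<kappa> \<psi> u q = mu_rep e \<kappa> (\<lambda>p. \<psi> p - \<psi>' p) u q + mu_rep e \<kappa> \<psi>' u q"
      by (rule mu_rep_add [OF dD *(2) *(4) *(4) *(1) *(4) _ q]) (simp add: algebra_simps)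
    moreover have "mu_rep e \<kappa> \<psi>' u q = mu_rep e \<kappa> \<psi>' (\<lambda>p. u p - u' p) q + mu_rep e \<kappa> \<psi>' u' q"
      by (rule mu_rep_add [OF *(2) *(2) dY *(5) *(2) *(4) _ q]) (simp add: algebra_simps)
    ultimately show ?thesis by simp
  qed
  then have "(\<lambda>q. mu_rep e \<kappa> \<psi> u q - mu_rep e \<kappa> \<psi>' u' q) \<in> NY \<kappa>'"
    using null_sections_add [OF mu_rep_null_sections_D [OF dD *(3,4)] mu_rep_null_sections_Y [OF *(2) dY *(6)]]
    by (rule_tac null_sections_cong) (auto simp: VY_inter_def)
  then show ?thesis
    unfolding CR_rel_iff by (intro conjI mu_rep_in_HY' *)
qed

lemma mu_classes:
  assumes "\<psi> \<in> HD" "u \<in> HY"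
  shows "mu e d \<kappa> \<kappa>' (ER_rel e \<kappa> `` {\<psi>}) (CR_rel e d \<kappa> `` {u}) = CR_rel e d \<kappa>' `` {mu_rep e \<kappa> \<psi> u}"
proof -
  have "CR_rel e d \<kappa>' `` {mu_rep e \<kappa> \<psi>' u'} = CR_rel e d \<kappa>' `` {mu_rep e \<kappa> \<psi> u}"
    if "\<psi>' \<in> ER_rel e \<kappa> `` {\<psi>}" "u' \<in> CR_rel e d \<kappa> `` {u}" for \<psi>' u'
    using class_eqI [OF CR_rel_def refl mu_rep_respects, of \<psi> \<psi>' u u'] that by simp
  moreover have "\<psi> \<in> ER_rel e \<kappa> `` {\<psi>}"
    using class_selfI [OF ER_rel_def refl assms(1) [unfolded VD_inter_def]] .
  moreover have "u \<in> CR_rel e d \<kappa> `` {u}"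
    using class_selfI [OF CR_rel_def refl assms(2) [unfolded VY_inter_def]] .
  ultimately show ?thesis unfolding mu_def by blast
qed

lemma ER_memD:
  assumes "K \<in> ER e \<kappa>" "\<psi> \<in> K"
  shows "\<psi> \<in> HD" "K = ER_rel e \<kappa> `` {\<psi>}" "d_eta \<psi> \<in> ND"
proof -
  have K: "K \<in> eta_constant_classes (U_diag e \<kappa>) (V_diag e \<kappa>) CARD('n)" using assms by (simp add: ER_def)
  then have K': "K \<in> hol_sections (cover_inter (U_diag e \<kappa>) (V_diag e \<kappa>) {1..CARD('n)}) // quot_rel (U_diag e \<kappa>) (V_diag e \<kappa>) CARD('n)"
    by (simp add: eta_constant_classes_def)
  note q = quotient_memD [OF refl refl K' assms(2)]
  show "\<psi> \<in> HD" "K = ER_rel e \<kappa> `` {\<psi>}" using q by (auto simp: VD_inter_def ER_rel_def)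
  have "open (cover_inter (U_diag e \<kappa>) (V_diag e \<kappa>) \<alpha>)" if "\<alpha> \<subseteq> {1..CARD('n)}" for \<alpha>
    using open_VD_inter [OF \<theta> finite_subset [OF that]] by (simp add: VD_inter_def)
  from eta_constant_classes_iff [OF this q(1)] K q(2) show "d_eta \<psi> \<in> ND" by simp
qed

lemma open_cover_Y:
  assumes "0 < t" "t < pi / 2" "\<alpha> \<subseteq> {1..d}"
  shows "open (cover_inter (U_Y e (a, b, c, t)) (V_Y e (a, b, c, t)) \<alpha>)"
  using open_VY_inter [OF assms(1,2) finite_subset [OF assms(3)]] by (simp add: VY_inter_def)

lemma CR_memD:
  assumes "f \<in> CR e d \<kappa>" "u \<in> f"
  shows "u \<in> HY" "f = CR_rel e d \<kappa> `` {u}" "d_eta u \<in> NY \<kappa>"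
proof -
  have f: "f \<in> eta_constant_classes (U_Y e \<kappa>) (V_Y e \<kappa>) d" using assms by (simp add: CR_def)
  then have f': "f \<in> hol_sections (cover_inter (U_Y e \<kappa>) (V_Y e \<kappa>) {1..d}) // quot_rel (U_Y e \<kappa>) (V_Y e \<kappa>) d"
    by (simp add: eta_constant_classes_def)
  note q = quotient_memD [OF refl refl f' assms(2)]
  show "u \<in> HY" "f = CR_rel e d \<kappa> `` {u}" using q by (auto simp: VY_inter_def CR_rel_def)
  from eta_constant_classes_iff [OF open_cover_Y [OF \<theta>] q(1)] f q(2) show "d_eta u \<in> NY \<kappa>" by simp
qed

lemma CR_nonempty: "f \<in> CR e d \<kappa> \<Longrightarrow> \<exists>u. u \<in> f"
  using class_selfI [OF refl refl] unfolding CR_def eta_constant_classes_def quotient_def by fastforce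

lemma ER_nonempty: "K \<in> ER e \<kappa> \<Longrightarrow> \<exists>\<psi>. \<psi> \<in> K"
  using class_selfI [OF refl refl] unfolding ER_def eta_constant_classes_def quotient_def by fastforce

lemma mu_in_CR:
  assumes "K \<in> ER e \<kappa>" "f \<in> CR e d \<kappa>"
  shows "mu e d \<kappa> \<kappa>' K f \<in> CR e d \<kappa>'"
proof -
  obtain \<psi> u where pu: "\<psi> \<in> K" "u \<in> f" using assms CR_nonempty ER_nonempty by blast
  note K = ER_memD [OF assms(1) pu(1)] and f = CR_memD [OF assms(2) pu(2)]
  have m: "mu_rep e \<kappa> \<psi> u \<in> hol_sections (cover_inter (U_Y e \<kappa>') (V_Y e \<kappa>') {1..d})"
    using mu_rep_in_HY' [OF K(1) f(1)] by (simp add: VY_inter_def)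
  have "mu e d \<kappa> \<kappa>' K f = CR_rel e d \<kappa>' `` {mu_rep e \<kappa> \<psi> u}"
    using mu_classes [OF K(1) f(1)] K(2) f(2) by simp
  then show ?thesis
    using eta_constant_classes_iff [OF open_cover_Y [OF \<tau>] m] d_eta_mu_rep_null_sections [OF K(1,3) f(1,3)]
    by (simp add: CR_def CR_rel_def)
qed

lemma CR_class_eqI:
  assumes "v \<in> HY'" "w \<in> HY'" "\<And>q. q \<in> VY_inter e \<kappa>' {1..d} \<Longrightarrow> v q = w q"
  shows "CR_rel e d \<kappa>' `` {v} = CR_rel e d \<kappa>' `` {w}"
proof (rule class_eqI [OF CR_rel_def refl])
  have "(\<lambda>p. v p - w p) \<in> NY \<kappa>'"
    by (rule null_sections_cong [OF null_sections_zero]) (simp add: assms(3) VY_inter_def)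
  then show "(v, w) \<in> CR_rel e d \<kappa>'" using assms by (simp add: CR_rel_iff)
qed

lemma class_add_CR: "u \<in> hol_sections (VY_inter e k {1..d}) \<Longrightarrow> v \<in> hol_sections (VY_inter e k {1..d}) \<Longrightarrow>
    class_add (CR_rel e d k) (CR_rel e d k `` {u}) (CR_rel e d k `` {v}) = CR_rel e d k `` {\<lambda>p. u p + v p}"
  by (rule class_add_eq [OF CR_rel_def refl]) (simp_all add: VY_inter_def)

lemma class_scale_CR: "u \<in> hol_sections (VY_inter e k {1..d}) \<Longrightarrow>
    class_scale (CR_rel e d k) c (CR_rel e d k `` {u}) = CR_rel e d k `` {\<lambda>p. c * u p}"
  by (rule class_scale_eq [OF CR_rel_def refl]) (simp_all add: VY_inter_def)

lemma class_add_ER: "u \<in> HD \<Longrightarrow> v \<in> HD \<Longrightarrow>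
    class_add (ER_rel e \<kappa>) (ER_rel e \<kappa> `` {u}) (ER_rel e \<kappa> `` {v}) = ER_rel e \<kappa> `` {\<lambda>p. u p + v p}"
  by (rule class_add_eq [OF ER_rel_def refl]) (simp_all add: VD_inter_def)

lemma class_scale_ER: "u \<in> HD \<Longrightarrow>
    class_scale (ER_rel e \<kappa>) c (ER_rel e \<kappa> `` {u}) = ER_rel e \<kappa> `` {\<lambda>p. c * u p}"
  by (rule class_scale_eq [OF ER_rel_def refl]) (simp_all add: VD_inter_def)

lemma mu_linear_left:
  assumes "f \<in> CR e d \<kappa>"
  shows "linear_classes (ER_rel e \<kappa>) (ER e \<kappa>) (CR_rel e d \<kappa>') (CR e d \<kappa>') (\<lambda>K. mu e d \<kappa> \<kappa>' K f)"
  unfolding linear_classes_def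
proof (intro conjI ballI allI)
  show "mu e d \<kappa> \<kappa>' K f \<in> CR e d \<kappa>'" if "K \<in> ER e \<kappa>" for K by (rule mu_in_CR [OF that assms])
  obtain u where u: "u \<in> f" using CR_nonempty [OF assms] by blast
  note f = CR_memD [OF assms u]
  fix K assume "K \<in> ER e \<kappa>"
  then obtain \<psi> where "\<psi> \<in> K" using ER_nonempty by blast
  note K = ER_memD [OF \<open>K \<in> ER e \<kappa>\<close> this]
  show "mu e d \<kappa> \<kappa>' (class_scale (ER_rel e \<kappa>) c K) f = class_scale (CR_rel e d \<kappa>') c (mu e d \<kappa> \<kappa>' K f)" for c
    unfolding K(2) f(2) class_scale_ER [OF K(1)] mu_classes [OF K(1) f(1)]
      mu_classes [OF hol_sections_lmul [OF K(1)] f(1)] class_scale_CR [OF mu_rep_in_HY' [OF K(1) f(1)]]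
    using K(1) f(1)
    by (intro CR_class_eqI mu_rep_in_HY' hol_sections_lmul mu_rep_scale)
  fix L assume "L \<in> ER e \<kappa>"
  then obtain \<phi> where "\<phi> \<in> L" using ER_nonempty by blast
  note L = ER_memD [OF \<open>L \<in> ER e \<kappa>\<close> this]
  show "mu e d \<kappa> \<kappa>' (class_add (ER_rel e \<kappa>) K L) f =
      class_add (CR_rel e d \<kappa>') (mu e d \<kappa> \<kappa>' K f) (mu e d \<kappa> \<kappa>' L f)"
    unfolding K(2) L(2) f(2) class_add_ER [OF K(1) L(1)] mu_classes [OF K(1) f(1)] mu_classes [OF L(1) f(1)]
      mu_classes [OF hol_sections_add [OF K(1) L(1)] f(1)]
      class_add_CR [OF mu_rep_in_HY' [OF K(1) f(1)] mu_rep_in_HY' [OF L(1) f(1)]]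
    using K(1) L(1) f(1)
    by (intro CR_class_eqI mu_rep_in_HY' hol_sections_add mu_rep_add) (simp_all add: algebra_simps)
qed

lemma mu_linear_right:
  assumes "K \<in> ER e \<kappa>"
  shows "linear_classes (CR_rel e d \<kappa>) (CR e d \<kappa>) (CR_rel e d \<kappa>') (CR e d \<kappa>') (\<lambda>f. mu e d \<kappa> \<kappa>' K f)"
  unfolding linear_classes_def
proof (intro conjI ballI allI)
  show "mu e d \<kappa> \<kappa>' K f \<in> CR e d \<kappa>'" if "f \<in> CR e d \<kappa>" for f by (rule mu_in_CR [OF assms that])
  obtain \<psi> where \<psi>: "\<psi> \<in> K" using ER_nonempty [OF assms] by blast
  note K = ER_memD [OF assms \<psi>]
  fix f assume "f \<in> CR e d \<kappa>"
  then obtain u where "u \<in> f" using CR_nonempty by blast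
  note f = CR_memD [OF \<open>f \<in> CR e d \<kappa>\<close> this]
  show "mu e d \<kappa> \<kappa>' K (class_scale (CR_rel e d \<kappa>) c f) = class_scale (CR_rel e d \<kappa>') c (mu e d \<kappa> \<kappa>' K f)" for c
    unfolding K(2) f(2) class_scale_CR [OF f(1)] mu_classes [OF K(1) f(1)]
      mu_classes [OF K(1) hol_sections_lmul [OF f(1)]] class_scale_CR [OF mu_rep_in_HY' [OF K(1) f(1)]]
    using K(1) f(1)
    by (intro CR_class_eqI mu_rep_in_HY' hol_sections_lmul mu_rep_scale)
  fix g assume "g \<in> CR e d \<kappa>"
  then obtain v where "v \<in> g" using CR_nonempty by blast
  note g = CR_memD [OF \<open>g \<in> CR e d \<kappa>\<close> this]
  show "mu e d \<kappa> \<kappa>' K (class_add (CR_rel e d \<kappa>) f g) =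
      class_add (CR_rel e d \<kappa>') (mu e d \<kappa> \<kappa>' K f) (mu e d \<kappa> \<kappa>' K g)"
    unfolding K(2) g(2) f(2) class_add_CR [OF f(1) g(1)] mu_classes [OF K(1) f(1)] mu_classes [OF K(1) g(1)]
      mu_classes [OF K(1) hol_sections_add [OF f(1) g(1)]]
      class_add_CR [OF mu_rep_in_HY' [OF K(1) f(1)] mu_rep_in_HY' [OF K(1) g(1)]]
    using K(1) g(1) f(1)
    by (intro CR_class_eqI mu_rep_in_HY' hol_sections_add mu_rep_add) (simp_all add: algebra_simps)
qed

lemma mu_well_defined:
  assumes "K \<in> ER e \<kappa>" "f \<in> CR e d \<kappa>" "\<psi> \<in> K" "u \<in> f"
  shows "(z, \<eta>) \<in> V_Y_star e d \<kappa>' \<Longrightarrow> \<exists>c. \<forall>\<^sub>F \<epsilon> in at_right 0. gamma_integral e \<kappa> \<epsilon> \<psi> u z \<eta> = c"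
    and "mu_rep e \<kappa> \<psi> u \<in> hol_sections (V_Y_star e d \<kappa>')"
    and "mu e d \<kappa> \<kappa>' K f = CR_rel e d \<kappa>' `` {mu_rep e \<kappa> \<psi> u}"
proof -
  note K = ER_memD [OF assms(1,3)] and f = CR_memD [OF assms(2,4)]
  show "\<exists>c. \<forall>\<^sub>F \<epsilon> in at_right 0. gamma_integral e \<kappa> \<epsilon> \<psi> u z \<eta> = c" if "(z, \<eta>) \<in> V_Y_star e d \<kappa>'"
    using eventually_gamma_integral [OF order_refl K(1) f(1)] that by (auto simp: V_Y_star_def VY_inter_def)
  show "mu_rep e \<kappa> \<psi> u \<in> hol_sections (V_Y_star e d \<kappa>')"
    using mu_rep_in_HY' [OF K(1) f(1)] by (simp add: V_Y_star_def VY_inter_def)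
  show "mu e d \<kappa> \<kappa>' K f = CR_rel e d \<kappa>' `` {mu_rep e \<kappa> \<psi> u}"
    using mu_classes [OF K(1) f(1)] K(2) f(2) by simp
qed

end

theorem theorem3p5:
  fixes e :: "nat \<Rightarrow> 'n::finite" and d :: nat
    and r r' \<rho> \<theta> s s' \<sigma> \<tau> :: real
    and \<kappa> \<kappa>' :: kappa
  assumes "bij_betw e {1..CARD('n)} UNIV"
    and "1 \<le> d" and "d \<le> CARD('n)"
    and "\<kappa> = (r, r', \<rho>, \<theta>)" and "\<kappa>' = (s, s', \<sigma>, \<tau>)"
    and "0 < r'" and "0 < \<theta>" and "\<theta> < pi / 2" and "0 < \<rho>" and "\<rho> < 1" and "0 < r" and "r < \<rho> * r'"
    and "0 < s'" and "0 < \<tau>" and "\<tau> < pi / 2" and "0 < \<sigma>" and "\<sigma> < 1" and "0 < s" and "s < \<sigma> * s'"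
    and "s < r" and "s' < r' / 2" and "\<tau> < \<theta> / 4" and "\<sigma> < \<rho> / 2 * sin (\<theta> / 4)"
  shows
    "(\<forall>z \<eta>. (z, \<eta>) \<in> V_Y_star e d \<kappa>' \<longrightarrow>
        (\<forall>\<^sub>F \<epsilon> in at_right 0. \<forall>w\<in>gamma_image e \<kappa> \<epsilon> z \<eta>.
           ((z, w), \<eta>) \<in> V_diag_star e \<kappa> \<and> (w, \<eta>) \<in> V_Y_star e d \<kappa>)) \<and>
     (\<forall>K\<in>ER e \<kappa>. \<forall>f\<in>CR e d \<kappa>. \<forall>\<psi>\<in>K. \<forall>u\<in>f.
        (\<forall>z \<eta>. (z, \<eta>) \<in> V_Y_star e d \<kappa>' \<longrightarrow>
           (\<exists>c. \<forall>\<^sub>F \<epsilon> in at_right 0. gamma_integral e \<kappa> \<epsilon> \<psi> u z \<eta> = c)) \<and>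
        mu_rep e \<kappa> \<psi> u \<in> hol_sections (V_Y_star e d \<kappa>') \<and>
        mu e d \<kappa> \<kappa>' K f = CR_rel e d \<kappa>' `` {mu_rep e \<kappa> \<psi> u}) \<and>
     (\<forall>f\<in>CR e d \<kappa>. linear_classes (ER_rel e \<kappa>) (ER e \<kappa>) (CR_rel e d \<kappa>') (CR e d \<kappa>')
        (\<lambda>K. mu e d \<kappa> \<kappa>' K f)) \<and>
     (\<forall>K\<in>ER e \<kappa>. linear_classes (CR_rel e d \<kappa>) (CR e d \<kappa>) (CR_rel e d \<kappa>') (CR e d \<kappa>')
        (\<lambda>f. mu e d \<kappa> \<kappa>' K f))"
proof -
  interpret composition_setting e d r r' \<rho> \<theta> s s' \<sigma> \<tau>
    using assms by unfold_locales
  have "\<forall>\<^sub>F \<epsilon> in at_right 0. \<forall>w\<in>gamma_image e (r, r', \<rho>, \<theta>) \<epsilon> z \<eta>.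
      ((z, w), \<eta>) \<in> V_diag_star e (r, r', \<rho>, \<theta>) \<and> (w, \<eta>) \<in> V_Y_star e d (r, r', \<rho>, \<theta>)"
    if "(z, \<eta>) \<in> V_Y_star e d (s, s', \<sigma>, \<tau>)" for z \<eta>
    using gamma_image_in [of z \<eta>] that by (simp add: V_Y_star_def V_diag_star_def VY_inter_def VD_inter_def)
  then show ?thesis
    unfolding assms(4,5)
    by (intro conjI ballI allI impI mu_well_defined mu_linear_left mu_linear_right) auto
qed

end
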